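(* Let $r \geq 1$ be an integer. Let $(\gamma_l)_{l\geq 1}$ be complex numbers with $|\gamma_l|\leq 1$ for all $l$, supported on $r$-th powers, i.e. $\gamma_l = 0$ unless $l=k^r$ for some positive integer $k$. With $A_d(x)$ and $M_d(x)$ defined from $(\gamma_l)$ as in the context, for all real $x\geq 2$ and all real $D$ with $\sqrt{x} \leq D \leq x^{(r+1)/(2r)}$ we have $$\sum_{d\leq D} \left| A_d(x) - M_d(x) \right| \ll D^{1/4}\, x^{3(r+1)/(8r)} (\log x)^{65.25},$$ where the sum is over positive integers $d \le D$ and the implied constant may depend on $r$ but not on $x$, $D$ or the sequence $(\gamma_l)$.
   Context: For positive integers $n$, set $$a_n = \sum_{\substack{l^2+m^2=n \\ (l,m)=1}} \gamma_l,$$ where $l,m$ run over positive integers and $(l,m)$ is the greatest common divisor. For a positive integer $d$ and real $x$ set $$A_d(x) = \sum_{\substack{n\leq x \\ d\mid n}} a_n, \qquad M_d(x) = \frac{\rho(d)}{d} \sum_{\substack{l<\sqrt{x} \\ (l,d)=1}} \gamma_l \frac{\varphi(l)}{l} \sqrt{x-l^2},$$ where $l$ runs over positive integers, $\varphi$ is Euler's totient function, and $\rho(d)$ is the number of solutions $\nu$ modulo $d$ of the congruence $\nu^2+1\equiv 0 \pmod d$. The notation $F \ll G$ means $|F| \leq C\,G$ for some constant $C>0$ (the implied constant). *)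

theory Defs
  imports Complex_Main "HOL-Number_Theory.Number_Theory"
begin

definition a_coeff :: "(nat \<Rightarrow> complex) \<Rightarrow> nat \<Rightarrow> complex" where
  "a_coeff \<gamma> n =
     (\<Sum>(l, m) \<in> {(l, m). l > 0 \<and> m > 0 \<and> l\<^sup>2 + m\<^sup>2 = n \<and> coprime l m}. \<gamma> l)"

definition A_sum :: "(nat \<Rightarrow> complex) \<Rightarrow> nat \<Rightarrow> real \<Rightarrow> complex" where
  "A_sum \<gamma> d x = (\<Sum>n \<in> {n. n > 0 \<and> real n \<le> x \<and> d dvd n}. a_coeff \<gamma> n)"

definition rho :: "nat \<Rightarrow> nat" where
  "rho d = card {\<nu> \<in> {0..<d}. [\<nu>\<^sup>2 + 1 = 0] (mod d)}"

definition M_main :: "(nat \<Rightarrow> complex) \<Rightarrow> nat \<Rightarrow> real \<Rightarrow> complex" where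
  "M_main \<gamma> d x =
     of_real (real (rho d) / real d) *
     (\<Sum>l \<in> {l. l > 0 \<and> real l < sqrt x \<and> coprime l d}.
        \<gamma> l * of_real (real (totient l) / real l * sqrt (x - (real l)\<^sup>2)))"

text \<open>Since \<open>sum\<close> vanishes on infinite sets, we record that all index sets are finite.\<close>

lemma finite_nat_real_le: "finite {n::nat. real n \<le> x}"
  by (rule finite_subset[of _ "{..nat \<lfloor>x\<rfloor>}"]) (auto simp: le_nat_floor)

lemma finite_a_coeff_index:
  "finite {(l, m). l > 0 \<and> m > 0 \<and> l\<^sup>2 + m\<^sup>2 = n \<and> coprime l (m::nat)}"
proof (rule finite_subset)
  have "l \<le> l\<^sup>2 + m\<^sup>2 \<and> m \<le> l\<^sup>2 + m\<^sup>2" for l m :: nat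
    using self_le_power[of l 2] self_le_power[of m 2]
    by (cases "l = 0"; cases "m = 0") auto
  then show "{(l, m). l > 0 \<and> m > 0 \<and> l\<^sup>2 + m\<^sup>2 = n \<and> coprime l m} \<subseteq> {..n} \<times> {..n}"
    by auto
qed auto

lemma finite_A_sum_index: "finite {n::nat. n > 0 \<and> real n \<le> x \<and> d dvd n}"
  by (rule finite_subset[OF _ finite_nat_real_le[of x]]) auto

lemma finite_M_main_index: "finite {l::nat. l > 0 \<and> real l < sqrt x \<and> coprime l d}"
  by (rule finite_subset[OF _ finite_nat_real_le[of "sqrt x"]]) auto

lemma finite_modulus_index: "finite {d::nat. d > 0 \<and> real d \<le> D}"
  by (rule finite_subset[OF _ finite_nat_real_le[of D]]) auto

end

theory Submission
  imports Defs "HOL-Analysis.Analysis" "HOL-Computational_Algebra.Squarefree"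
begin

text \<open>
  Splitting the condition \<open>d dvd l\<^sup>2 + m\<^sup>2\<close> over the roots \<open>\<nu>\<close> of \<open>\<nu>\<^sup>2 + 1 = 0\<close> modulo \<open>d\<close> turns \<open>A_d\<close> into
  counts of \<open>m = \<nu> l\<close> modulo \<open>d\<close> in symmetric intervals; Moebius inversion over a common divisor \<open>b\<close> of \<open>m\<close>
  and of the base \<open>t\<close> of \<open>l = t ^ r\<close> removes the coprimality condition. Let \<open>X = x powr ((r + 1) / (2 * r))\<close>.
  The intervals are smoothed at the relative scale \<open>\<eta> = (D / X) powr (1/4)\<close> and the counts expanded in finite
  Fourier series modulo \<open>d\<close>. If \<open>\<nu>\<^sup>2 + 1 = c d\<close> and \<open>\<nu>'\<^sup>2 + 1 = c' d'\<close>, then \<open>c d' + c' d - 2 \<nu> \<nu>' - 2\<close> is an integer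
  equal to \<open>((\<nu> d' - \<nu>' d)\<^sup>2 + (d' - d)\<^sup>2) / (d d')\<close>, so the fractions \<open>\<nu> / d\<close> with \<open>d\<close> in a dyadic block are
  separated by a constant times \<open>1 / d\<close>, and the large sieve bounds the exponential sums by \<open>sqrt (D * X) / \<eta>\<close>.
  The smoothing error is majorised by a difference of smooth counts and costs \<open>\<eta> * X\<close>; both terms equal
  \<open>D powr (1/4) * X powr (3/4)\<close>. All other losses are powers of \<open>log x\<close>, measured by an exponent \<open>K\<close> with \<open>x < 2 ^ K\<close>.
\<close>

section \<open>The large sieve for roots of \<open>\<nu>\<^sup>2 + 1\<close>\<close>

text \<open>The large sieve needs coefficients that are the same at all points, but the Fourier
  coefficient at frequency h depends on the modulus: for an interval of half-length
  \<open>M t\<close> it oscillates in d with phase \<open>M t * h / d\<close>, and this phase also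
  varies with t. Separating the modulus by partial summation over 2^k <= d < 2^(k+1) costs a factor
  of about H P / 2^k for h near H, where P bounds both the half-lengths and the multipliers of h up
  to a constant. The coefficients of a sharp interval decay only like d / h, so this cost would
  leave no decay at all. Ramps of width w improve the decay to d^2 / (h^2 w). After the separation
  this is d P / (h w), just enough to make every dyadic block of frequencies above 2^k / P
  contribute the same amount. The price is the factor P / w, which is the loss 1 / \<eta> of the
  overview.\<close>

definition ee :: "real \<Rightarrow> complex" where "ee t = cis (2 * pi * t)"

lemma norm_ee [simp]: "norm (ee t) = 1"
  by (simp add: ee_def)

lemma ee_add: "ee (s + t) = ee s * ee t"
  by (simp add: ee_def cis_mult algebra_simps)

lemma ee_0 [simp]: "ee 0 = 1"
  by (simp add: ee_def)

lemma ee_int [simp]: "ee (of_int k) = 1"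
  by (simp add: ee_def cis.code complex_eq_iff cos_int_2pin sin_int_2pin)

lemma cnj_ee: "cnj (ee t) = ee (- t)"
  by (simp add: ee_def cis_cnj)

lemma ee_nat_mult: "ee (real n * t) = ee t ^ n"
  by (simp add: ee_def Complex.DeMoivre mult_ac)

text \<open>A positive integer is at least 1, so the two squares add up to at least
  \<open>d * d'\<close>. Moduli within a factor 2 of each other let \<open>(d' - d)^2\<close> supply
  at most half of that, and the fractions must account for the rest. The roots are arbitrary
  integers rather than residues, so that shifts by the modulus are covered.\<close>

lemma root_fractions_spaced:
  fixes d d' \<nu> \<nu>' :: int
  assumes "d > 0" "d' > 0" "d dvd \<nu>\<^sup>2 + 1" "d' dvd \<nu>'\<^sup>2 + 1"
    and "\<not> (d = d' \<and> \<nu> = \<nu>')" "d \<le> 2 * d'" "d' \<le> 2 * d"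
  shows "1 / (2 * of_int d * of_int d') \<le> (of_int \<nu> / of_int d - of_int \<nu>' / of_int d' :: real)^2"
proof -
  obtain c where c: "\<nu>\<^sup>2 + 1 = d * c" using assms(3) by blast
  obtain c' where c': "\<nu>'\<^sup>2 + 1 = d' * c'" using assms(4) by blast
  \<comment> \<open>\<open>J + 2\<close> is twice the hyperbolic cosine of the distance between the
    points \<open>(\<nu> + i) / d\<close> and \<open>(\<nu>' + i) / d'\<close> of the upper
    half-plane. Both lie in the orbit of \<open>i\<close> under SL(2, Z), and the integrality of
    \<open>J\<close> reflects the discreteness of this orbit.\<close>
  define J where "J = c * d' + c' * d - 2 * \<nu> * \<nu>' - 2"
  have "J * (d * d') = (d * c) * d'\<^sup>2 + (d' * c') * d^2 - 2 * \<nu> * \<nu>' * d * d' - 2 * d * d'"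
    unfolding J_def by (simp add: algebra_simps power2_eq_square)
  also have "\<dots> = (\<nu> * d' - \<nu>' * d)^2 + (d' - d)^2"
    unfolding c[symmetric] c'[symmetric] by (simp add: algebra_simps power2_eq_square)
  finally have J: "J * (d * d') = (\<nu> * d' - \<nu>' * d)^2 + (d' - d)^2" .
  have "(\<nu> * d' - \<nu>' * d)^2 + (d' - d)^2 > 0"
    using assms(1,2,5) by (auto simp: sum_power2_gt_zero_iff)
  hence "J > 0" using J assms(1,2) by (metis mult_pos_pos zero_less_mult_pos2)
  hence "d * d' \<le> J * (d * d')" using assms(1,2) by simp
  \<comment> \<open>Expanded, the product of the two ratio hypotheses says exactly that
    \<open>2 * (d' - d)^2\<close> is at most \<open>d * d'\<close>.\<close>
  moreover have "(2 * d' - d) * (2 * d - d') \<ge> 0" using assms by simp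
  hence "2 * (d' - d)^2 \<le> d * d'" by (simp add: algebra_simps power2_eq_square)
  ultimately have "d * d' \<le> 2 * (\<nu> * d' - \<nu>' * d)^2" using J by linarith
  hence le: "real_of_int d * of_int d' \<le> 2 * (of_int \<nu> * of_int d' - of_int \<nu>' * of_int d)^2"
    by (metis (mono_tags, lifting) of_int_diff of_int_le_iff of_int_mult of_int_numeral of_int_power)
  have "(of_int \<nu> / of_int d - of_int \<nu>' / of_int d' :: real)^2
      = (of_int \<nu> * of_int d' - of_int \<nu>' * of_int d)^2 / (of_int d * of_int d')^2"
    using assms(1,2) by (simp add: field_simps power2_eq_square)
  also have "\<dots> \<ge> (of_int d * of_int d' / 2) / (of_int d * of_int d')^2"
    using le by (intro divide_right_mono) auto
  also have "(of_int d * of_int d' / 2) / (of_int d * of_int d')^2 = 1 / (2 * of_int d * of_int d' :: real)"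
    using assms(1,2) by (simp add: field_simps power2_eq_square)
  finally show ?thesis .
qed

section \<open>Harmonic sums over separated points and the large sieve inequality\<close>

lemma harmonic_dyadic: "(\<Sum>j=1..<2^J. 1 / real j) \<le> real J"
proof (induction J)
  case (Suc J)
  have "{1..<2^Suc J} = {1..<2^J} \<union> {2^J..<2^Suc J::nat}"
    by (intro ivl_disj_un_two(3)[symmetric]) auto
  hence "(\<Sum>j=1..<2^Suc J. 1 / real j) = (\<Sum>j=1..<2^J. 1 / real j) + (\<Sum>j\<in>{2^J..<2^Suc J}. 1 / real j)"
    by (simp only:) (rule sum.union_disjoint, auto)
  also have "(\<Sum>j\<in>{2^J..<2^Suc J}. 1 / real j) \<le> (\<Sum>j\<in>{2^J..<(2::nat)^Suc J}. 1 / 2^J)"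
    by (intro sum_mono divide_left_mono) (auto simp flip: of_nat_power)
  also have "\<dots> = 1" by simp
  finally show ?case using Suc by simp
qed auto

text \<open>Buckets of width \<delta> receive at most one value each, and the bucket number
  \<open>g q\<close> runs between 1 and \<open>2 ^ J - 1\<close>. The sum is thus at most 1 /
  \<delta> times a harmonic sum.\<close>

lemma sum_inverse_separated:
  fixes f :: "'a \<Rightarrow> real"
  assumes "finite S" "\<delta> > 0" "1 / \<delta> < 2 ^ J"
    and ge: "\<And>q. q \<in> S \<Longrightarrow> \<delta> \<le> f q" and le: "\<And>q. q \<in> S \<Longrightarrow> f q \<le> 1"
    and sep: "\<And>q q'. q \<in> S \<Longrightarrow> q' \<in> S \<Longrightarrow> q \<noteq> q' \<Longrightarrow> \<delta> \<le> \<bar>f q - f q'\<bar>"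
  shows "(\<Sum>q\<in>S. 1 / f q) \<le> real J / \<delta>"
proof -
  define g where "g q = nat \<lfloor>f q / \<delta>\<rfloor>" for q
  have g1: "g q \<ge> 1" if "q \<in> S" for q
    using ge[OF that] \<open>\<delta> > 0\<close> by (simp add: g_def le_nat_iff le_floor_iff)
  have g2: "real (g q) \<le> f q / \<delta>" "f q / \<delta> < real (g q) + 1" if "q \<in> S" for q
    using ge[OF that] \<open>\<delta> > 0\<close> unfolding g_def by (auto intro!: of_nat_floor)
  have g3: "g q < 2 ^ J" if "q \<in> S" for q
  proof -
    have "real (g q) \<le> f q / \<delta>" using g2 that by blast
    also have "\<dots> \<le> 1 / \<delta>" using le[OF that] \<open>\<delta> > 0\<close> by (simp add: divide_right_mono)
    also have "\<dots> < 2 ^ J" by fact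
    finally show ?thesis by (metis of_nat_less_iff of_nat_numeral of_nat_power)
  qed
  have inj: "inj_on g S"
  proof (rule inj_onI, rule ccontr)
    fix q q' assume *: "q \<in> S" "q' \<in> S" "g q = g q'" "q \<noteq> q'"
    have "\<bar>f q / \<delta> - f q' / \<delta>\<bar> < 1" using g2[OF *(1)] g2[OF *(2)] *(3) by linarith
    hence "\<bar>f q - f q'\<bar> < \<delta>" using \<open>\<delta> > 0\<close> by (simp add: abs_if field_simps split: if_splits)
    thus False using sep[OF *(1,2,4)] by simp
  qed
  have "(\<Sum>q\<in>S. 1 / f q) \<le> (\<Sum>q\<in>S. 1 / \<delta> * (1 / real (g q)))"
  proof (intro sum_mono)
    fix q assume q: "q \<in> S"
    have "\<delta> * real (g q) \<le> f q" using g2(1)[OF q] \<open>\<delta> > 0\<close> by (simp add: field_simps)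
    moreover have "\<delta> * real (g q) > 0" using g1[OF q] \<open>\<delta> > 0\<close> by simp
    ultimately show "1 / f q \<le> 1 / \<delta> * (1 / real (g q))" by (simp add: frac_le)
  qed
  also have "\<dots> = 1 / \<delta> * (\<Sum>j\<in>g ` S. 1 / real j)"
    by (simp add: sum_distrib_left sum.reindex[OF inj])
  also have "(\<Sum>j\<in>g ` S. 1 / real j) \<le> (\<Sum>j=1..<2^J. 1 / real j)"
    using g1 g3 by (intro sum_mono2) auto
  also have "\<dots> \<le> real J" by (rule harmonic_dyadic)
  finally show ?thesis using \<open>\<delta> > 0\<close> by (simp add: mult_left_mono divide_simps)
qed

text \<open>Up to pi / 3 the derivative of the sine is at least 1 / 2. From there on the sine is at
  least 0.85, while \<open>x / 2\<close> is at most pi / 4 <= 0.8.\<close>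

lemma half_le_sin:
  assumes "0 \<le> x" "x \<le> pi / 2"
  shows "x / 2 \<le> sin x"
proof (cases "x \<le> pi / 3")
  case True
  show ?thesis
  proof (cases "x = 0")
    case False
    hence "x > 0" using assms by simp
    then obtain z where z: "z > 0" "z < x" "sin x - sin 0 = (x - 0) * cos z"
      using MVT2[of 0 x sin cos] by (auto intro: derivative_eq_intros)
    have "cos z \<ge> cos (pi / 3)" using z True by (intro cos_monotone_0_pi_le) auto
    hence "x * (1/2) \<le> x * cos z" using \<open>x > 0\<close> by (intro mult_left_mono) (auto simp: cos_60)
    thus ?thesis using z by simp
  qed auto
next
  case False
  have "sin x \<ge> sin (pi / 3)" using False assms by (intro sin_monotone_2pi_le) auto
  moreover have "sqrt 3 \<ge> 17/10" by (intro real_le_rsqrt) (simp add: power2_eq_square)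
  hence "sin (pi/3) \<ge> 17/20" by (simp add: sin_60)
  moreover have "pi \<le> 3.2" using pi_approx by simp
  ultimately show ?thesis using assms by simp
qed

lemma norm_ee_minus_1: "norm (ee t - 1) = 2 * \<bar>sin (pi * t)\<bar>"
proof -
  have "(norm (ee t - 1))^2 = (2 * \<bar>sin (pi * t)\<bar>)^2"
    using cos_double_sin[of "pi * t"] sin_cos_squared_add[of "2 * pi * t"]
    by (simp add: ee_def cmod_power2 power2_diff algebra_simps)
  thus ?thesis by (rule power2_eq_imp_eq) auto
qed

lemma sin_pi_ge_dist:
  assumes "0 < f" "f < 1"
  shows "min f (1 - f) / 2 \<le> sin (pi * f)"
proof -
  have *: "f / 2 \<le> sin (pi * f)" if "0 < f" "f \<le> 1/2" for f
  proof -
    have "pi * f / 2 \<le> sin (pi * f)" using that by (intro half_le_sin) auto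
    moreover have "pi * f \<ge> 1 * f" using that pi_ge_two by (intro mult_right_mono) auto
    ultimately show ?thesis by simp
  qed
  show ?thesis
  proof (cases "f \<le> 1/2")
    case False
    have "sin (pi * f) = sin (pi * (1 - f))" by (simp add: algebra_simps)
    thus ?thesis using *[of "1 - f"] False assms by simp
  qed (use * assms in simp)
qed

text \<open>Here \<open>f\<close> represents \<open>t\<close> modulo 1. The geometric sum is at most
  \<open>2 / min f (1 - f)\<close>; writing this as two reciprocals lets the distances to 0 and to 1
  be summed separately over separated points.\<close>

lemma norm_geometric_ee:
  assumes "t - f \<in> \<int>" "0 < f" "f < 1"
  shows "norm (\<Sum>n\<le>N. ee (real n * t)) \<le> 2 * (1 / f + 1 / (1 - f))"
proof -
  obtain k where k: "t = f + of_int k" using assms(1) by (metis Ints_cases add.commute diff_add_cancel)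
  have et: "ee t = ee f" by (simp add: k ee_add)
  have nz: "norm (ee f - 1) \<ge> min f (1 - f)" 
    using sin_pi_ge_dist[OF assms(2,3)] assms sin_gt_zero[of "pi * f"] by (simp add: norm_ee_minus_1)
  moreover have "min f (1 - f) > 0" using assms by simp
  ultimately have "ee f \<noteq> 1" by auto
  have "(\<Sum>n\<le>N. ee (real n * t)) = (\<Sum>n<Suc N. ee f ^ n)"
    by (simp add: ee_nat_mult et lessThan_Suc_atMost)
  also have "\<dots> = (ee f ^ Suc N - 1) / (ee f - 1)"
    using \<open>ee f \<noteq> 1\<close> by (rule geometric_sum)
  also have "norm \<dots> \<le> 2 / min f (1 - f)"
    unfolding norm_divide
    using norm_triangle_ineq4[of "ee f ^ Suc N" 1] nz \<open>min f (1 - f) > 0\<close>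
    by (intro frac_le) (auto simp: norm_power norm_mult)
  also have "\<dots> \<le> 2 * (1 / f + 1 / (1 - f))"
    using assms by (simp add: min_def)
  finally show ?thesis .
qed

text \<open>The diagonal term is \<open>N + 1\<close>. For the other \<open>q\<close> the fractional
  parts of \<open>v p - v q\<close> are again \<delta>-separated and stay \<delta> away from both 0
  and 1, so \<open>sum_inverse_separated\<close> applies once to \<open>f\<close> and once to
  \<open>1 - f\<close>.\<close>

lemma separated_kernel_sum:
  fixes v :: "'p \<Rightarrow> real"
  assumes "finite Z" "p \<in> Z" "\<delta> > 0" "1 / \<delta> < 2 ^ J"
    and sep: "\<And>p q k. p \<in> Z \<Longrightarrow> q \<in> Z \<Longrightarrow> p \<noteq> q \<Longrightarrow> \<delta> \<le> \<bar>v p - v q - of_int k\<bar>"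
  shows "(\<Sum>q\<in>Z. norm (\<Sum>n\<le>N. ee (real n * (v p - v q)))) \<le> real N + 1 + 4 * real J / \<delta>"
proof -
  define f where "f q = frac (v p - v q)" for q
  define S where "S = Z - {p}"
  have S: "finite S" using assms by (simp add: S_def)
  have f: "\<delta> \<le> f q" "\<delta> \<le> 1 - f q" if "q \<in> S" for q
  proof -
    have q: "q \<in> Z" "p \<noteq> q" using that by (auto simp: S_def)
    have "\<delta> \<le> \<bar>f q\<bar>" using sep[OF assms(2) q, of "\<lfloor>v p - v q\<rfloor>"] by (simp add: f_def frac_def)
    thus "\<delta> \<le> f q" by (simp add: f_def)
    have "\<delta> \<le> \<bar>f q - 1\<bar>" using sep[OF assms(2) q, of "\<lfloor>v p - v q\<rfloor> + 1"]
      by (simp add: f_def frac_def algebra_simps)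
    thus "\<delta> \<le> 1 - f q" using frac_lt_1[of "v p - v q"] by (simp add: f_def)
  qed
  have fs: "\<delta> \<le> \<bar>f q - f q'\<bar>" if "q \<in> S" "q' \<in> S" "q \<noteq> q'" for q q'
    using sep[of q' q "\<lfloor>v p - v q\<rfloor> - \<lfloor>v p - v q'\<rfloor>"] that
    by (simp add: S_def f_def frac_def algebra_simps)
  have A: "(\<Sum>q\<in>S. 1 / f q) \<le> real J / \<delta>"
    using f fs assms(3) by (intro sum_inverse_separated S assms) force+
  have B: "(\<Sum>q\<in>S. 1 / (1 - f q)) \<le> real J / \<delta>"
    using f fs assms(3) by (intro sum_inverse_separated S assms) (force simp: abs_minus_commute)+
  have "(\<Sum>q\<in>Z. norm (\<Sum>n\<le>N. ee (real n * (v p - v q))))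
      = norm (\<Sum>n\<le>N. ee (real n * (v p - v p))) + (\<Sum>q\<in>S. norm (\<Sum>n\<le>N. ee (real n * (v p - v q))))"
    unfolding S_def using assms by (intro sum.remove) auto
  also have "norm (\<Sum>n\<le>N. ee (real n * (v p - v p))) = real N + 1"
    using norm_of_nat[of "Suc N", where 'a = complex] by simp
  also have "(\<Sum>q\<in>S. norm (\<Sum>n\<le>N. ee (real n * (v p - v q)))) \<le> (\<Sum>q\<in>S. 2 * (1 / f q + 1 / (1 - f q)))"
  proof (intro sum_mono norm_geometric_ee)
    fix q assume q: "q \<in> S"
    show "v p - v q - f q \<in> \<int>" by (simp add: f_def frac_def)
    show "0 < f q" "f q < 1" using f[OF q] assms(3) by linarith+
  qed
  also have "\<dots> = 2 * ((\<Sum>q\<in>S. 1 / f q) + (\<Sum>q\<in>S. 1 / (1 - f q)))"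
    by (simp add: sum_distrib_left sum.distrib)
  also have "\<dots> \<le> 4 * real J / \<delta>" using A B by simp
  finally show ?thesis by simp
qed

text \<open>Schur's test: after expanding the square, the inequality between geometric and
  arithmetic means and the symmetry of \<open>norm (K p q)\<close> leave only a row sum of the
  kernel, which \<open>separated_kernel_sum\<close> bounds.\<close>

lemma large_sieve_dual:
  fixes v :: "'p \<Rightarrow> real" and b :: "'p \<Rightarrow> complex"
  assumes "finite Z" "\<delta> > 0" "1 / \<delta> < 2 ^ J"
    and sep: "\<And>p q k. p \<in> Z \<Longrightarrow> q \<in> Z \<Longrightarrow> p \<noteq> q \<Longrightarrow> \<delta> \<le> \<bar>v p - v q - of_int k\<bar>"
  shows "(\<Sum>n\<le>N. (norm (\<Sum>p\<in>Z. b p * ee (real n * v p)))^2)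
        \<le> (real N + 1 + 4 * real J / \<delta>) * (\<Sum>p\<in>Z. (norm (b p))^2)"
proof -
  define K where "K p q = (\<Sum>n\<le>N. ee (real n * (v p - v q)))" for p q
  have K_sym: "norm (K q p) = norm (K p q)" for p q
  proof -
    have "K q p = cnj (K p q)" by (simp add: K_def cnj_ee algebra_simps)
    thus ?thesis by simp
  qed
  have "complex_of_real (\<Sum>n\<le>N. (norm (\<Sum>p\<in>Z. b p * ee (real n * v p)))^2)
     = (\<Sum>n\<le>N. (\<Sum>p\<in>Z. b p * ee (real n * v p)) * cnj (\<Sum>q\<in>Z. b q * ee (real n * v q)))"
    unfolding of_real_sum complex_norm_square ..
  also have "\<dots> = (\<Sum>n\<le>N. \<Sum>p\<in>Z. \<Sum>q\<in>Z. b p * cnj (b q) * ee (real n * (v p - v q)))"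
    by (simp add: sum_product cnj_ee distrib_left diff_conv_add_uminus ee_add mult_ac del: add_uminus_conv_diff)
  also have "\<dots> = (\<Sum>p\<in>Z. \<Sum>q\<in>Z. b p * cnj (b q) * K p q)"
    unfolding K_def sum_distrib_left
    by (subst sum.swap, rule sum.cong[OF refl], rule sum.swap)
  finally have eq: "complex_of_real (\<Sum>n\<le>N. (norm (\<Sum>p\<in>Z. b p * ee (real n * v p)))^2)
     = (\<Sum>p\<in>Z. \<Sum>q\<in>Z. b p * cnj (b q) * K p q)" .
  have "(\<Sum>n\<le>N. (norm (\<Sum>p\<in>Z. b p * ee (real n * v p)))^2)
     = norm (complex_of_real (\<Sum>n\<le>N. (norm (\<Sum>p\<in>Z. b p * ee (real n * v p)))^2))"
    by (simp add: sum_nonneg del: of_real_sum)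
  also have "\<dots> \<le> (\<Sum>p\<in>Z. \<Sum>q\<in>Z. norm (b p) * norm (b q) * norm (K p q))"
    unfolding eq by (intro order.trans[OF norm_sum] sum_mono) (simp add: norm_mult)
  also have "\<dots> \<le> (\<Sum>p\<in>Z. \<Sum>q\<in>Z. ((norm (b p))^2 + (norm (b q))^2) / 2 * norm (K p q))"
  proof (intro sum_mono mult_right_mono)
    fix p q
    have "0 \<le> (norm (b p) - norm (b q))^2" by simp
    thus "norm (b p) * norm (b q) \<le> ((norm (b p))^2 + (norm (b q))^2) / 2"
      by (simp add: power2_diff)
  qed auto
  also have "\<dots> = ((\<Sum>p\<in>Z. \<Sum>q\<in>Z. (norm (b p))^2 * norm (K p q)) + (\<Sum>p\<in>Z. \<Sum>q\<in>Z. (norm (b q))^2 * norm (K p q))) / 2"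
    by (simp add: sum.distrib[symmetric] sum_divide_distrib add_divide_distrib algebra_simps)
  also have "(\<Sum>p\<in>Z. \<Sum>q\<in>Z. (norm (b q))^2 * norm (K p q)) = (\<Sum>p\<in>Z. \<Sum>q\<in>Z. (norm (b p))^2 * norm (K p q))"
    by (subst sum.swap) (simp add: K_sym)
  also have "((\<Sum>p\<in>Z. \<Sum>q\<in>Z. (norm (b p))^2 * norm (K p q)) + (\<Sum>p\<in>Z. \<Sum>q\<in>Z. (norm (b p))^2 * norm (K p q))) / 2
      = (\<Sum>p\<in>Z. (norm (b p))^2 * (\<Sum>q\<in>Z. norm (K p q)))"
    by (simp only: sum_distrib_left[symmetric] field_sum_of_halves add_divide_distrib)
  also have "\<dots> \<le> (\<Sum>p\<in>Z. (norm (b p))^2 * (real N + 1 + 4 * real J / \<delta>))"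
    unfolding K_def by (intro sum_mono mult_left_mono separated_kernel_sum assms) auto
  also have "\<dots> = (real N + 1 + 4 * real J / \<delta>) * (\<Sum>p\<in>Z. (norm (b p))^2)"
    by (simp only: sum_distrib_right mult.commute[of "real N + 1 + 4 * real J / \<delta>"])
  finally show ?thesis .
qed

text \<open>Duality: the left side \<open>X\<close> is linear in the pooled coefficients
  \<open>a n\<close>, with the dual sums for \<open>cnj (S p)\<close> as weights. Cauchy-Schwarz and
  the dual inequality give an upper bound for \<open>X^2\<close> that contains a factor
  \<open>X\<close>, which cancels. The map \<open>\<mu>\<close> need not be injective; indices of
  equal frequency are pooled, so the right side measures coincidences.\<close>

lemma large_sieve:
  fixes v :: "'p \<Rightarrow> real" and c :: "'i \<Rightarrow> complex" and \<mu> :: "'i \<Rightarrow> nat"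
  assumes "finite Z" "\<delta> > 0" "1 / \<delta> < 2 ^ J" "finite I"
    and N: "\<And>i. i \<in> I \<Longrightarrow> \<mu> i \<le> N"
    and sep: "\<And>p q k. p \<in> Z \<Longrightarrow> q \<in> Z \<Longrightarrow> p \<noteq> q \<Longrightarrow> \<delta> \<le> \<bar>v p - v q - of_int k\<bar>"
  shows "(\<Sum>p\<in>Z. (norm (\<Sum>i\<in>I. c i * ee (real (\<mu> i) * v p)))^2)
        \<le> (real N + 1 + 4 * real J / \<delta>) * (\<Sum>(i, j)\<in>{(i, j). i \<in> I \<and> j \<in> I \<and> \<mu> i = \<mu> j}. norm (c i) * norm (c j))"
proof -
  define R where "R = real N + 1 + 4 * real J / \<delta>"
  have "R \<ge> 0" using assms by (simp add: R_def)
  define S where "S p = (\<Sum>i\<in>I. c i * ee (real (\<mu> i) * v p))" for p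
  define F where "F n = {i \<in> I. \<mu> i = n}" for n
  define a where "a n = (\<Sum>i\<in>F n. c i)" for n
  define X where "X = (\<Sum>p\<in>Z. (norm (S p))^2)"
  define V where "V n = (\<Sum>p\<in>Z. cnj (S p) * ee (real n * v p))" for n
  have finF: "finite (F n)" for n using assms by (simp add: F_def)
  have S_alt: "S p = (\<Sum>n\<le>N. a n * ee (real n * v p))" for p
  proof -
    have "(\<Sum>n\<le>N. a n * ee (real n * v p)) = (\<Sum>n\<le>N. \<Sum>i\<in>F n. c i * ee (real (\<mu> i) * v p))"
      by (simp add: a_def sum_distrib_right F_def)
    also have "\<dots> = S p"
      unfolding S_def F_def by (intro sum.group) (use assms in auto)
    finally show ?thesis ..
  qed
  have "complex_of_real X = (\<Sum>p\<in>Z. S p * cnj (S p))"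
    unfolding X_def of_real_sum complex_norm_square ..
  also have "\<dots> = (\<Sum>p\<in>Z. \<Sum>n\<le>N. a n * (cnj (S p) * ee (real n * v p)))"
    by (subst S_alt) (simp add: sum_distrib_right sum_distrib_left mult_ac)
  also have "\<dots> = (\<Sum>n\<le>N. a n * V n)"
    unfolding V_def sum_distrib_left by (rule sum.swap)
  finally have XV: "complex_of_real X = (\<Sum>n\<le>N. a n * V n)" .
  have X0: "X \<ge> 0" by (simp add: X_def sum_nonneg)
  have "X = norm (complex_of_real X)" using X0 by simp
  also have "\<dots> \<le> (\<Sum>n\<le>N. norm (a n) * norm (V n))"
    unfolding XV by (intro order.trans[OF norm_sum]) (simp add: norm_mult)
  finally have "X^2 \<le> (\<Sum>n\<le>N. norm (a n) * norm (V n))^2" using X0 by (intro power_mono)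
  also have "\<dots> \<le> (\<Sum>n\<le>N. (norm (a n))^2) * (\<Sum>n\<le>N. (norm (V n))^2)"
    by (rule Cauchy_Schwarz_ineq_sum)
  also have "\<dots> \<le> (\<Sum>n\<le>N. (norm (a n))^2) * (R * (\<Sum>p\<in>Z. (norm (cnj (S p)))^2))"
    unfolding V_def R_def by (intro mult_left_mono large_sieve_dual assms sum_nonneg) auto
  also have "(\<Sum>p\<in>Z. (norm (cnj (S p)))^2) = X" by (simp add: X_def)
  finally have "X * X \<le> (R * (\<Sum>n\<le>N. (norm (a n))^2)) * X"
    by (simp add: power2_eq_square mult_ac)
  hence "X \<le> R * (\<Sum>n\<le>N. (norm (a n))^2)"
    using X0 \<open>R \<ge> 0\<close> by (cases "X = 0") (auto intro!: mult_nonneg_nonneg sum_nonneg)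
  also have "(\<Sum>n\<le>N. (norm (a n))^2) \<le> (\<Sum>n\<le>N. \<Sum>ij\<in>F n \<times> F n. norm (c (fst ij)) * norm (c (snd ij)))"
  proof (intro sum_mono)
    fix n
    have "(norm (a n))^2 \<le> (\<Sum>i\<in>F n. norm (c i))^2"
      unfolding a_def by (intro power_mono norm_sum) auto
    also have "\<dots> = (\<Sum>ij\<in>F n \<times> F n. norm (c (fst ij)) * norm (c (snd ij)))"
      by (simp add: power2_eq_square sum_product sum.cartesian_product case_prod_unfold)
    finally show "(norm (a n))^2 \<le> \<dots>" .
  qed
  also have "\<dots> = (\<Sum>n\<le>N. \<Sum>ij\<in>{ij \<in> {(i, j). i \<in> I \<and> j \<in> I \<and> \<mu> i = \<mu> j}. \<mu> (fst ij) = n}. norm (c (fst ij)) * norm (c (snd ij)))"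
    by (intro sum.cong refl) (auto simp: F_def)
  also have "\<dots> = (\<Sum>ij\<in>{(i, j). i \<in> I \<and> j \<in> I \<and> \<mu> i = \<mu> j}. norm (c (fst ij)) * norm (c (snd ij)))"
    by (intro sum.group finite_subset[OF _ finite_cartesian_product[OF assms(4,4)]]) (use N in auto)
  finally show ?thesis using \<open>R \<ge> 0\<close>
    by (simp add: X_def S_def R_def case_prod_unfold mult_left_mono)
qed

section \<open>Roots of \<nu>^2 + 1 in dyadic ranges of moduli\<close>

abbreviation moduli :: "real \<Rightarrow> nat set" where
  "moduli D \<equiv> {d. d > 0 \<and> real d \<le> D}"

definition sqrt_roots :: "nat \<Rightarrow> nat set" where
  "sqrt_roots d = {\<nu>. \<nu> < d \<and> d dvd \<nu>\<^sup>2 + 1}"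

lemma finite_sqrt_roots [simp, intro]: "finite (sqrt_roots d)"
  by (simp add: sqrt_roots_def)

lemma rho_eq_card: "rho d = card (sqrt_roots d)"
  unfolding rho_def sqrt_roots_def by (intro arg_cong[of _ _ card]) (auto simp: cong_0_iff)

definition root_pairs :: "nat \<Rightarrow> (nat \<times> nat) set" where
  "root_pairs k = (SIGMA d:{2^k..<2^Suc k}. sqrt_roots d)"

lemma finite_root_pairs [simp, intro]: "finite (root_pairs k)"
  by (auto simp: root_pairs_def)

text \<open>Shifting \<open>\<nu>'\<close> by a multiple of \<open>d'\<close> keeps it a root, so
  the spacing of fractions holds modulo 1. The constant 3 comes from 2 d d' <= 8 * 4^k <= (3 *
  2^k)^2.\<close>

lemma root_pairs_spaced:
  assumes "p \<in> root_pairs k" "q \<in> root_pairs k" "p \<noteq> q"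
  shows "1 / (3 * 2 ^ k) \<le> \<bar>real (snd p) / real (fst p) - real (snd q) / real (fst q) - of_int i\<bar>"
proof -
  obtain d \<nu> d' \<nu>' where pq: "p = (d, \<nu>)" "q = (d', \<nu>')" by (cases p, cases q)
  have d: "2 ^ k \<le> d" "d < 2 * 2 ^ k" "2 ^ k \<le> d'" "d' < 2 * 2 ^ k" "\<nu> < d" "\<nu>' < d'"
    "d dvd \<nu>\<^sup>2 + 1" "d' dvd \<nu>'\<^sup>2 + 1"
    using assms(1,2) by (auto simp: root_pairs_def sqrt_roots_def pq)
  have pos: "d > 0" "d' > 0" using d(1,3) by (auto intro: Nat.gr0I)
  have 1: "int d dvd (int \<nu>)^2 + 1" "int d' dvd (int \<nu>')^2 + 1"
  proof -
    have "int d dvd int (\<nu>\<^sup>2 + 1)" "int d' dvd int (\<nu>'\<^sup>2 + 1)"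
      using d(7,8) by (simp_all only: of_nat_dvd_iff)
    thus "int d dvd (int \<nu>)^2 + 1" "int d' dvd (int \<nu>')^2 + 1" by (simp_all add: add.commute)
  qed
  have "(int \<nu>' + i * int d')^2 + 1 = ((int \<nu>')^2 + 1) + int d' * (2 * i * int \<nu>' + i^2 * int d')"
    by (simp add: power2_eq_square algebra_simps)
  hence 2: "int d' dvd (int \<nu>' + i * int d')^2 + 1" using 1 by (metis dvd_add dvd_triv_left)
  have 3: "\<not> (int d = int d' \<and> int \<nu> = int \<nu>' + i * int d')"
  proof
    assume *: "int d = int d' \<and> int \<nu> = int \<nu>' + i * int d'"
    hence "int \<nu> mod int d' = int \<nu>' mod int d'" by (metis mod_mult_self1)
    hence "\<nu> = \<nu>'" using * d(5,6) by (metis mod_less of_nat_eq_iff zmod_int)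
    thus False using * assms(3) pq by simp
  qed
  have "1 / (2 * real d * real d') \<le> (real \<nu> / real d - of_int (int \<nu>' + i * int d') / real d')^2"
    using root_fractions_spaced[OF _ _ 1(1) 2 3] pos d by simp
  also have "of_int (int \<nu>' + i * int d') / real d' = real \<nu>' / real d' + of_int i"
    using pos by (simp add: field_simps)
  finally have A: "1 / (2 * real d * real d') \<le> (real \<nu> / real d - real \<nu>' / real d' - of_int i)^2"
    by (simp add: algebra_simps)
  have "real d < real (2 * 2 ^ k)" "real d' < real (2 * 2 ^ k)"
    using d(2,4) by (simp_all only: of_nat_less_iff)
  hence r: "real d \<le> 2 * 2 ^ k" "real d' \<le> 2 * 2 ^ k" by simp_all
  have "2 * real d * real d' \<le> 2 * (2 * 2 ^ k) * (2 * 2 ^ k)"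
    using r by (intro mult_mono) auto
  also have "\<dots> \<le> (3 * 2 ^ k)^2" by (simp add: power2_eq_square)
  finally have "(1 / (3 * 2 ^ k))^2 \<le> 1 / (2 * real d * real d')"
    using pos unfolding power_divide by (intro frac_le) auto
  with A have "(1 / (3 * 2 ^ k))^2 \<le> \<bar>real \<nu> / real d - real \<nu>' / real d' - of_int i\<bar>\<^sup>2" by simp
  thus ?thesis unfolding pq fst_conv snd_conv by (rule power2_le_imp_le) auto
qed

lemma large_sieve_roots:
  fixes c :: "'i \<Rightarrow> complex" and \<mu> :: "'i \<Rightarrow> nat"
  assumes "finite I" "\<And>i. i \<in> I \<Longrightarrow> \<mu> i \<le> N"
  shows "(\<Sum>(d, \<nu>)\<in>root_pairs k. (norm (\<Sum>i\<in>I. c i * ee (real (\<mu> i) * (real \<nu> / real d))))^2)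
        \<le> (real N + 1 + 12 * real (k + 2) * 2 ^ k) * (\<Sum>(i, j)\<in>{(i, j). i \<in> I \<and> j \<in> I \<and> \<mu> i = \<mu> j}. norm (c i) * norm (c j))"
proof -
  have "(1::real) / (1 / (3 * 2 ^ k)) < 2 ^ (k + 2)" by (simp add: power_add)
  have "(\<Sum>p\<in>root_pairs k. (norm (\<Sum>i\<in>I. c i * ee (real (\<mu> i) * (real (snd p) / real (fst p)))))^2)
        \<le> (real N + 1 + 4 * real (k + 2) / (1 / (3 * 2 ^ k))) * 
        (\<Sum>(i, j)\<in>{(i, j). i \<in> I \<and> j \<in> I \<and> \<mu> i = \<mu> j}. norm (c i) * norm (c j))"
    by (intro large_sieve[OF finite_root_pairs _ \<open>1 / (1 / (3 * 2 ^ k)) < 2 ^ (k + 2)\<close>] assms root_pairs_spaced) auto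
  thus ?thesis by (simp add: case_prod_unfold algebra_simps)
qed

text \<open>The large sieve with a single index of frequency 0 and coefficient 1 counts the points.
  This replaces an evaluation of the mean value of \<open>rho\<close>, at the cost of one
  logarithm.\<close>

lemma card_root_pairs: "real (card (root_pairs k)) \<le> 13 * real (k + 2) * 2 ^ k"
proof -
  have "real (card (root_pairs k)) = (\<Sum>(d, \<nu>)\<in>root_pairs k. (norm (\<Sum>i\<in>{()}. 1 * ee (real 0 * (real \<nu> / real d))))^2)"
    by simp
  also have "\<dots> \<le> (real 0 + 1 + 12 * real (k + 2) * 2 ^ k) * 
      (\<Sum>(i, j)\<in>{(i, j). i \<in> {()} \<and> j \<in> {()} \<and> 0 = (0::nat)}. norm (1::complex) * norm (1::complex))"
    by (intro large_sieve_roots) auto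
  also have "{(i, j). i \<in> {()} \<and> j \<in> {()} \<and> 0 = (0::nat)} = {((), ())}" by auto
  finally have "real (card (root_pairs k)) \<le> 1 + 12 * real (k + 2) * 2 ^ k" by simp
  moreover have "1 * 1 \<le> real (k + 2) * 2 ^ k" by (intro mult_mono) auto
  ultimately show ?thesis by (simp add: algebra_simps)
qed

section \<open>Coincidences among the frequencies h u t^r\<close>

lemma sum_inverse_max_square:
  assumes "T < 2 ^ K"
  shows "(\<Sum>a=1..T. \<Sum>b=1..T. 1 / (real (max a b))^2) \<le> 2 * real K"
proof -
  have half: "(\<Sum>a=1..T. \<Sum>b=1..T. if b \<le> a then 1 / (real a)^2 else 0) \<le> real K"
  proof -
    have "(\<Sum>b=1..T. if b \<le> a then 1 / (real a)^2 else 0) = 1 / real a" if "a \<in> {1..T}" for a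
    proof -
      have "(\<Sum>b=1..T. if b \<le> a then 1 / (real a)^2 else 0) = (\<Sum>b=1..a. 1 / (real a)^2)"
        using that by (intro sum.mono_neutral_cong_right) auto
      thus ?thesis using that by (simp add: power2_eq_square)
    qed
    hence "(\<Sum>a=1..T. \<Sum>b=1..T. if b \<le> a then 1 / (real a)^2 else 0) = (\<Sum>a=1..T. 1 / real a)"
      by (rule sum.cong[OF refl])
    also have "\<dots> \<le> (\<Sum>a=1..<2^K. 1 / real a)"
      using assms by (intro sum_mono2) auto
    finally show ?thesis using harmonic_dyadic[of K] by linarith
  qed
  have "(\<Sum>a=1..T. \<Sum>b=1..T. 1 / (real (max a b))^2) \<le>
        (\<Sum>a=1..T. \<Sum>b=1..T. (if b \<le> a then 1 / (real a)^2 else 0) + (if a \<le> b then 1 / (real b)^2 else 0))"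
    by (intro sum_mono) (auto simp: max_def)
  also have "\<dots> = (\<Sum>a=1..T. \<Sum>b=1..T. if b \<le> a then 1 / (real a)^2 else 0) +
      (\<Sum>a=1..T. \<Sum>b=1..T. if a \<le> b then 1 / (real b)^2 else 0)"
    by (simp add: sum.distrib)
  also have "(\<Sum>a=1..T. \<Sum>b=1..T. if a \<le> b then 1 / (real b)^2 else 0) =
      (\<Sum>a=1..T. \<Sum>b=1..T. if b \<le> a then 1 / (real a)^2 else 0)"
    by (rule sum.swap)
  finally show ?thesis using half by linarith
qed

text \<open>With t = a G, t' = b G and a, b coprime, the equation h a^r = h' b^r forces h = b^r q
  and h' = a^r q. A solution is therefore determined by (a, b, G, q), and both G and q have a range
  of length inversely proportional to max a b. Summing 1 / (max a b)^2 costs a logarithm, so there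
  are hardly more solutions than the H T diagonal ones.\<close>

lemma card_power_coincidences:
  fixes H T u r K :: nat
  assumes "T < 2 ^ K" "u \<ge> 1" "r \<ge> 1" "H \<ge> 1"
  defines "I \<equiv> {H..<2*H} \<times> {1..T}"
  shows "real (card {(i, j). i \<in> I \<and> j \<in> I \<and> fst i * (u * snd i ^ r) = fst j * (u * snd j ^ r)}) \<le> 4 * real H * real T * real K"
    (is "real (card ?S) \<le> _")
proof -
  define Q where "Q = (SIGMA ab:{1..T} \<times> {1..T}. {1..T div max (fst ab) (snd ab)} \<times> {1..2*H div max (fst ab) (snd ab)})"
  define \<phi> where "\<phi> = (\<lambda>((a::nat, b::nat), (G::nat, q::nat)). ((b ^ r * q, G * a), (a ^ r * q, G * b)))"
  have sub: "?S \<subseteq> \<phi> ` Q"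
  proof safe
    fix h t h' t' assume "(h, t) \<in> I" "(h', t') \<in> I"
      and eq: "fst (h, t) * (u * snd (h, t) ^ r) = fst (h', t') * (u * snd (h', t') ^ r)"
    hence hh: "H \<le> h" "h < 2*H" "H \<le> h'" "h' < 2*H" "1 \<le> t" "t \<le> T" "1 \<le> t'" "t' \<le> T"
      by (auto simp: I_def)
    define G where "G = gcd t t'"
    have "G > 0" using hh by (simp add: G_def)
    obtain a b where ab: "t = a * G" "t' = b * G" "coprime a b"
      using gcd_coprime_exists[of t t'] hh unfolding G_def by (metis gcd_eq_0_iff not_one_le_zero)
    have "a \<ge> 1" "b \<ge> 1" using hh ab by (auto intro: Suc_leI Nat.gr0I)
    have "h * a ^ r * (u * G ^ r) = h' * b ^ r * (u * G ^ r)"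
      using eq by (simp add: ab power_mult_distrib mult_ac)
    hence eq2: "h * a ^ r = h' * b ^ r" using \<open>G > 0\<close> assms(2) by simp
    have "coprime (b ^ r) (a ^ r)" using ab(3) by (simp add: coprime_commute)
    moreover have "b ^ r dvd h * a ^ r" using eq2 by simp
    ultimately have "b ^ r dvd h" by (simp add: coprime_dvd_mult_left_iff)
    then obtain q where q: "h = b ^ r * q" by blast
    have "h' = a ^ r * q" using eq2 q \<open>b \<ge> 1\<close> by (simp add: mult_ac)
    have "q \<noteq> 0" using q hh assms(4) by (intro notI) simp
    hence "q \<ge> 1" by simp
    \<comment> \<open>Replacing the r-th powers by first powers makes the count uniform in r; the
      case r = 1 is the worst.\<close>
    have "a * q \<le> a ^ r * q" "b * q \<le> b ^ r * q"
      using \<open>a \<ge> 1\<close> \<open>b \<ge> 1\<close> assms(3) by (auto intro!: self_le_power)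
    hence "a * q \<le> 2 * H" "b * q \<le> 2 * H" using hh q \<open>h' = a ^ r * q\<close> by linarith+
    hence "max a b * q \<le> 2 * H" by (simp add: max_def)
    moreover have "max a b * G \<le> T" using hh ab by (simp add: max_def)
    ultimately have "q \<le> 2 * H div max a b" "G \<le> T div max a b"
      using \<open>a \<ge> 1\<close> by (simp_all add: less_eq_div_iff_mult_less_eq mult.commute max_def)
    moreover have "a \<le> T" "b \<le> T" using hh ab \<open>G > 0\<close>
      by (metis le_trans mult_le_mono2 One_nat_def Suc_leI nat_mult_1_right)+
    ultimately have "((a, b), (G, q)) \<in> Q"
      using \<open>a \<ge> 1\<close> \<open>b \<ge> 1\<close> \<open>G > 0\<close> \<open>q \<ge> 1\<close> by (simp add: Q_def)
    moreover have "((h, t), (h', t')) = \<phi> ((a, b), (G, q))"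
      using ab q \<open>h' = a ^ r * q\<close> by (simp add: \<phi>_def mult.commute)
    ultimately show "((h, t), (h', t')) \<in> \<phi> ` Q" by blast
  qed
  have finQ: "finite Q" by (auto simp: Q_def)
  have "card ?S \<le> card (\<phi> ` Q)" using sub finQ by (intro card_mono) auto
  also have "\<dots> \<le> card Q" using finQ by (rule card_image_le)
  also have "card Q = (\<Sum>ab\<in>{1..T} \<times> {1..T}. (T div max (fst ab) (snd ab)) * (2*H div max (fst ab) (snd ab)))"
    unfolding Q_def by (subst card_SigmaI) (auto simp: card_cartesian_product)
  finally have "real (card ?S) \<le> real (\<Sum>ab\<in>{1..T} \<times> {1..T}. (T div max (fst ab) (snd ab)) * (2*H div max (fst ab) (snd ab)))"
    by linarith
  also have "\<dots> \<le> (\<Sum>ab\<in>{1..T} \<times> {1..T}. 2 * real H * real T * (1 / (real (max (fst ab) (snd ab)))^2))"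
    unfolding of_nat_sum
  proof (intro sum_mono)
    fix ab assume "ab \<in> {1..T} \<times> {1..T}"
    let ?m = "max (fst ab) (snd ab)"
    have "real ((T div ?m) * (2*H div ?m)) \<le> (real T / real ?m) * (real (2*H) / real ?m)"
      unfolding of_nat_mult[of "T div ?m"] by (intro mult_mono of_nat_div_le_of_nat) auto
    thus "real ((T div ?m) * (2*H div ?m)) \<le> 2 * real H * real T * (1 / (real ?m)^2)"
      by (simp add: power2_eq_square mult_ac)
  qed
  also have "\<dots> = 2 * real H * real T * (\<Sum>a=1..T. \<Sum>b=1..T. 1 / (real (max a b))^2)"
    by (simp only: sum_distrib_left[symmetric] sum.cartesian_product case_prod_unfold)
  also have "\<dots> \<le> 2 * real H * real T * (2 * real K)"
    by (intro mult_left_mono sum_inverse_max_square assms) auto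
  finally show ?thesis by simp
qed

text \<open>Cauchy-Schwarz over the points followed by the large sieve. One factor
  \<open>real K + 2\<close> each comes from the number of points, the sieve constant and the count
  of coincidences. \<open>P\<close> bounds the multipliers \<open>u * t ^ r\<close>, so the
  frequencies stay below \<open>2 * H * P\<close>.\<close>

lemma root_pairs_block_bound_ee:
  fixes c :: "nat \<times> nat \<Rightarrow> complex"
  assumes "T < 2 ^ K" "u \<ge> 1" "r \<ge> 1" "H \<ge> 1" "k \<le> K" "P \<ge> 1"
    and l: "\<And>t. t \<in> {1..T} \<Longrightarrow> u * t ^ r \<le> P"
    and c: "\<And>i. i \<in> {H..<2*H} \<times> {1..T} \<Longrightarrow> norm (c i) \<le> B"
    and "B \<ge> 0"
  shows "(\<Sum>(d, \<nu>)\<in>root_pairs k. norm (\<Sum>i\<in>{H..<2*H} \<times> {1..T}. c i * ee (real (fst i * (u * snd i ^ r)) * (real \<nu> / real d))))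
     \<le> 25 * (real K + 2)^2 * sqrt (2 ^ k * real H * real T * (real H * real P + 2 ^ k)) * B"
    (is "(\<Sum>(d, \<nu>)\<in>_. norm (?S d \<nu>)) \<le> _")
proof -
  define I where "I = {H..<2*H} \<times> {1..T}"
  define L where "L = real K + 2"
  define W where "W = {(i, j). i \<in> I \<and> j \<in> I \<and> fst i * (u * snd i ^ r) = fst j * (u * snd j ^ r)}"
  have L: "L \<ge> 1" "real (k + 2) \<le> L" "real K \<le> L" using assms by (auto simp: L_def)
  have W: "real (card W) \<le> 4 * real H * real T * real K"
    unfolding W_def I_def by (rule card_power_coincidences) (use assms in auto)
  have HP: "1 \<le> real H * real P" using mult_mono[of 1 "real H" 1 "real P"] assms by simp
  have "(\<Sum>(d, \<nu>)\<in>root_pairs k. (norm (?S d \<nu>))^2) \<le> (real (2*H*P) + 1 + 12 * real (k + 2) * 2 ^ k) * 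
        (\<Sum>(i, j)\<in>W. norm (c i) * norm (c j))"
    unfolding W_def I_def[symmetric]
  proof (rule large_sieve_roots)
    fix i assume "i \<in> I"
    thus "fst i * (u * snd i ^ r) \<le> 2*H*P" by (intro mult_mono l) (auto simp: I_def)
  qed (auto simp: I_def)
  also have "\<dots> \<le> (12 * L * (real H * real P + 2 ^ k)) * (4 * real H * real T * L * B^2)"
  proof (intro mult_mono)
    have "2 * (real H * real P) + 1 \<le> 12 * 1 * (real H * real P)" using HP by simp
    also have "\<dots> \<le> 12 * L * (real H * real P)" using L by (intro mult_mono) auto
    finally have "2 * (real H * real P) + 1 \<le> 12 * L * (real H * real P)" .
    moreover have "12 * real (k + 2) * 2 ^ k \<le> 12 * L * 2 ^ k" using L by simp
    ultimately show "real (2*H*P) + 1 + 12 * real (k + 2) * 2 ^ k \<le> 12 * L * (real H * real P + 2 ^ k)"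
      by (simp add: algebra_simps)
    have "(\<Sum>(i, j)\<in>W. norm (c i) * norm (c j)) \<le> (\<Sum>(i, j)\<in>W. B * B)"
      using c \<open>B \<ge> 0\<close> by (intro sum_mono) (auto simp: W_def I_def intro!: mult_mono)
    also have "\<dots> = real (card W) * B^2" by (simp add: power2_eq_square)
    also have "\<dots> \<le> 4 * real H * real T * real K * B^2" using W by (intro mult_right_mono) auto
    also have "\<dots> \<le> 4 * real H * real T * L * B^2" using L by (intro mult_right_mono mult_left_mono) auto
    finally show "(\<Sum>(i, j)\<in>W. norm (c i) * norm (c j)) \<le> \<dots>" .
  qed (use L in \<open>auto intro!: sum_nonneg\<close>)
  finally have LS: "(\<Sum>(d, \<nu>)\<in>root_pairs k. (norm (?S d \<nu>))^2) \<le> \<dots>" .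
  have "(\<Sum>(d, \<nu>)\<in>root_pairs k. norm (?S d \<nu>))^2 = (\<Sum>p\<in>root_pairs k. 1 * norm (?S (fst p) (snd p)))^2"
    by (simp add: case_prod_unfold)
  also have "\<dots> \<le> (\<Sum>p\<in>root_pairs k. 1^2) * (\<Sum>p\<in>root_pairs k. (norm (?S (fst p) (snd p)))^2)"
    by (rule Cauchy_Schwarz_ineq_sum)
  also have "\<dots> = real (card (root_pairs k)) * (\<Sum>(d, \<nu>)\<in>root_pairs k. (norm (?S d \<nu>))^2)"
    by (simp add: case_prod_unfold)
  also have "\<dots> \<le> (13 * L * 2 ^ k) * ((12 * L * (real H * real P + 2 ^ k)) * (4 * real H * real T * L * B^2))"
  proof (intro mult_mono LS)
    have "13 * real (k + 2) * 2 ^ k \<le> 13 * L * 2 ^ k" using L by simp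
    thus "real (card (root_pairs k)) \<le> 13 * L * 2 ^ k" using card_root_pairs[of k] by linarith
  qed (use L in \<open>auto intro!: sum_nonneg\<close>)
  also have "\<dots> = 624 * L ^ 3 * (2 ^ k * real H * real T * (real H * real P + 2 ^ k)) * B^2"
    by (simp add: power3_eq_cube mult_ac)
  \<comment> \<open>Here 624 = 13 * 12 * 4. It is rounded up to a square, and \<open>L ^ 3\<close>
    to an even power, so that the square root can be taken.\<close>
  also have "\<dots> \<le> 625 * L ^ 4 * (2 ^ k * real H * real T * (real H * real P + 2 ^ k)) * B^2"
    using L by (intro mult_right_mono mult_mono power_increasing) auto
  also have "\<dots> = (25 * L\<^sup>2 * sqrt (2 ^ k * real H * real T * (real H * real P + 2 ^ k)) * B)^2"
    by (simp add: power_mult_distrib flip: power_mult)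
  finally show ?thesis unfolding L_def
    by (rule power2_le_imp_le) (use \<open>B \<ge> 0\<close> in auto)
qed

text \<open>The cosine is the mean of \<open>ee\<close> and its conjugate. Conjugating the whole
  second sum moves the conjugation to the coefficients, which keep the same bound
  \<open>B\<close>.\<close>

lemma root_pairs_block_bound:
  fixes c :: "nat \<times> nat \<Rightarrow> complex"
  assumes "T < 2 ^ K" "u \<ge> 1" "r \<ge> 1" "H \<ge> 1" "k \<le> K" "P \<ge> 1"
    and l: "\<And>t. t \<in> {1..T} \<Longrightarrow> u * t ^ r \<le> P"
    and c: "\<And>i. i \<in> {H..<2*H} \<times> {1..T} \<Longrightarrow> norm (c i) \<le> B"
    and "B \<ge> 0"
  shows "(\<Sum>(d, \<nu>)\<in>root_pairs k. norm (\<Sum>i\<in>{H..<2*H} \<times> {1..T}. 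
        c i * of_real (cos (2 * pi * (real (fst i * (u * snd i ^ r)) * (real \<nu> / real d))))))
     \<le> 25 * (real K + 2)^2 * sqrt (2 ^ k * real H * real T * (real H * real P + 2 ^ k)) * B"
    (is "?L \<le> ?R")
proof -
  define I where "I = {H..<2*H} \<times> {1..T}"
  define E where "E c = (\<Sum>(d, \<nu>)\<in>root_pairs k. norm (\<Sum>i\<in>I. c i * ee (real (fst i * (u * snd i ^ r)) * (real \<nu> / real d))))" for c
  have E: "E c \<le> ?R" "E (\<lambda>i. cnj (c i)) \<le> ?R"
    unfolding E_def I_def by (rule root_pairs_block_bound_ee; use assms in simp)+
  have cos_eq: "of_real (cos (2 * pi * y)) = (ee y + cnj (ee y)) / 2" for y
    by (simp add: complex_eq_iff ee_def)
  have cos_le: "norm (\<Sum>i\<in>I. c i * of_real (cos (2 * pi * y i))) \<le> 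
      (norm (\<Sum>i\<in>I. c i * ee (y i)) + norm (\<Sum>i\<in>I. cnj (c i) * ee (y i))) / 2" for y
  proof -
    have "(\<Sum>i\<in>I. c i * of_real (cos (2 * pi * y i))) = ((\<Sum>i\<in>I. c i * ee (y i)) + cnj (\<Sum>i\<in>I. cnj (c i) * ee (y i))) / 2"
      unfolding cos_eq by (simp add: sum.distrib[symmetric] sum_divide_distrib distrib_left)
    also have "norm \<dots> \<le> (norm (\<Sum>i\<in>I. c i * ee (y i)) + norm (cnj (\<Sum>i\<in>I. cnj (c i) * ee (y i)))) / 2"
      unfolding norm_divide by (simp add: divide_right_mono del: cnj_sum complex_cnj_mult complex_mod_cnj)
        (rule norm_triangle_ineq)
    finally show ?thesis by (simp only: complex_mod_cnj)
  qed
  have "?L \<le> (\<Sum>(d, \<nu>)\<in>root_pairs k. (norm (\<Sum>i\<in>I. c i * ee (real (fst i * (u * snd i ^ r)) * (real \<nu> / real d))) +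
      norm (\<Sum>i\<in>I. cnj (c i) * ee (real (fst i * (u * snd i ^ r)) * (real \<nu> / real d)))) / 2)"
    unfolding case_prod_unfold I_def[symmetric] by (intro sum_mono) (rule cos_le)
  also have "\<dots> = (E c + E (\<lambda>i. cnj (c i))) / 2"
    unfolding E_def by (simp add: sum.distrib case_prod_unfold flip: sum_divide_distrib)
  also have "\<dots> \<le> (?R + ?R) / 2" by (intro divide_right_mono add_mono E) auto
  also have "\<dots> = ?R" by simp
  finally show ?thesis .
qed

text \<open>Telescoping in the modulus variable removes the dependence of the coefficients on the modulus.\<close>
lemma sum_norm_separate_modulus:
  fixes c :: "nat \<Rightarrow> 'i \<Rightarrow> complex" and z :: "'p \<Rightarrow> 'i \<Rightarrow> complex" and s :: "'p \<Rightarrow> nat"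
  assumes s: "\<And>p. p \<in> Z \<Longrightarrow> s p \<in> {A..<B}"
    and bd: "\<And>c' B'. B' \<ge> 0 \<Longrightarrow> (\<And>i. i \<in> I \<Longrightarrow> norm (c' i) \<le> B') \<Longrightarrow> (\<Sum>p\<in>Z. norm (\<Sum>i\<in>I. c' i * z p i)) \<le> \<Gamma> * B'"
    and B0: "\<And>i. i \<in> I \<Longrightarrow> norm (c A i) \<le> B0" "B0 \<ge> 0"
    and B1: "\<And>i n. i \<in> I \<Longrightarrow> A \<le> n \<Longrightarrow> n < B \<Longrightarrow> norm (c (Suc n) i - c n i) \<le> B1" "B1 \<ge> 0"
  shows "(\<Sum>p\<in>Z. norm (\<Sum>i\<in>I. c (s p) i * z p i)) \<le> \<Gamma> * (B0 + real (B - A) * B1)"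
proof -
  have tel: "c (s p) i = c A i + (\<Sum>n\<in>{A..<s p}. c (Suc n) i - c n i)" if "p \<in> Z" for p i
    using s[OF that] sum_Suc_diff'[of A "s p" "\<lambda>n. c n i"] by simp
  have "(\<Sum>p\<in>Z. norm (\<Sum>i\<in>I. c (s p) i * z p i)) \<le>
      (\<Sum>p\<in>Z. norm (\<Sum>i\<in>I. c A i * z p i) + (\<Sum>n\<in>{A..<B}. norm (\<Sum>i\<in>I. (c (Suc n) i - c n i) * z p i)))"
  proof (intro sum_mono)
    fix p assume p: "p \<in> Z"
    have "(\<Sum>i\<in>I. c (s p) i * z p i) = (\<Sum>i\<in>I. c A i * z p i) + (\<Sum>n\<in>{A..<s p}. \<Sum>i\<in>I. (c (Suc n) i - c n i) * z p i)"
      by (subst sum.swap) (simp add: tel[OF p] distrib_right sum.distrib sum_distrib_right)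
    also have "norm \<dots> \<le> norm (\<Sum>i\<in>I. c A i * z p i) + (\<Sum>n\<in>{A..<s p}. norm (\<Sum>i\<in>I. (c (Suc n) i - c n i) * z p i))"
      by (intro norm_triangle_le add_left_mono norm_sum)
    also have "(\<Sum>n\<in>{A..<s p}. norm (\<Sum>i\<in>I. (c (Suc n) i - c n i) * z p i)) \<le> (\<Sum>n\<in>{A..<B}. norm (\<Sum>i\<in>I. (c (Suc n) i - c n i) * z p i))"
      using s[OF p] by (intro sum_mono2) auto
    finally show "norm (\<Sum>i\<in>I. c (s p) i * z p i) \<le> norm (\<Sum>i\<in>I. c A i * z p i) + (\<Sum>n\<in>{A..<B}. norm (\<Sum>i\<in>I. (c (Suc n) i - c n i) * z p i))"
      by simp
  qed
  also have "\<dots> = (\<Sum>p\<in>Z. norm (\<Sum>i\<in>I. c A i * z p i)) + (\<Sum>n\<in>{A..<B}. \<Sum>p\<in>Z. norm (\<Sum>i\<in>I. (c (Suc n) i - c n i) * z p i))"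
    unfolding sum.distrib by (intro arg_cong2[of _ _ _ _ "(+)"] refl sum.swap)
  also have "\<dots> \<le> \<Gamma> * B0 + (\<Sum>n\<in>{A..<B}. \<Gamma> * B1)"
    using B0 B1 by (intro add_mono sum_mono bd) auto
  also have "\<dots> = \<Gamma> * (B0 + real (B - A) * B1)" by (simp add: algebra_simps)
  finally show ?thesis .
qed

section \<open>Finite Fourier expansion of smoothed counts\<close>

definition ap_count :: "nat \<Rightarrow> int \<Rightarrow> nat \<Rightarrow> real" where
  "ap_count M a d = real (card {m::int. \<bar>m\<bar> \<le> int M \<and> int d dvd m - a})"

text \<open>This counts with a trapezoid weight: 1 for |m| up to \<open>M\<close>, falling linearly
  to 0 at \<open>M + w\<close>. Its total mass is 2 M + w, the mean of the lengths 2 (M + j) + 1,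
  and \<open>smooth_error\<close> subtracts the corresponding density.\<close>

definition smooth_count :: "nat \<Rightarrow> nat \<Rightarrow> int \<Rightarrow> nat \<Rightarrow> real" where
  "smooth_count w M a d = (\<Sum>j<w. ap_count (M + j) a d) / real w"

abbreviation smooth_error :: "nat \<Rightarrow> nat \<Rightarrow> int \<Rightarrow> nat \<Rightarrow> real" where
  "smooth_error w M a d \<equiv> smooth_count w M a d - (2 * real M + real w) / real d"

definition dirichlet_kernel :: "nat \<Rightarrow> real \<Rightarrow> real" where
  "dirichlet_kernel M v = 1 + 2 * (\<Sum>m=1..M. cos (2 * pi * (real m * v)))"

text \<open>A kernel of de la Vallee Poussin type, the transform of the trapezoid weight. Away from
  the integers it decays quadratically, whereas \<open>dirichlet_kernel\<close> decays only
  linearly.\<close>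

definition trap_kernel :: "nat \<Rightarrow> nat \<Rightarrow> real \<Rightarrow> real" where
  "trap_kernel w M v = (\<Sum>j<w. dirichlet_kernel (M + j) v) / real w"

text \<open>The factor \<open>1 + cos (pi * v)\<close> folds the frequencies \<open>h\<close> and \<open>d - h\<close> together. It makes the
  kernel vanish at \<open>v = 1\<close>, so that the coefficient of a frequency depends on \<open>d\<close> without a jump
  at \<open>d = h\<close>.\<close>
definition folded_kernel :: "nat \<Rightarrow> nat \<Rightarrow> real \<Rightarrow> real" where
  "folded_kernel w M v = (1 + cos (pi * v)) * trap_kernel w M v"

lemma sum_symmetric_int_interval:
  fixes f :: "int \<Rightarrow> real"
  shows "(\<Sum>m\<in>{-int M..int M}. f m) = f 0 + (\<Sum>m=1..M. f (int m) + f (- int m))"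
proof (induction M)
  case (Suc M)
  have "{-int (Suc M)..int (Suc M)} = insert (int (Suc M)) (insert (- int (Suc M)) {-int M..int M})"
    by auto
  thus ?case using Suc by simp
qed auto

lemma sum_cos_orthogonality:
  assumes "d > 0"
  shows "(\<Sum>h<d. cos (2 * pi * (real h * (of_int n / real d)))) = (if int d dvd n then real d else 0)"
proof (cases "int d dvd n")
  case True
  then obtain k where "n = int d * k" by blast
  hence "cos (2 * pi * (real h * (of_int n / real d))) = 1" for h
    using assms cos_int_2pin[of "int h * k"] by (simp add: mult_ac)
  thus ?thesis using True by simp
next
  case False
  define z where "z = ee (of_int n / real d)"
  have "z ^ d = ee (of_int n)" using assms unfolding z_def by (subst ee_nat_mult[symmetric]) simp
  hence zd: "z ^ d = 1" by simp
  have "z \<noteq> 1"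
  proof
    assume "z = 1"
    hence "cos (2 * pi * (of_int n / real d)) = 1" by (simp add: z_def ee_def complex_eq_iff)
    then obtain k :: int where "2 * pi * (of_int n / real d) = of_int k * 2 * pi"
      using cos_one_2pi_int by blast
    hence "real_of_int n = of_int (k * int d)" using assms by (simp add: field_simps)
    hence "n = k * int d" by linarith
    thus False using False by simp
  qed
  have "(\<Sum>h<d. cos (2 * pi * (real h * (of_int n / real d)))) = Re (\<Sum>h<d. ee (real h * (of_int n / real d)))"
    by (simp add: ee_def)
  also have "(\<Sum>h<d. ee (real h * (of_int n / real d))) = (\<Sum>h<d. z ^ h)"
    by (simp only: z_def ee_nat_mult)
  also have "\<dots> = 0" using geometric_sum[OF \<open>z \<noteq> 1\<close>, of d] zd by simp
  finally show ?thesis using False by simp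
qed

text \<open>Orthogonality modulo \<open>d\<close> detects the congruence. Since the interval is
  symmetric, \<open>m\<close> and \<open>- m\<close> pair off and the sines cancel, which keeps the
  expansion real.\<close>

lemma ap_count_fourier:
  assumes "d > 0"
  shows "ap_count M a d = (\<Sum>h<d. cos (2 * pi * (real h * (of_int a / real d))) * dirichlet_kernel M (real h / real d)) / real d"
proof -
  let ?A = "{-int M..int M}"
  have eq: "{m::int. \<bar>m\<bar> \<le> int M \<and> int d dvd m - a} = {m\<in>?A. int d dvd m - a}" by auto
  have "real d * ap_count M a d = (\<Sum>m\<in>?A. if int d dvd m - a then real d else 0)"
    unfolding ap_count_def eq by (subst sum.If_cases) (auto simp: Int_def)
  also have "\<dots> = (\<Sum>m\<in>?A. \<Sum>h<d. cos (2 * pi * (real h * (of_int (m - a) / real d))))"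
    using assms by (simp only: sum_cos_orthogonality)
  also have "\<dots> = (\<Sum>h<d. \<Sum>m\<in>?A. cos (2 * pi * (real h * (of_int (m - a) / real d))))"
    by (rule sum.swap)
  also have "\<dots> = (\<Sum>h<d. cos (2 * pi * (real h * (of_int a / real d))) * dirichlet_kernel M (real h / real d))"
  proof (intro sum.cong refl)
    fix h
    let ?x = "2 * pi * (real h * (of_int a / real d))"
    let ?y = "\<lambda>m::nat. 2 * pi * (real m * (real h / real d))"
    have "cos (2 * pi * (real h * (of_int (int m - a) / real d))) + cos (2 * pi * (real h * (of_int (- int m - a) / real d)))
        = 2 * (cos ?x * cos (?y m))" for m
    proof -
      have 1: "2 * pi * (real h * (of_int (int m - a) / real d)) = ?y m - ?x"
        and 2: "2 * pi * (real h * (of_int (- int m - a) / real d)) = - (?y m + ?x)"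
        by (simp_all add: diff_divide_distrib right_diff_distrib algebra_simps)
      show ?thesis unfolding 1 2 cos_minus cos_diff cos_add by simp
    qed
    thus "(\<Sum>m\<in>?A. cos (2 * pi * (real h * (of_int (m - a) / real d)))) = cos ?x * dirichlet_kernel M (real h / real d)"
      unfolding sum_symmetric_int_interval dirichlet_kernel_def
      by (simp add: sum_distrib_left distrib_left mult_ac)
  qed
  finally show ?thesis using assms by (simp add: field_simps)
qed

lemma smooth_count_fourier:
  assumes "d > 0"
  shows "smooth_count w M a d = (\<Sum>h<d. cos (2 * pi * (real h * (of_int a / real d))) * trap_kernel w M (real h / real d)) / real d"
  unfolding smooth_count_def ap_count_fourier[OF assms] trap_kernel_def
  by (simp add: sum_divide_distrib sum_distrib_left mult_ac)
     (subst sum.swap, simp add: mult_ac)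

lemma trap_kernel_0: "w > 0 \<Longrightarrow> trap_kernel w M 0 = 2 * real M + real w"
proof -
  have "(\<Sum>j<n. dirichlet_kernel (M + j) 0) = real n * (2 * real M + real n)" for n
    by (induction n) (auto simp: dirichlet_kernel_def algebra_simps)
  thus "w > 0 \<Longrightarrow> trap_kernel w M 0 = 2 * real M + real w" by (simp add: trap_kernel_def)
qed

lemma trap_kernel_reflect:
  assumes "h \<le> d" "d > 0"
  shows "trap_kernel w M (real (d - h) / real d) = trap_kernel w M (real h / real d)"
proof -
  have "cos (2 * pi * (real m * (real (d - h) / real d))) = cos (2 * pi * (real m * (real h / real d)))" for m
  proof -
    have "2 * pi * (real m * (real (d - h) / real d)) = 2 * pi * of_int (int m) - 2 * pi * (real m * (real h / real d))"
      using assms by (simp add: of_nat_diff field_simps)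
    thus ?thesis using cos_int_2pin[of "int m"] sin_int_2pin[of "int m"] by (simp add: cos_diff)
  qed
  thus ?thesis by (simp add: trap_kernel_def dirichlet_kernel_def)
qed

text \<open>Frequency 0 is the expected main term. Inserting the factor
  \<open>1 + cos (pi * v)\<close> changes nothing: both the trapezoid kernel and the phase are
  invariant under h -> d - h, while \<open>cos (pi * h / d)\<close> changes sign, so the added terms
  cancel.\<close>

lemma smooth_count_folded:
  assumes "d > 0" "w > 0"
  shows "smooth_error w M a d =
     (\<Sum>h=1..<d. folded_kernel w M (real h / real d) * cos (2 * pi * (real h * (of_int a / real d)))) / real d"
proof -
  define f where "f h = cos (2 * pi * (real h * (of_int a / real d))) * trap_kernel w M (real h / real d)" for h
  define g where "g h = cos (pi * (real h / real d)) * f h" for h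
  have refl: "f (d - h) = f h" "g (d - h) = - g h" if "h \<in> {1..<d}" for h
  proof -
    have "2 * pi * (real (d - h) * (of_int a / real d)) = 2 * pi * of_int a - 2 * pi * (real h * (of_int a / real d))"
      using that by (simp add: of_nat_diff field_simps)
    hence "cos (2 * pi * (real (d - h) * (of_int a / real d))) = cos (2 * pi * (real h * (of_int a / real d)))"
      by (simp add: cos_diff)
    thus 1: "f (d - h) = f h" using that trap_kernel_reflect[of h d w M] by (simp only: f_def) simp
    have "pi * (real (d - h) / real d) = pi - pi * (real h / real d)"
      using that by (simp add: of_nat_diff field_simps)
    thus "g (d - h) = - g h" unfolding g_def 1 by (simp only: cos_diff) simp
  qed
  have "(\<Sum>h=1..<d. g h) = (\<Sum>h=1..<d. g (d - h))"
    by (rule sum.reindex_bij_witness[of _ "\<lambda>h. d - h" "\<lambda>h. d - h"]) auto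
  also have "\<dots> = - (\<Sum>h=1..<d. g h)" using refl by (simp add: sum_negf)
  finally have "(\<Sum>h=1..<d. g h) = 0" by simp
  moreover have "{..<d} = insert 0 {1..<d}" using assms by auto
  hence "(\<Sum>h<d. f h) = 2 * real M + real w + (\<Sum>h=1..<d. f h)"
    using assms by (simp add: f_def trap_kernel_0)
  ultimately have "(\<Sum>h<d. f h) = 2 * real M + real w + (\<Sum>h=1..<d. f h + g h)"
    by (simp add: sum.distrib)
  moreover have "f h + g h = folded_kernel w M (real h / real d) * cos (2 * pi * (real h * (of_int a / real d)))" for h
    by (simp add: f_def g_def folded_kernel_def algebra_simps)
  moreover have "smooth_count w M a d = (\<Sum>h<d. f h) / real d"
    unfolding f_def by (rule smooth_count_fourier[OF assms(1)])
  ultimately show ?thesis by (simp add: add_divide_distrib)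
qed

section \<open>Closed forms, size and variation of the kernels\<close>

lemma dirichlet_kernel_sin: "dirichlet_kernel M v * sin (pi * v) = sin ((2 * real M + 1) * (pi * v))"
proof (induction M)
  case (Suc M)
  have "sin ((2 * real (Suc M) + 1) * (pi * v)) - sin ((2 * real M + 1) * (pi * v)) = 
      2 * sin (pi * v) * cos (2 * pi * (real (Suc M) * v))"
  proof -
    have "sin (y + z) - sin (y - z) = 2 * sin z * cos y" for y z :: real
      by (simp add: sin_add sin_diff)
    from this[of "2 * pi * (real (Suc M) * v)" "pi * v"] show ?thesis by (simp add: algebra_simps)
  qed
  moreover have "dirichlet_kernel (Suc M) v = dirichlet_kernel M v + 2 * cos (2 * pi * (real (Suc M) * v))"
    by (simp add: dirichlet_kernel_def)
  ultimately show ?case using Suc by (simp add: algebra_simps)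
qed (simp add: dirichlet_kernel_def)

lemma trap_kernel_sin:
  assumes "w > 0"
  shows "trap_kernel w M v * (2 * real w * (sin (pi * v))^2) = 
     cos (2 * pi * (real M * v)) - cos (2 * pi * (real (M + w) * v))"
proof -
  have "(\<Sum>j<n. dirichlet_kernel (M + j) v) * (2 * (sin (pi * v))^2) = 
     cos (2 * pi * (real M * v)) - cos (2 * pi * (real (M + n) * v))" for n
  proof (induction n)
    case (Suc n)
    have "cos (2 * pi * (real (M + n) * v)) - cos (2 * pi * (real (M + Suc n) * v)) = 
       2 * sin ((2 * real (M + n) + 1) * (pi * v)) * sin (pi * v)"
    proof -
      have "cos (y - z) - cos (y + z) = 2 * sin y * sin z" for y z :: real
        by (simp add: cos_add cos_diff)
      from this[of "(2 * real (M + n) + 1) * (pi * v)" "pi * v"] show ?thesis by (simp add: algebra_simps)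
    qed
    also have "\<dots> = dirichlet_kernel (M + n) v * (2 * (sin (pi * v))^2)"
      unfolding dirichlet_kernel_sin[symmetric] by (simp add: power2_eq_square)
    finally show ?case using Suc by (simp add: distrib_right)
  qed auto
  from this[of w] assms show ?thesis by (simp add: trap_kernel_def)
qed

lemma folded_kernel_1 [simp]: "folded_kernel w M 1 = 0"
  by (simp add: folded_kernel_def)

text \<open>The closed form of the trapezoid kernel has \<open>(sin (pi * v))^2\<close> in the
  denominator. By the half-angle formulas the factor \<open>1 + cos (pi * v)\<close> cancels its
  part \<open>(cos (pi * v / 2))^2\<close>, which removes the singularity at 1 and leaves only the
  one at 0.\<close>

lemma folded_kernel_closed_form:
  assumes "w > 0" "0 < v" "v \<le> 1"
  shows "folded_kernel w M v = (cos (2 * pi * (real M * v)) - cos (2 * pi * (real (M + w) * v)))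
        / (4 * real w * (sin (pi * v / 2))^2)"
proof (cases "v = 1")
  case True
  thus ?thesis using cos_int_2pin[of "int M"] cos_int_2pin[of "int (M + w)"] by simp
next
  case False
  have s: "sin (pi * v / 2) > 0" using assms by (intro sin_gt_zero) auto
  have "pi * v < pi * 1" using assms False by (intro mult_strict_left_mono) auto
  hence c: "cos (pi * v / 2) > 0" using assms by (intro cos_gt_zero) auto
  have 1: "1 + cos (pi * v) = 2 * (cos (pi * v / 2))^2"
    using cos_double_cos[of "pi * v / 2"] by simp
  have 2: "sin (pi * v) = 2 * sin (pi * v / 2) * cos (pi * v / 2)"
    using sin_double[of "pi * v / 2"] by simp
  have "folded_kernel w M v * (4 * real w * (sin (pi * v / 2))^2)
      = trap_kernel w M v * (2 * real w * (sin (pi * v))^2)"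
    unfolding folded_kernel_def 1 2 by (simp add: power_mult_distrib)
  also have "\<dots> = cos (2 * pi * (real M * v)) - cos (2 * pi * (real (M + w) * v))"
    by (rule trap_kernel_sin[OF assms(1)])
  finally show ?thesis using s assms by (simp add: field_simps)
qed

lemma cos_lipschitz: "\<bar>cos x - cos y\<bar> \<le> \<bar>x - y :: real\<bar>"
proof -
  have "\<bar>cos x - cos y\<bar> = 2 * (\<bar>sin ((x + y) / 2)\<bar> * \<bar>sin ((y - x) / 2)\<bar>)"
    by (simp add: cos_diff_cos abs_mult)
  also have "\<dots> \<le> 2 * (1 * \<bar>(y - x) / 2\<bar>)"
    by (intro mult_left_mono mult_mono abs_sin_x_le_abs_x) auto
  finally show ?thesis by simp
qed

text \<open>Term-by-term bounds, intended for arguments up to about 1 / Q, where the kernel has not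
  begun to decay. The constants use 2 pi < 8: each Dirichlet kernel has size at most 3 Q and
  Lipschitz constant at most 16 Q^2, and 44 = 2 * 16 + 4 * 3.\<close>

lemma folded_kernel_bound_low:
  assumes "w > 0" "M + w \<le> Q"
  shows "\<bar>folded_kernel w M v\<bar> \<le> 6 * real Q"
    and "\<bar>folded_kernel w M v - folded_kernel w M v'\<bar> \<le> 44 * (real Q)^2 * \<bar>v - v'\<bar>"
proof -
  have Q1: "real Q \<ge> 1" using assms by simp
  have D: "\<bar>dirichlet_kernel n v\<bar> \<le> 3 * real Q" if "n \<le> Q" for n v
  proof -
    have "\<bar>dirichlet_kernel n v\<bar> \<le> 1 + 2 * \<bar>\<Sum>m=1..n. cos (2 * pi * (real m * v))\<bar>"
      unfolding dirichlet_kernel_def by linarith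
    also have "\<bar>\<Sum>m=1..n. cos (2 * pi * (real m * v))\<bar> \<le> (\<Sum>m=1..n. 1)"
      by (rule order.trans[OF sum_abs]) (intro sum_mono abs_cos_le_one)
    finally show ?thesis using that Q1 by simp
  qed
  have L: "\<bar>dirichlet_kernel n v - dirichlet_kernel n v'\<bar> \<le> 16 * (real Q)^2 * \<bar>v - v'\<bar>" if "n \<le> Q" for n
  proof -
    have "dirichlet_kernel n v - dirichlet_kernel n v' = 2 * (\<Sum>m=1..n. cos (2 * pi * (real m * v)) - cos (2 * pi * (real m * v')))"
      by (simp add: dirichlet_kernel_def sum_subtractf)
    hence "\<bar>dirichlet_kernel n v - dirichlet_kernel n v'\<bar> \<le> 2 * (\<Sum>m=1..n. \<bar>cos (2 * pi * (real m * v)) - cos (2 * pi * (real m * v'))\<bar>)"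
      by (simp add: abs_mult sum_abs)
    also have "\<dots> \<le> 2 * (\<Sum>m=1..n. 8 * real Q * \<bar>v - v'\<bar>)"
    proof (intro mult_left_mono sum_mono)
      fix m assume m: "m \<in> {1..n}"
      have "\<bar>cos (2 * pi * (real m * v)) - cos (2 * pi * (real m * v'))\<bar> \<le> \<bar>2 * pi * (real m * v) - 2 * pi * (real m * v')\<bar>"
        by (rule cos_lipschitz)
      also have "\<dots> = 2 * pi * real m * \<bar>v - v'\<bar>" by (simp add: abs_mult flip: right_diff_distrib)
      also have "\<dots> \<le> 2 * 4 * real Q * \<bar>v - v'\<bar>"
        using m that pi_less_4 by (intro mult_right_mono mult_mono) auto
      finally show "\<bar>cos (2 * pi * (real m * v)) - cos (2 * pi * (real m * v'))\<bar> \<le> 8 * real Q * \<bar>v - v'\<bar>" by simp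
    qed auto
    also have "\<dots> = 16 * real n * real Q * \<bar>v - v'\<bar>" by simp
    also have "\<dots> \<le> 16 * real Q * real Q * \<bar>v - v'\<bar>"
      using that by (intro mult_right_mono mult_left_mono) auto
    finally show ?thesis by (simp add: power2_eq_square)
  qed
  have TD: "\<bar>trap_kernel w M v\<bar> \<le> 3 * real Q" for v
  proof -
    have "\<bar>\<Sum>j<w. dirichlet_kernel (M + j) v\<bar> \<le> (\<Sum>j<w. 3 * real Q)"
      by (rule order.trans[OF sum_abs]) (use assms in \<open>intro sum_mono D, auto\<close>)
    thus ?thesis using assms by (simp add: trap_kernel_def field_simps)
  qed
  have TL: "\<bar>trap_kernel w M v - trap_kernel w M v'\<bar> \<le> 16 * (real Q)^2 * \<bar>v - v'\<bar>"
  proof -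
    have "\<bar>\<Sum>j<w. dirichlet_kernel (M + j) v - dirichlet_kernel (M + j) v'\<bar> \<le> (\<Sum>j<w. 16 * (real Q)^2 * \<bar>v - v'\<bar>)"
      by (rule order.trans[OF sum_abs]) (use assms in \<open>intro sum_mono L, auto\<close>)
    thus ?thesis using assms
      by (simp add: trap_kernel_def sum_subtractf field_simps flip: diff_divide_distrib)
  qed
  have c2: "\<bar>1 + cos (pi * v)\<bar> \<le> 2" for v
    using cos_ge_minus_one[of "pi * v"] cos_le_one[of "pi * v"] by linarith
  have "\<bar>folded_kernel w M v\<bar> \<le> 2 * (3 * real Q)"
    unfolding folded_kernel_def abs_mult by (intro mult_mono TD c2) auto
  thus "\<bar>folded_kernel w M v\<bar> \<le> 6 * real Q" by simp
  have "folded_kernel w M v - folded_kernel w M v' = 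
      (1 + cos (pi * v)) * (trap_kernel w M v - trap_kernel w M v') + 
      (cos (pi * v) - cos (pi * v')) * trap_kernel w M v'"
    by (simp add: folded_kernel_def algebra_simps)
  hence "\<bar>folded_kernel w M v - folded_kernel w M v'\<bar> \<le> 
      \<bar>1 + cos (pi * v)\<bar> * \<bar>trap_kernel w M v - trap_kernel w M v'\<bar> + 
      \<bar>cos (pi * v) - cos (pi * v')\<bar> * \<bar>trap_kernel w M v'\<bar>"
    by (metis abs_mult abs_triangle_ineq)
  also have "\<dots> \<le> 2 * (16 * (real Q)^2 * \<bar>v - v'\<bar>) + (4 * \<bar>v - v'\<bar>) * (3 * real Q)"
  proof (intro add_mono mult_mono TD TL c2)
    have "\<bar>cos (pi * v) - cos (pi * v')\<bar> \<le> \<bar>pi * v - pi * v'\<bar>" by (rule cos_lipschitz)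
    also have "\<dots> = pi * \<bar>v - v'\<bar>" by (simp add: abs_mult flip: right_diff_distrib)
    also have "\<dots> \<le> 4 * \<bar>v - v'\<bar>" using pi_less_4 by (intro mult_right_mono) auto
    finally show "\<bar>cos (pi * v) - cos (pi * v')\<bar> \<le> 4 * \<bar>v - v'\<bar>" .
  qed auto
  also have "\<dots> = 32 * (real Q)^2 * \<bar>v - v'\<bar> + 12 * (real Q * 1) * \<bar>v - v'\<bar>" by simp
  also have "\<dots> \<le> 32 * (real Q)^2 * \<bar>v - v'\<bar> + 12 * (real Q * real Q) * \<bar>v - v'\<bar>"
    using Q1 by (intro add_left_mono mult_right_mono mult_left_mono) auto
  also have "\<dots> = 44 * (real Q)^2 * \<bar>v - v'\<bar>" by (simp add: power2_eq_square)
  finally show "\<bar>folded_kernel w M v - folded_kernel w M v'\<bar> \<le> 44 * (real Q)^2 * \<bar>v - v'\<bar>" .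
qed

text \<open>In the closed form the numerator is at most 2 and has Lipschitz constant 16 Q, while the
  half-angle sine is at least a / 2. The two summands of the second bound come from varying the
  numerator and the denominator in turn.\<close>

lemma folded_kernel_bound_high:
  assumes "w > 0" "M + w \<le> Q" "0 < a" "a \<le> v" "a \<le> v'" "v \<le> 1" "v' \<le> 1"
  shows "\<bar>folded_kernel w M v\<bar> \<le> 2 / (real w * a\<^sup>2)"
    and "\<bar>folded_kernel w M v - folded_kernel w M v'\<bar> \<le> 16 / real w * (real Q / a\<^sup>2 + 1 / a ^ 3) * \<bar>v - v'\<bar>"
proof -
  define N where "N v = cos (2 * pi * (real M * v)) - cos (2 * pi * (real (M + w) * v))" for v
  define S where "S v = sin (pi * v / 2)" for v
  have F: "folded_kernel w M v = N v / (4 * real w * (S v)^2)" if "a \<le> v" "v \<le> 1" for v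
    using folded_kernel_closed_form[of w v M] that assms by (simp add: N_def S_def)
  have S: "a / 2 \<le> S v" if "a \<le> v" "v \<le> 1" for v
  proof -
    have "pi * v / 2 / 2 \<le> S v" unfolding S_def using that assms by (intro half_le_sin) auto
    moreover have "2 * a \<le> pi * v" using that assms pi_ge_two by (intro mult_mono) auto
    ultimately show ?thesis by simp
  qed
  have N: "\<bar>N v\<bar> \<le> 2" for v
    using abs_cos_le_one[of "2 * pi * (real M * v)"] abs_cos_le_one[of "2 * pi * (real (M + w) * v)"]
    unfolding N_def by linarith
  have Spos: "S v > 0" if "a \<le> v" "v \<le> 1" for v using S[OF that] assms by simp
  have S2: "a\<^sup>2 / 4 \<le> (S v)^2" if "a \<le> v" "v \<le> 1" for v
    using power_mono[OF S[OF that], of 2] assms by (simp add: power_divide)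
  have "\<bar>folded_kernel w M v\<bar> = \<bar>N v\<bar> / (4 * real w * (S v)^2)"
    using assms by (simp add: F abs_mult)
  also have "\<dots> \<le> 2 / (4 * real w * (a\<^sup>2 / 4))"
    using assms by (intro frac_le N mult_left_mono S2) auto
  finally show "\<bar>folded_kernel w M v\<bar> \<le> 2 / (real w * a\<^sup>2)" by simp
  define \<delta> where "\<delta> = \<bar>v - v'\<bar>"
  have Nlip: "\<bar>N v - N v'\<bar> \<le> 16 * real Q * \<delta>"
  proof -
    have *: "\<bar>cos (2 * pi * (real n * v)) - cos (2 * pi * (real n * v'))\<bar> \<le> 8 * real Q * \<delta>" if "n \<le> Q" for n
    proof -
      have "\<bar>cos (2 * pi * (real n * v)) - cos (2 * pi * (real n * v'))\<bar> \<le> \<bar>2 * pi * (real n * v) - 2 * pi * (real n * v')\<bar>"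
        by (rule cos_lipschitz)
      also have "\<dots> = 2 * pi * real n * \<delta>" by (simp add: abs_mult \<delta>_def flip: right_diff_distrib)
      also have "\<dots> \<le> 2 * 4 * real Q * \<delta>"
        using that pi_less_4 by (intro mult_right_mono mult_mono) (auto simp: \<delta>_def)
      finally show ?thesis by simp
    qed
    show ?thesis using *[of M] *[of "M + w"] assms(2) unfolding N_def by linarith
  qed
  let ?s = "S v" and ?s' = "S v'"
  have sp: "?s > 0" "?s' > 0" using Spos assms by auto
  \<comment> \<open>The factor \<open>?s + ?s'\<close> is kept because it cancels one power of the
    small sines below, which yields \<open>1 / a ^ 3\<close> instead of
    \<open>1 / a ^ 4\<close>.\<close>
  have Sdiff: "\<bar>?s'\<^sup>2 - ?s^2\<bar> \<le> 2 * \<delta> * (?s + ?s')"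
  proof -
    have "?s'\<^sup>2 - ?s^2 = sin (pi * v' / 2 - pi * v / 2) * sin (pi * v' / 2 + pi * v / 2)"
      unfolding S_def sin_diff sin_add
    proof -
      have "(a * c - d * b) * (a * c + d * b) = a^2 - b^2" if "c^2 = 1 - b^2" "d^2 = 1 - a^2" for a b c d :: real
      proof -
        have "(a * c - d * b) * (a * c + d * b) = a^2 * c^2 - d^2 * b^2"
        by (simp add: algebra_simps power2_eq_square)
        thus ?thesis unfolding that by (simp add: algebra_simps)
      qed
      thus "(sin (pi * v' / 2))^2 - (sin (pi * v / 2))^2 = 
        (sin (pi * v' / 2) * cos (pi * v / 2) - cos (pi * v' / 2) * sin (pi * v / 2)) *
        (sin (pi * v' / 2) * cos (pi * v / 2) + cos (pi * v' / 2) * sin (pi * v / 2))"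
        by (simp only: cos_squared_eq)
    qed
    also have "\<bar>\<dots>\<bar> \<le> (2 * \<delta>) * (?s + ?s')"
      unfolding abs_mult
    proof (intro mult_mono)
      have "\<bar>sin (pi * v' / 2 - pi * v / 2)\<bar> \<le> \<bar>pi * v' / 2 - pi * v / 2\<bar>" by (rule abs_sin_x_le_abs_x)
      also have "\<dots> = \<bar>(pi / 2) * (v' - v)\<bar>" by (simp add: right_diff_distrib)
      also have "\<dots> = (pi / 2) * \<delta>" by (simp add: abs_mult \<delta>_def abs_minus_commute)
      also have "\<dots> \<le> 2 * \<delta>" using pi_less_4 by (intro mult_right_mono) (auto simp: \<delta>_def)
      finally show "\<bar>sin (pi * v' / 2 - pi * v / 2)\<bar> \<le> 2 * \<delta>" .
      have "\<bar>sin (pi * v' / 2 + pi * v / 2)\<bar> \<le> \<bar>?s'\<bar> * \<bar>cos (pi * v / 2)\<bar> + \<bar>cos (pi * v' / 2)\<bar> * \<bar>?s\<bar>"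
        unfolding sin_add S_def by (metis abs_mult abs_triangle_ineq)
      also have "\<dots> \<le> \<bar>?s'\<bar> * 1 + 1 * \<bar>?s\<bar>" by (intro add_mono mult_mono) auto
      finally show "\<bar>sin (pi * v' / 2 + pi * v / 2)\<bar> \<le> ?s + ?s'" using sp by simp
    qed (auto simp: \<delta>_def)
    finally show ?thesis by simp
  qed
  have inv2: "1 / ?s^2 \<le> 4 / a\<^sup>2"
    using S2[of v] assms sp by (simp add: field_simps)
  have inv3: "1 / (?s^2 * ?s') \<le> 8 / a ^ 3" "1 / (?s * ?s'\<^sup>2) \<le> 8 / a ^ 3"
  proof -
    have "(a / 2)^2 * (a / 2) \<le> ?s^2 * ?s'" "(a / 2) * (a / 2)^2 \<le> ?s * ?s'\<^sup>2"
      using S[of v] S[of v'] assms sp by (intro mult_mono power_mono; simp)+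
    moreover have "(a / 2)^2 * (a / 2) = a ^ 3 / 8" "(a / 2) * (a / 2)^2 = a ^ 3 / 8"
      by (simp_all add: power2_eq_square power3_eq_cube)
    ultimately show "1 / (?s^2 * ?s') \<le> 8 / a ^ 3" "1 / (?s * ?s'\<^sup>2) \<le> 8 / a ^ 3"
      using sp assms by (simp_all add: field_simps)
  qed
  have "folded_kernel w M v - folded_kernel w M v' = (N v / ?s^2 - N v' / ?s'\<^sup>2) / (4 * real w)"
    using assms by (simp add: F diff_divide_distrib mult.commute)
  also have "N v / ?s^2 - N v' / ?s'\<^sup>2 = (N v - N v') * (1 / ?s^2) + N v' * ((?s'\<^sup>2 - ?s^2) / (?s^2 * ?s'\<^sup>2))"
    using sp by (simp add: field_simps)
  finally have "\<bar>folded_kernel w M v - folded_kernel w M v'\<bar> = 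
      \<bar>(N v - N v') * (1 / ?s^2) + N v' * ((?s'\<^sup>2 - ?s^2) / (?s^2 * ?s'\<^sup>2))\<bar> / (4 * real w)"
    by simp
  also have "\<dots> \<le> (\<bar>N v - N v'\<bar> * (1 / ?s^2) + \<bar>N v'\<bar> * (\<bar>?s'\<^sup>2 - ?s^2\<bar> / (?s^2 * ?s'\<^sup>2))) / (4 * real w)"
    by (intro divide_right_mono order.trans[OF abs_triangle_ineq]) (auto simp: abs_mult)
  also have "\<dots> \<le> ((16 * real Q * \<delta>) * (4 / a\<^sup>2) + 2 * ((2 * \<delta> * (?s + ?s')) / (?s^2 * ?s'\<^sup>2))) / (4 * real w)"
    by (intro divide_right_mono add_mono mult_mono N Nlip inv2 Sdiff) (auto simp: \<delta>_def)
  also have "(2 * \<delta> * (?s + ?s')) / (?s^2 * ?s'\<^sup>2) = 2 * \<delta> * (1 / (?s * ?s'\<^sup>2) + 1 / (?s^2 * ?s'))"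
    using sp by (simp add: field_simps power2_eq_square)
  also have "((16 * real Q * \<delta>) * (4 / a\<^sup>2) + 2 * (2 * \<delta> * (1 / (?s * ?s'\<^sup>2) + 1 / (?s^2 * ?s')))) / (4 * real w)
      \<le> ((16 * real Q * \<delta>) * (4 / a\<^sup>2) + 2 * (2 * \<delta> * (8 / a ^ 3 + 8 / a ^ 3))) / (4 * real w)"
    by (intro divide_right_mono add_left_mono mult_left_mono add_mono inv3) (auto simp: \<delta>_def)
  also have "\<dots> = 16 / real w * (real Q / a\<^sup>2 + 1 / a ^ 3) * \<delta>"
    using assms by (simp add: field_simps)
  finally show "\<bar>folded_kernel w M v - folded_kernel w M v'\<bar> \<le> 16 / real w * (real Q / a\<^sup>2 + 1 / a ^ 3) * \<bar>v - v'\<bar>"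
    by (simp add: \<delta>_def)
qed

text \<open>The index \<open>i\<close> is a pair (h, t). Setting the coefficient to 0 for h > d lets
  all moduli of a dyadic block share one range of frequencies.\<close>

definition folded_coeff :: "nat \<Rightarrow> (nat \<Rightarrow> nat) \<Rightarrow> (nat \<Rightarrow> complex) \<Rightarrow> nat \<Rightarrow> nat \<times> nat \<Rightarrow> complex" where
  "folded_coeff w M \<gamma> d i = (if fst i \<le> d then \<gamma> (snd i) * of_real (folded_kernel w (M (snd i)) (real (fst i) / real d)) else 0)"

lemma norm_folded_coeff_le:
  assumes "norm (\<gamma> (snd i)) \<le> 1" "B \<ge> 0"
    and "fst i \<le> d \<Longrightarrow> \<bar>folded_kernel w (M (snd i)) (real (fst i) / real d)\<bar> \<le> B"
  shows "norm (folded_coeff w M \<gamma> d i) \<le> B"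
proof (cases "fst i \<le> d")
  case True
  have "norm (\<gamma> (snd i)) * \<bar>folded_kernel w (M (snd i)) (real (fst i) / real d)\<bar> \<le> 1 * B"
    using assms True by (intro mult_mono) auto
  thus ?thesis using True by (simp add: folded_coeff_def norm_mult)
qed (use assms in \<open>simp add: folded_coeff_def\<close>)

text \<open>The cut-off at h = d moves as d grows by 1. The only frequency that enters is h = d + 1,
  and its kernel value is taken at 1, where \<open>folded_kernel\<close> vanishes; hence there is no
  jump.\<close>

lemma norm_folded_coeff_diff_le:
  assumes "norm (\<gamma> (snd i)) \<le> 1" "B \<ge> 0"
    and "fst i \<le> d \<Longrightarrow> \<bar>folded_kernel w (M (snd i)) (real (fst i) / real (Suc d)) - folded_kernel w (M (snd i)) (real (fst i) / real d)\<bar> \<le> B"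
  shows "norm (folded_coeff w M \<gamma> (Suc d) i - folded_coeff w M \<gamma> d i) \<le> B"
proof (cases "fst i \<le> d")
  case True
  have "norm (\<gamma> (snd i)) * \<bar>folded_kernel w (M (snd i)) (real (fst i) / real (Suc d)) - folded_kernel w (M (snd i)) (real (fst i) / real d)\<bar> \<le> 1 * B"
    using assms True by (intro mult_mono) auto
  moreover have "folded_coeff w M \<gamma> (Suc d) i - folded_coeff w M \<gamma> d i = 
      \<gamma> (snd i) * of_real (folded_kernel w (M (snd i)) (real (fst i) / real (Suc d)) - folded_kernel w (M (snd i)) (real (fst i) / real d))"
    using True by (simp add: folded_coeff_def right_diff_distrib)
  ultimately show ?thesis by (simp only: norm_mult norm_of_real)
next
  case False
  have "folded_coeff w M \<gamma> (Suc d) i = 0"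
  proof (cases "fst i = Suc d")
    case True
    hence "real (fst i) / real (Suc d) = 1" by simp
    thus ?thesis by (simp add: folded_coeff_def del: of_nat_Suc)
  qed (use False in \<open>simp add: folded_coeff_def\<close>)
  thus ?thesis using False assms by (simp add: folded_coeff_def)
qed

section \<open>Dyadic blocks of frequencies for moduli in one dyadic range\<close>

lemma dyadic_cover: "(\<Sum>h=1..<2 ^ Suc k :: nat. f h) = (\<Sum>j\<le>k. \<Sum>h\<in>{2^j..<2*2^j}. f h :: 'a :: comm_monoid_add)"
proof (induction k)
  case 0
  have "{1..<2 ^ Suc 0} = {1::nat}" "{2^0..<2*2^0} = {1::nat}" by auto
  thus ?case by simp
next
  case (Suc k)
  have "{1..<2 ^ Suc (Suc k)} = {1..<2 ^ Suc k} \<union> {2 ^ Suc k..<2 * 2 ^ Suc k :: nat}" by auto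
  moreover have "{1..<2 ^ Suc k} \<inter> {2 ^ Suc k..<2 * 2 ^ Suc k :: nat} = {}" by auto
  ultimately have "(\<Sum>h=1..<2 ^ Suc (Suc k). f h) = (\<Sum>h=1..<2 ^ Suc k. f h) + (\<Sum>h\<in>{2 ^ Suc k..<2 * 2 ^ Suc k}. f h)"
    by (simp only:) (rule sum.union_disjoint, auto)
  thus ?case using Suc by (simp only: sum.atMost_Suc)
qed

text \<open>The setting after Moebius inversion: \<open>u\<close> will be
  \<open>b ^ (r - 1)\<close>, and \<open>P\<close> bounds both \<open>u * t ^ r\<close> and the
  half-lengths of the sharp intervals. The latter are widened before use: half-length at most P, a
  shift by w and a ramp of width w, with w <= 2 P, give the bound 5 P.\<close>

context
  fixes T K u r k P w :: nat and M :: "nat \<Rightarrow> nat" and \<gamma> :: "nat \<Rightarrow> complex"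
  assumes TK: "T < 2 ^ K" and ur: "u \<ge> 1" "r \<ge> 1" and kK: "k \<le> K" and P: "P \<ge> 1"
    and l: "\<And>t. t \<in> {1..T} \<Longrightarrow> u * t ^ r \<le> P"
    and M: "\<And>t. t \<in> {1..T} \<Longrightarrow> M t + w \<le> 5 * P"
    and w: "w \<ge> 1" "w \<le> 2 * P"
    and \<gamma>: "\<And>t. t \<in> {1..T} \<Longrightarrow> norm (\<gamma> t) \<le> 1"
begin

abbreviation block_sum :: "nat \<Rightarrow> real" where
  "block_sum H \<equiv> (\<Sum>(d, \<nu>)\<in>root_pairs k. norm (\<Sum>i\<in>{H..<2*H} \<times> {1..T}. folded_coeff w M \<gamma> d i *
        of_real (cos (2 * pi * (real (fst i * (u * snd i ^ r)) * (real \<nu> / real d))))))"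

text \<open>Partial summation over the 2^k steps of the modulus: \<open>B0\<close> bounds the
  coefficients at the start of the block and \<open>B1\<close> each increment, so the sieve bound is
  multiplied by the size plus the total variation.\<close>

lemma folded_block_bound_aux:
  assumes "H \<ge> 1" "B0 \<ge> 0" "B1 \<ge> 0"
    and B0: "\<And>h t. h \<in> {H..<2*H} \<Longrightarrow> t \<in> {1..T} \<Longrightarrow> h \<le> 2 ^ k \<Longrightarrow> \<bar>folded_kernel w (M t) (real h / 2 ^ k)\<bar> \<le> B0"
    and B1: "\<And>h t n. h \<in> {H..<2*H} \<Longrightarrow> t \<in> {1..T} \<Longrightarrow> 2 ^ k \<le> n \<Longrightarrow> n < 2 * 2 ^ k \<Longrightarrow> h \<le> n \<Longrightarrow>
        \<bar>folded_kernel w (M t) (real h / real (Suc n)) - folded_kernel w (M t) (real h / real n)\<bar> \<le> B1"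
  shows "block_sum H
     \<le> 25 * (real K + 2)^2 * sqrt (2 ^ k * real H * real T * (real H * real P + 2 ^ k)) * (B0 + 2 ^ k * B1)"
proof -
  have "(\<Sum>p\<in>root_pairs k. norm (\<Sum>i\<in>{H..<2*H} \<times> {1..T}. folded_coeff w M \<gamma> (fst p) i *
        of_real (cos (2 * pi * (real (fst i * (u * snd i ^ r)) * (real (snd p) / real (fst p)))))))
     \<le> 25 * (real K + 2)^2 * sqrt (2 ^ k * real H * real T * (real H * real P + 2 ^ k)) * (B0 + real (2 * 2 ^ k - 2 ^ k) * B1)"
  proof (rule sum_norm_separate_modulus)
    show "fst p \<in> {2 ^ k..<2 * 2 ^ k}" if "p \<in> root_pairs k" for p
      using that by (auto simp: root_pairs_def)
    show "norm (folded_coeff w M \<gamma> (2 ^ k) i) \<le> B0" if "i \<in> {H..<2*H} \<times> {1..T}" for i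
      using that \<gamma> B0[of "fst i" "snd i"] assms by (intro norm_folded_coeff_le) auto
    show "norm (folded_coeff w M \<gamma> (Suc n) i - folded_coeff w M \<gamma> n i) \<le> B1" 
      if "i \<in> {H..<2*H} \<times> {1..T}" "2 ^ k \<le> n" "n < 2 * 2 ^ k" for i n
      using that \<gamma> B1[of "fst i" "snd i" n] assms by (intro norm_folded_coeff_diff_le) auto
    fix c' :: "nat \<times> nat \<Rightarrow> complex" and B' :: real
    assume "B' \<ge> 0" and c': "\<And>i. i \<in> {H..<2*H} \<times> {1..T} \<Longrightarrow> norm (c' i) \<le> B'"
    thus "(\<Sum>p\<in>root_pairs k. norm (\<Sum>i\<in>{H..<2*H} \<times> {1..T}. c' i *
        of_real (cos (2 * pi * (real (fst i * (u * snd i ^ r)) * (real (snd p) / real (fst p)))))))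
      \<le> 25 * (real K + 2)^2 * sqrt (2 ^ k * real H * real T * (real H * real P + 2 ^ k)) * B'"
      using root_pairs_block_bound[OF TK ur assms(1) kK P l c' \<open>B' \<ge> 0\<close>] by (simp only: case_prod_unfold)
  qed (use assms in auto)
  moreover have "real (2 * 2 ^ k - 2 ^ k) = 2 ^ k" by (simp add: mult_2)
  ultimately show ?thesis by (simp only: case_prod_unfold)
qed

lemma frac_diff_consecutive:
  assumes "2 ^ k \<le> n" "h < 2 * H"
  shows "\<bar>real h / real (Suc n) - real h / real n\<bar> \<le> 2 * real H / (2 ^ k)^2"
proof -
  have n: "real n \<ge> 2 ^ k" using assms(1) by (metis of_nat_le_iff of_nat_numeral of_nat_power)
  have npos: "real n > 0" using n by (smt (verit) zero_less_power)
  have "\<bar>real h / real (Suc n) - real h / real n\<bar> = real h / (real n * real (Suc n))"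
  proof -
    have "real h / real (Suc n) - real h / real n = - (real h / (real n * real (Suc n)))"
      using npos by (simp add: field_simps)
    thus ?thesis by simp
  qed
  also have "\<dots> \<le> 2 * real H / (2 ^ k * 2 ^ k)"
  proof (intro frac_le mult_mono)
    show "2 ^ k \<le> real (Suc n)" using n by linarith
  qed (use assms n npos in auto)
  finally show ?thesis by (simp add: power2_eq_square)
qed

text \<open>Up to constants all arguments h / d are at most 1 / P, so the kernel has size O(P) and
  its total variation over the block is O(H P^2 / 2^k), again O(P). The constant 2230 is 6 * 5 + 44
  * 25 * 2.\<close>

lemma folded_block_bound_low:
  assumes "H \<ge> 1" "real H * real P \<le> 2 ^ k"
  shows "block_sum H
     \<le> 200000 * (real K + 2)^2 * 2 ^ k * (sqrt (2 ^ k * real T * real P) * (real P / real w))"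
proof -
  let ?D = "2 ^ k :: real"
  define B1 where "B1 = 44 * (real (5*P))^2 * (2 * real H / ?D^2)"
  have "block_sum H
     \<le> 25 * (real K + 2)^2 * sqrt (?D * real H * real T * (real H * real P + ?D)) * (6 * real (5*P) + ?D * B1)"
  proof (rule folded_block_bound_aux)
    fix h t :: nat assume "t \<in> {1..T}"
    thus "\<bar>folded_kernel w (M t) (real h / 2 ^ k)\<bar> \<le> 6 * real (5 * P)"
      using M w by (intro folded_kernel_bound_low(1)) auto
  next
    fix h t n :: nat assume *: "h \<in> {H..<2*H}" "t \<in> {1..T}" "2 ^ k \<le> n"
    have "\<bar>folded_kernel w (M t) (real h / real (Suc n)) - folded_kernel w (M t) (real h / real n)\<bar>
        \<le> 44 * (real (5*P))^2 * \<bar>real h / real (Suc n) - real h / real n\<bar>"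
      using M[OF *(2)] w by (intro folded_kernel_bound_low(2)) auto
    also have "\<dots> \<le> B1"
      unfolding B1_def using * by (intro mult_left_mono frac_diff_consecutive) auto
    finally show "\<bar>folded_kernel w (M t) (real h / real (Suc n)) - folded_kernel w (M t) (real h / real n)\<bar> \<le> B1" .
  qed (use assms in \<open>auto simp: B1_def\<close>)
  also have "\<dots> \<le> 25 * (real K + 2)^2 * sqrt (?D * real H * real T * (?D + ?D)) * (2230 * real P)"
  proof (intro mult_mono real_sqrt_le_mono add_mono)
    have "?D * B1 = 2200 * (real H * real P / ?D) * real P"
      by (simp add: B1_def power2_eq_square field_simps)
    also have "\<dots> \<le> 2200 * 1 * real P"
      using assms by (intro mult_right_mono mult_left_mono) auto
    finally show "6 * real (5 * P) + ?D * B1 \<le> 2230 * real P" by simp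
  qed (use assms in \<open>auto simp: B1_def\<close>)
  also have "?D * real H * real T * (?D + ?D) = ?D^2 * (2 * (real H * real T))"
    by (simp add: power2_eq_square)
  also have "sqrt \<dots> = ?D * sqrt (2 * (real H * real T))" by (simp add: real_sqrt_mult)
  also have "25 * (real K + 2)^2 * (?D * sqrt (2 * (real H * real T))) * (2230 * real P)
      = 55750 * (real K + 2)^2 * ?D * (real P * sqrt (2 * (real H * real T)))" by simp
  also have "real P * sqrt (2 * (real H * real T)) = sqrt (2 * ((real H * real P) * (real T * real P)))"
    by (simp add: real_sqrt_mult)
  also have "\<dots> \<le> sqrt (2 * (?D * (real T * real P)))"
    using assms by (intro real_sqrt_le_mono mult_left_mono mult_right_mono) auto
  also have "\<dots> = sqrt 2 * sqrt (?D * real T * real P)" by (simp add: real_sqrt_mult)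
  also have "sqrt 2 * sqrt (?D * real T * real P) \<le> 3 / 2 * sqrt (?D * real T * real P)"
    by (intro mult_right_mono real_le_lsqrt) (auto simp: power2_eq_square)
  also have "\<dots> = 3 * (sqrt (?D * real T * real P) * (1 / 2))" by simp
  \<comment> \<open>Since \<open>w\<close> is at most \<open>2 * P\<close>, the factor 1 / 2 is at
    most P / w. This deliberate loss gives low and high blocks the same bound.\<close>
  also have "\<dots> \<le> 3 * (sqrt (?D * real T * real P) * (real P / real w))"
    using w by (intro mult_left_mono) (auto simp: field_simps)
  also have "55750 * (real K + 2)^2 * ?D * (3 * (sqrt (?D * real T * real P) * (real P / real w)))
      = 167250 * ((real K + 2)^2 * ?D * (sqrt (?D * real T * real P) * (real P / real w)))" by simp
  also have "\<dots> \<le> 200000 * ((real K + 2)^2 * ?D * (sqrt (?D * real T * real P) * (real P / real w)))"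
    by (intro mult_right_mono) auto
  finally show ?thesis by (simp add: mult_left_mono)
qed

text \<open>The kernel has size O(4^k / (H^2 w)), and its variation over the block may exceed this
  by a factor H P / 2^k >= 1; both are O(V). The sieve factor grows like H and V decays like 1 / H,
  so the bound does not depend on H.\<close>

lemma folded_block_bound_high:
  assumes "H \<ge> 1" "real H * real P \<ge> 2 ^ k"
  shows "block_sum H
     \<le> 200000 * (real K + 2)^2 * 2 ^ k * (sqrt (2 ^ k * real T * real P) * (real P / real w))"
proof -
  let ?D = "2 ^ k :: real"
  \<comment> \<open>A lower bound for h / n on the whole block, including the last step where
    \<open>Suc n\<close> reaches \<open>2 * 2 ^ k\<close>.\<close>
  define a where "a = real H / (2 * ?D)"
  define V where "V = ?D * real P / (real H * real w)"
  define B0 where "B0 = 2 / (real w * a\<^sup>2)"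
  define B1 where "B1 = 16 / real w * (real (5*P) / a\<^sup>2 + 1 / a ^ 3) * (2 * real H / ?D^2)"
  have a: "a > 0" using assms by (simp add: a_def)
  have a_le: "a \<le> real h / real n" if "H \<le> h" "n \<le> 2 * 2 ^ k" "n > 0" for h n
  proof -
    have "real n \<le> real (2 * 2 ^ k)" using that(2) by (simp only: of_nat_le_iff)
    hence "real n \<le> 2 * 2 ^ k" by simp
    thus ?thesis unfolding a_def using that by (intro frac_le) auto
  qed
  have "block_sum H
     \<le> 25 * (real K + 2)^2 * sqrt (?D * real H * real T * (real H * real P + ?D)) * (B0 + ?D * B1)"
  proof (rule folded_block_bound_aux)
    fix h t :: nat assume *: "h \<in> {H..<2*H}" "t \<in> {1..T}" "h \<le> 2 ^ k"
    have "real h \<le> real (2 ^ k)" using *(3) by (simp only: of_nat_le_iff)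
    hence "real h / 2 ^ k \<le> 1" by simp
    moreover have "a \<le> real h / 2 ^ k" using a_le[of h "2 ^ k"] * by simp
    ultimately show "\<bar>folded_kernel w (M t) (real h / 2 ^ k)\<bar> \<le> B0"
      unfolding B0_def using M[OF *(2)] w a 
      by (intro folded_kernel_bound_high(1)[of w "M t" "5*P" a _ "real h / 2 ^ k"]) auto
  next
    fix h t n :: nat assume *: "h \<in> {H..<2*H}" "t \<in> {1..T}" "2 ^ k \<le> n" "n < 2 * 2 ^ k" "h \<le> n"
    have n0: "n > 0" using *(3) by (intro Nat.gr0I) auto
    have t1: "a \<le> real h / real (Suc n)" "a \<le> real h / real n" using * n0 by (intro a_le; simp)+
    have "\<bar>folded_kernel w (M t) (real h / real (Suc n)) - folded_kernel w (M t) (real h / real n)\<bar>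
        \<le> 16 / real w * (real (5*P) / a\<^sup>2 + 1 / a ^ 3) * \<bar>real h / real (Suc n) - real h / real n\<bar>"
      using M[OF *(2)] w a t1 * n0 by (intro folded_kernel_bound_high(2)) auto
    also have "\<dots> \<le> B1"
      unfolding B1_def using * a by (intro mult_left_mono frac_diff_consecutive mult_nonneg_nonneg add_nonneg_nonneg) auto
    finally show "\<bar>folded_kernel w (M t) (real h / real (Suc n)) - folded_kernel w (M t) (real h / real n)\<bar> \<le> B1" .
  qed (use assms a in \<open>auto simp: B0_def B1_def intro!: mult_nonneg_nonneg add_nonneg_nonneg\<close>)
  also have "\<dots> \<le> 25 * (real K + 2)^2 * sqrt (?D * real H * real T * (real H * real P + real H * real P)) * (904 * V)"
  proof (intro mult_mono real_sqrt_le_mono add_mono)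
    have Hpos: "real H > 0" and wpos: "real w > 0" using assms w by auto
    have q: "?D / real H \<le> real P" using assms Hpos by (simp add: field_simps)
    have "B0 = 8 * (?D / (real H * real w)) * (?D / real H)"
      using Hpos wpos by (simp add: B0_def a_def power2_eq_square field_simps)
    also have "\<dots> \<le> 8 * (?D / (real H * real w)) * real P" by (intro mult_left_mono q) auto
    finally have 1: "B0 \<le> 8 * V" by (simp add: V_def)
    have "?D * B1 = ?D / (real H * real w) * (640 * real P + 256 * (?D / real H))"
      using Hpos wpos by (simp add: B1_def a_def power2_eq_square power3_eq_cube field_simps)
    also have "\<dots> \<le> ?D / (real H * real w) * (640 * real P + 256 * real P)"
      by (intro mult_left_mono add_left_mono q) auto
    also have "\<dots> = 896 * V" by (simp add: V_def)
    finally show "B0 + ?D * B1 \<le> 904 * V" using 1 by simp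
  qed (use assms a in \<open>auto simp: B0_def B1_def intro!: mult_nonneg_nonneg add_nonneg_nonneg\<close>)
  also have "?D * real H * real T * (real H * real P + real H * real P) = (real H)^2 * (2 * (?D * real T * real P))"
    by (simp add: power2_eq_square)
  also have "sqrt \<dots> = real H * (sqrt 2 * sqrt (?D * real T * real P))" by (simp add: real_sqrt_mult)
  also have "25 * (real K + 2)^2 * (real H * (sqrt 2 * sqrt (?D * real T * real P))) * (904 * V)
      = 22600 * (real K + 2)^2 * ?D * (sqrt (?D * real T * real P) * (real P / real w)) * sqrt 2"
    using assms by (simp add: V_def field_simps)
  also have "\<dots> \<le> 22600 * (real K + 2)^2 * ?D * (sqrt (?D * real T * real P) * (real P / real w)) * (3 / 2)"
    by (intro mult_left_mono real_le_lsqrt) (auto simp: power2_eq_square)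
  also have "\<dots> = 33900 * ((real K + 2)^2 * ?D * (sqrt (?D * real T * real P) * (real P / real w)))" by simp
  also have "\<dots> \<le> 200000 * ((real K + 2)^2 * ?D * (sqrt (?D * real T * real P) * (real P / real w)))"
    by (intro mult_right_mono) auto
  finally show ?thesis by simp
qed

text \<open>The division by d in the Fourier expansion removes the factor 2^k of the block bounds,
  and the k + 1 dyadic blocks of frequencies cost one more logarithm.\<close>

lemma smooth_count_block_bound:
  "(\<Sum>(d, \<nu>)\<in>root_pairs k. norm (\<Sum>t=1..T. \<gamma> t * of_real 
       (smooth_error w (M t) (int \<nu> * int (u * t ^ r)) d)))
     \<le> 200000 * (real K + 2) ^ 3 * (sqrt (2 ^ k * real T * real P) * (real P / real w))"
proof -
  let ?C = "\<lambda>d \<nu> i. folded_coeff w M \<gamma> d i * of_real (cos (2 * pi * (real (fst i * (u * snd i ^ r)) * (real \<nu> / real d))))"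
  define R where "R = sqrt (2 ^ k * real T * real P) * (real P / real w)"
  have "norm (\<Sum>t=1..T. \<gamma> t * of_real 
       (smooth_error w (M t) (int \<nu> * int (u * t ^ r)) d))
      \<le> (\<Sum>j\<le>k. norm (\<Sum>i\<in>{2^j..<2*2^j} \<times> {1..T}. ?C d \<nu> i)) / 2 ^ k" if "(d, \<nu>) \<in> root_pairs k" for d \<nu>
  proof -
    have d: "2 ^ k \<le> d" "d < 2 ^ Suc k" using that by (auto simp: root_pairs_def)
    have d0: "d > 0" using d(1) by (intro Nat.gr0I) auto
    have "real (2 ^ k) \<le> real d" using d(1) by (simp only: of_nat_le_iff)
    hence dr: "2 ^ k \<le> real d" by simp
    have inner: "\<gamma> t * of_real (smooth_error w (M t) (int \<nu> * int (u * t ^ r)) d)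
       = (\<Sum>h=1..<2 ^ Suc k. ?C d \<nu> (h, t)) / of_nat d" for t
    proof -
      \<comment> \<open>The range of h is extended to one that is independent of d: coefficients
        vanish for h > d by definition, and for h = d because \<open>folded_kernel\<close> vanishes
        at 1.\<close>
      have "(\<Sum>h=1..<2 ^ Suc k. ?C d \<nu> (h, t)) = (\<Sum>h=1..<d. ?C d \<nu> (h, t))"
      proof (rule sum.mono_neutral_right)
        show "\<forall>h\<in>{1..<2 ^ Suc k} - {1..<d}. ?C d \<nu> (h, t) = 0"
        proof
        fix h assume "h \<in> {1..<2 ^ Suc k} - {1..<d}"
        hence "h \<ge> d" by auto
        thus "?C d \<nu> (h, t) = 0" using d0 by (cases "h = d") (auto simp: folded_coeff_def)
        qed
      qed (use d in auto)
      also have "\<dots> = (\<Sum>h=1..<d. \<gamma> t * of_real (folded_kernel w (M t) (real h / real d) * 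
        cos (2 * pi * (real h * (of_int (int \<nu> * int (u * t ^ r)) / real d)))))"
        by (intro sum.cong refl) (auto simp: folded_coeff_def mult_ac)
      also have "\<dots> = \<gamma> t * of_real (real d * (smooth_error w (M t) (int \<nu> * int (u * t ^ r)) d))"
      proof -
        have "real d * (smooth_error w (M t) (int \<nu> * int (u * t ^ r)) d)
        = (\<Sum>h=1..<d. folded_kernel w (M t) (real h / real d) * 
        cos (2 * pi * (real h * (of_int (int \<nu> * int (u * t ^ r)) / real d))))"
        using d0 w by (subst smooth_count_folded) simp_all
        thus ?thesis by (simp only: of_real_sum sum_distrib_left)
      qed
      finally have *: "(\<Sum>h=1..<2 ^ Suc k. ?C d \<nu> (h, t)) = \<gamma> t * of_real (real d * 
        (smooth_error w (M t) (int \<nu> * int (u * t ^ r)) d))" .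
      show ?thesis unfolding * using d0 by (simp only: of_real_mult) simp
    qed
    have "(\<Sum>t=1..T. \<gamma> t * of_real (smooth_error w (M t) (int \<nu> * int (u * t ^ r)) d))
      = (\<Sum>t=1..T. \<Sum>h=1..<2 ^ Suc k. ?C d \<nu> (h, t)) / of_nat d"
      unfolding inner sum_divide_distrib ..
    also have "(\<Sum>t=1..T. \<Sum>h=1..<2 ^ Suc k. ?C d \<nu> (h, t)) = (\<Sum>h=1..<2 ^ Suc k. \<Sum>t=1..T. ?C d \<nu> (h, t))"
      by (rule sum.swap)
    also have "\<dots> = (\<Sum>j\<le>k. \<Sum>h\<in>{2^j..<2*2^j}. \<Sum>t=1..T. ?C d \<nu> (h, t))"
      by (rule dyadic_cover)
    also have "\<dots> = (\<Sum>j\<le>k. \<Sum>i\<in>{2^j..<2*2^j} \<times> {1..T}. ?C d \<nu> i)"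
      by (simp only: sum.cartesian_product case_prod_unfold prod.collapse)
    finally have eq: "(\<Sum>t=1..T. \<gamma> t * of_real (smooth_error w (M t) (int \<nu> * int (u * t ^ r)) d))
      = (\<Sum>j\<le>k. \<Sum>i\<in>{2^j..<2*2^j} \<times> {1..T}. ?C d \<nu> i) / of_nat d" .
    show ?thesis
      unfolding eq norm_divide norm_of_nat using dr by (intro frac_le norm_sum sum_nonneg) auto
  qed
  hence "(\<Sum>(d, \<nu>)\<in>root_pairs k. norm (\<Sum>t=1..T. \<gamma> t * of_real 
       (smooth_error w (M t) (int \<nu> * int (u * t ^ r)) d)))
     \<le> (\<Sum>(d, \<nu>)\<in>root_pairs k. (\<Sum>j\<le>k. norm (\<Sum>i\<in>{2^j..<2*2^j} \<times> {1..T}. ?C d \<nu> i)) / 2 ^ k)"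
    by (intro sum_mono) auto
  also have "\<dots> = (\<Sum>j\<le>k. \<Sum>(d, \<nu>)\<in>root_pairs k. norm (\<Sum>i\<in>{2^j..<2*2^j} \<times> {1..T}. ?C d \<nu> i)) / 2 ^ k"
    by (simp only: case_prod_unfold sum_divide_distrib) (rule sum.swap)
  also have "\<dots> \<le> (\<Sum>j\<le>k. 200000 * (real K + 2)^2 * 2 ^ k * R) / 2 ^ k"
  proof (intro divide_right_mono sum_mono)
    fix j
    show "block_sum (2^j) \<le> 200000 * (real K + 2)^2 * 2 ^ k * R"
      using folded_block_bound_low[of "2^j"] folded_block_bound_high[of "2^j"]
      unfolding R_def by (cases "real (2^j) * real P \<le> 2 ^ k") auto
  qed auto
  also have "\<dots> = 200000 * (real K + 2)^2 * R * (real k + 1)" by (simp add: field_simps)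
  also have "\<dots> \<le> 200000 * (real K + 2)^2 * R * (real K + 2)"
    using kK by (intro mult_left_mono) (auto simp: R_def)
  also have "\<dots> = 200000 * (real K + 2) ^ 3 * R" by (simp add: power2_eq_square power3_eq_cube)
  finally show ?thesis by (simp only: R_def)
qed

end

section \<open>Sharp counts on average over the moduli\<close>

lemma sum_root_pairs_le:
  fixes f :: "nat \<Rightarrow> nat \<Rightarrow> real"
  assumes "D < 2 ^ K" "\<And>d \<nu>. f d \<nu> \<ge> 0"
  shows "(\<Sum>d\<in>moduli D. \<Sum>\<nu>\<in>sqrt_roots d. f d \<nu>)
        \<le> (\<Sum>k\<in>{k. k < K \<and> 2 ^ k \<le> D}. \<Sum>(d, \<nu>)\<in>root_pairs k. f d \<nu>)"
proof -
  have "(\<Sum>d\<in>moduli D. \<Sum>\<nu>\<in>sqrt_roots d. f d \<nu>)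
      = (\<Sum>(d, \<nu>)\<in>(SIGMA d:moduli D. sqrt_roots d). f d \<nu>)"
    by (intro sum.Sigma finite_modulus_index) auto
  also have "\<dots> \<le> (\<Sum>(k, d, \<nu>)\<in>(SIGMA k:{k. k < K \<and> 2 ^ k \<le> D}. root_pairs k). f d \<nu>)"
  proof (rule sum_le_included[where i = snd])
    show "\<forall>p\<in>(SIGMA d:moduli D. sqrt_roots d).
        \<exists>q\<in>(SIGMA k:{k. k < K \<and> 2 ^ k \<le> D}. root_pairs k). snd q = p \<and> (case p of (d, \<nu>) \<Rightarrow> f d \<nu>) \<le> (case q of (k, d, \<nu>) \<Rightarrow> f d \<nu>)"
    proof safe
      fix d \<nu> assume d: "d > 0" "real d \<le> D" "\<nu> \<in> sqrt_roots d"
      obtain k where k: "2 ^ k \<le> d" "d < 2 ^ (k + 1)" using ex_power_ivl1[of 2 d] d(1) by auto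
      have "real (2 ^ k) \<le> real d" using k(1) by (simp only: of_nat_le_iff)
      hence "2 ^ k \<le> D" using d(2) by (simp only: of_nat_power of_nat_numeral)
      hence "(2::real) ^ k < 2 ^ K" using assms(1) by linarith
      hence "k < K" by simp
      hence "(k, d, \<nu>) \<in> (SIGMA k:{k. k < K \<and> 2 ^ k \<le> D}. root_pairs k)"
        using k d \<open>2 ^ k \<le> D\<close> by (auto simp: root_pairs_def)
      thus "\<exists>q\<in>(SIGMA k:{k. k < K \<and> 2 ^ k \<le> D}. root_pairs k). snd q = (d, \<nu>) \<and> f d \<nu> \<le> (case q of (k, d, \<nu>) \<Rightarrow> f d \<nu>)"
        by force
    qed
  qed (use assms(2) in \<open>auto intro!: finite_modulus_index\<close>)
  also have "\<dots> = (\<Sum>k\<in>{k. k < K \<and> 2 ^ k \<le> D}. \<Sum>(d, \<nu>)\<in>root_pairs k. f d \<nu>)"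
    by (subst sum.Sigma) auto
  finally show ?thesis .
qed

text \<open>Used to sum main-term discrepancies of size O(w / d). A block contributes the number of
  its roots divided by 2^k, which is O(K), and there are at most K blocks.\<close>

lemma sum_sqrt_roots_inverse:
  assumes "D < 2 ^ K"
  shows "(\<Sum>d\<in>moduli D. \<Sum>\<nu>\<in>sqrt_roots d. 1 / real d) \<le> 13 * (real K + 2)^2"
proof -
  have "(\<Sum>d\<in>moduli D. \<Sum>\<nu>\<in>sqrt_roots d. 1 / real d)
     \<le> (\<Sum>k\<in>{k. k < K \<and> 2 ^ k \<le> D}. \<Sum>(d, \<nu>)\<in>root_pairs k. 1 / real d)"
    by (intro sum_root_pairs_le assms) auto
  also have "\<dots> \<le> (\<Sum>k\<in>{k. k < K \<and> 2 ^ k \<le> D}. 13 * (real K + 2))"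
  proof (intro sum_mono)
    fix k assume k: "k \<in> {k. k < K \<and> 2 ^ k \<le> D}"
    have "(\<Sum>(d, \<nu>)\<in>root_pairs k. 1 / real d) \<le> (\<Sum>p\<in>root_pairs k. 1 / 2 ^ k)"
      unfolding case_prod_unfold
    proof (intro sum_mono divide_left_mono)
      fix p assume "p \<in> root_pairs k"
      hence "2 ^ k \<le> fst p" by (auto simp: root_pairs_def)
      moreover have "(0::nat) < 2 ^ k" by simp
      ultimately have "real (2 ^ k) \<le> real (fst p)" "fst p > 0" by (simp_all only: of_nat_le_iff less_le_trans)
      thus "2 ^ k \<le> real (fst p)" "0 < real (fst p) * 2 ^ k" by simp_all
    qed auto
    also have "\<dots> = real (card (root_pairs k)) / 2 ^ k" by simp
    also have "\<dots> \<le> (13 * real (k + 2) * 2 ^ k) / 2 ^ k" by (intro divide_right_mono card_root_pairs) auto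
    also have "\<dots> = 13 * real (k + 2)" by simp
    also have "\<dots> \<le> 13 * (real K + 2)" using k by simp
    finally show "(\<Sum>(d, \<nu>)\<in>root_pairs k. 1 / real d) \<le> 13 * (real K + 2)" .
  qed
  also have "\<dots> = real (card {k. k < K \<and> 2 ^ k \<le> D}) * (13 * (real K + 2))" by simp
  also have "\<dots> \<le> (real K + 2) * (13 * (real K + 2))"
  proof (intro mult_right_mono)
    have "card {k. k < K \<and> 2 ^ k \<le> D} \<le> card {..<K}" by (intro card_mono) auto
    thus "real (card {k. k < K \<and> 2 ^ k \<le> D}) \<le> real K + 2" by simp
  qed auto
  also have "\<dots> = 13 * (real K + 2)^2" by (simp add: power2_eq_square)
  finally show ?thesis .
qed

lemma smooth_count_sum_bound:
  fixes M :: "nat \<Rightarrow> nat" and \<gamma> :: "nat \<Rightarrow> complex"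
  assumes "T < 2 ^ K" "D < 2 ^ K" "D \<ge> 0" "u \<ge> 1" "r \<ge> 1" "P \<ge> 1"
    and l: "\<And>t. t \<in> {1..T} \<Longrightarrow> u * t ^ r \<le> P"
    and M: "\<And>t. t \<in> {1..T} \<Longrightarrow> M t + w \<le> 5 * P"
    and w: "w \<ge> 1" "w \<le> 2 * P"
    and \<gamma>: "\<And>t. t \<in> {1..T} \<Longrightarrow> norm (\<gamma> t) \<le> 1"
  shows "(\<Sum>d\<in>moduli D. \<Sum>\<nu>\<in>sqrt_roots d. norm (\<Sum>t=1..T. \<gamma> t * of_real 
       (smooth_error w (M t) (int \<nu> * int (u * t ^ r)) d)))
     \<le> 200000 * (real K + 2) ^ 4 * (sqrt (D * real T * real P) * (real P / real w))"
    (is "(\<Sum>d\<in>_. \<Sum>\<nu>\<in>_. ?f d \<nu>) \<le> _")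
proof -
  define R where "R = sqrt (D * real T * real P) * (real P / real w)"
  have "(\<Sum>d\<in>moduli D. \<Sum>\<nu>\<in>sqrt_roots d. ?f d \<nu>)
     \<le> (\<Sum>k\<in>{k. k < K \<and> 2 ^ k \<le> D}. \<Sum>(d, \<nu>)\<in>root_pairs k. ?f d \<nu>)"
    by (intro sum_root_pairs_le assms(2)) auto
  also have "\<dots> \<le> (\<Sum>k\<in>{k. k < K \<and> 2 ^ k \<le> D}. 200000 * (real K + 2) ^ 3 * R)"
  proof (intro sum_mono)
    fix k assume k: "k \<in> {k. k < K \<and> 2 ^ k \<le> D}"
    have "(\<Sum>(d, \<nu>)\<in>root_pairs k. ?f d \<nu>) \<le> 200000 * (real K + 2) ^ 3 * (sqrt (2 ^ k * real T * real P) * (real P / real w))"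
      by (intro smooth_count_block_bound assms) (use k in auto)
    also have "\<dots> \<le> 200000 * (real K + 2) ^ 3 * R"
      unfolding R_def using k by (intro mult_left_mono mult_right_mono real_sqrt_le_mono) auto
    finally show "(\<Sum>(d, \<nu>)\<in>root_pairs k. ?f d \<nu>) \<le> 200000 * (real K + 2) ^ 3 * R" .
  qed
  also have "\<dots> = real (card {k. k < K \<and> 2 ^ k \<le> D}) * (200000 * (real K + 2) ^ 3 * R)" by simp
  also have "\<dots> \<le> (real K + 2) * (200000 * (real K + 2) ^ 3 * R)"
  proof (intro mult_right_mono)
    have "card {k. k < K \<and> 2 ^ k \<le> D} \<le> card {..<K}" by (intro card_mono) auto
    thus "real (card {k. k < K \<and> 2 ^ k \<le> D}) \<le> real K + 2" by simp
    show "0 \<le> 200000 * (real K + 2) ^ 3 * R" using assms(3) by (simp add: R_def)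
  qed
  also have "\<dots> = 200000 * (real K + 2) ^ 4 * R" by (simp add: eval_nat_numeral)
  finally show ?thesis by (simp only: R_def)
qed

lemma ap_count_mono: "M \<le> M' \<Longrightarrow> ap_count M a d \<le> ap_count M' a d"
proof -
  assume "M \<le> M'"
  moreover have "finite {m::int. \<bar>m\<bar> \<le> int M' \<and> int d dvd m - a}"
    by (rule finite_subset[of _ "{- int M'..int M'}"]) auto
  ultimately show ?thesis unfolding ap_count_def of_nat_le_iff by (intro card_mono) auto
qed

lemma ap_count_le_smooth_count: "w > 0 \<Longrightarrow> ap_count M a d \<le> smooth_count w M a d"
proof -
  assume "w > 0"
  have "(\<Sum>j<w. ap_count M a d) \<le> (\<Sum>j<w. ap_count (M + j) a d)"
    by (intro sum_mono ap_count_mono) auto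
  thus ?thesis using \<open>w > 0\<close> by (simp add: smooth_count_def field_simps)
qed

lemma smooth_count_le_ap_count: "w > 0 \<Longrightarrow> smooth_count w M a d \<le> ap_count (M + w) a d"
proof -
  assume "w > 0"
  have "(\<Sum>j<w. ap_count (M + j) a d) \<le> (\<Sum>j<w. ap_count (M + w) a d)"
    by (intro sum_mono ap_count_mono) auto
  thus ?thesis using \<open>w > 0\<close> by (simp add: smooth_count_def field_simps)
qed

text \<open>By monotonicity the smooth count at \<open>M - w\<close> lies below the sharp count at
  \<open>M\<close>, and the smooth count at \<open>M\<close> below the one at \<open>M + w\<close>.
  The majorant is linear in smooth counts, so it can be summed over t and estimated by the same
  Fourier bound. For \<open>M < w\<close> the lower count is replaced by 0.\<close>

lemma abs_ap_count_minus_smooth_count_le: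
  assumes "w > 0"
  shows "\<bar>ap_count M a d - smooth_count w M a d\<bar> \<le>
     smooth_count w (M + w) a d - (if M \<ge> w then smooth_count w (M - w) a d else 0)"
proof -
  have "ap_count M a d \<ge> (if M \<ge> w then smooth_count w (M - w) a d else 0)"
    using smooth_count_le_ap_count[OF assms, of "M - w" a d] by (auto simp: ap_count_def)
  moreover have "smooth_count w M a d \<le> smooth_count w (M + w) a d"
    using smooth_count_le_ap_count[OF assms, of M a d] ap_count_le_smooth_count[OF assms, of "M + w" a d] by linarith
  ultimately show ?thesis using ap_count_le_smooth_count[OF assms, of M a d] by linarith
qed

text \<open>The smooth bound is used three times: for the given coefficients at \<open>M\<close>,
  and for the two halves of the majorant, with coefficients 1 at \<open>M + w\<close> and the
  indicator \<open>I\<close> at \<open>M - w\<close>. What remains are differences of main terms, at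
  most 8 w / d for each t, and 104 = 8 * 13.\<close>

lemma ap_count_sum_bound:
  fixes y :: "nat \<Rightarrow> real" and \<gamma> :: "nat \<Rightarrow> complex"
  assumes "T < 2 ^ K" "D < 2 ^ K" "D \<ge> 0" "u \<ge> 1" "r \<ge> 1" "P \<ge> 1"
    and l: "\<And>t. t \<in> {1..T} \<Longrightarrow> u * t ^ r \<le> P"
    and y: "\<And>t. t \<in> {1..T} \<Longrightarrow> y t \<ge> 0" "\<And>t. t \<in> {1..T} \<Longrightarrow> nat \<lfloor>y t\<rfloor> \<le> P"
    and w: "w \<ge> 1" "w \<le> 2 * P"
    and \<gamma>: "\<And>t. t \<in> {1..T} \<Longrightarrow> norm (\<gamma> t) \<le> 1"
  shows "(\<Sum>d\<in>moduli D. \<Sum>\<nu>\<in>sqrt_roots d. norm (\<Sum>t=1..T. \<gamma> t * of_real 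
       (ap_count (nat \<lfloor>y t\<rfloor>) (int \<nu> * int (u * t ^ r)) d - 2 * y t / real d)))
     \<le> 600000 * (real K + 2) ^ 4 * (sqrt (D * real T * real P) * (real P / real w)) + 104 * (real K + 2)^2 * real T * real w"
proof -
  define M where "M t = nat \<lfloor>y t\<rfloor>" for t
  define \<epsilon> where "\<epsilon> M d \<nu> t = smooth_error w M (int \<nu> * int (u * t ^ r)) d" for M d \<nu> t
  define I where "I t = (if M t \<ge> w then 1 else 0 :: real)" for t
  define E where "E \<gamma> M d \<nu> = norm (\<Sum>t=1..T. \<gamma> t * complex_of_real (\<epsilon> (M t) d \<nu> t))" for \<gamma> M d \<nu>
  define B where "B = 200000 * (real K + 2) ^ 4 * (sqrt (D * real T * real P) * (real P / real w))"
  have EB: "(\<Sum>d\<in>moduli D. \<Sum>\<nu>\<in>sqrt_roots d. E \<gamma>' M' d \<nu>) \<le> B"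
    if "\<And>t. t \<in> {1..T} \<Longrightarrow> norm (\<gamma>' t) \<le> 1" "\<And>t. t \<in> {1..T} \<Longrightarrow> M' t + w \<le> 5 * P" for \<gamma>' M'
    unfolding E_def B_def \<epsilon>_def by (intro smooth_count_sum_bound assms that) auto
  have Mle: "M t \<le> P" if "t \<in> {1..T}" for t using y that by (simp add: M_def)
  have pw: "norm (\<Sum>t=1..T. \<gamma> t * of_real (ap_count (M t) (int \<nu> * int (u * t ^ r)) d - 2 * y t / real d))
    \<le> E \<gamma> M d \<nu> + E (\<lambda>_. 1) (\<lambda>t. M t + w) d \<nu> + E (\<lambda>t. of_real (I t)) (\<lambda>t. M t - w) d \<nu> + 8 * real T * real w * (1 / real d)"
    if "d > 0" for d \<nu>
  proof -
    define q where "q t = ap_count (M t) (int \<nu> * int (u * t ^ r)) d - 2 * y t / real d - \<epsilon> (M t) d \<nu> t" for t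
    have q: "\<bar>q t\<bar> \<le> \<epsilon> (M t + w) d \<nu> t - I t * \<epsilon> (M t - w) d \<nu> t + 8 * real w * (1 / real d)" if t: "t \<in> {1..T}" for t
    proof -
      let ?a = "int \<nu> * int (u * t ^ r)"
      have yM: "real (M t) \<le> y t" "y t < real (M t) + 1" using y(1)[OF t] unfolding M_def by (auto intro: of_nat_floor)
      have w1: "real w \<ge> 1" using w by simp
      have "q t = (ap_count (M t) ?a d - smooth_count w (M t) ?a d) + (2 * real (M t) + real w - 2 * y t) / real d"
        by (simp add: q_def \<epsilon>_def diff_divide_distrib add_divide_distrib)
      also have "\<bar>\<dots>\<bar> \<le> \<bar>ap_count (M t) ?a d - smooth_count w (M t) ?a d\<bar> + \<bar>2 * real (M t) + real w - 2 * y t\<bar> / real d"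
        by (rule order.trans[OF abs_triangle_ineq]) simp
      \<comment> \<open>Rounding \<open>y t\<close> down changes 2 y by less than 2, and the ramps
        add w; both fit into 3 w because w >= 1.\<close>
      also have "\<dots> \<le> (smooth_count w (M t + w) ?a d - (if M t \<ge> w then smooth_count w (M t - w) ?a d else 0)) + 3 * real w / real d"
        using yM w1 w by (intro add_mono divide_right_mono abs_ap_count_minus_smooth_count_le) auto
      also have "(smooth_count w (M t + w) ?a d - (if M t \<ge> w then smooth_count w (M t - w) ?a d else 0))
        = \<epsilon> (M t + w) d \<nu> t - I t * \<epsilon> (M t - w) d \<nu> t + ((2 * real (M t + w) + real w) - I t * (2 * real (M t - w) + real w)) / real d"
        by (simp add: \<epsilon>_def I_def diff_divide_distrib add_divide_distrib)
      \<comment> \<open>The difference is 4 w if \<open>w \<le> M t\<close>. Otherwise only 2 M + 3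
        w remains, which is below 5 w.\<close>
      also have "((2 * real (M t + w) + real w) - I t * (2 * real (M t - w) + real w)) / real d \<le> 5 * real w / real d"
        by (intro divide_right_mono) (auto simp: I_def of_nat_diff)
      finally show ?thesis by simp
    qed
    have "(\<Sum>t=1..T. \<gamma> t * of_real (ap_count (M t) (int \<nu> * int (u * t ^ r)) d - 2 * y t / real d))
      = (\<Sum>t=1..T. \<gamma> t * complex_of_real (\<epsilon> (M t) d \<nu> t)) + (\<Sum>t=1..T. \<gamma> t * of_real (q t))"
      by (simp add: q_def algebra_simps flip: sum.distrib)
    also have "norm \<dots> \<le> E \<gamma> M d \<nu> + (\<Sum>t=1..T. norm (\<gamma> t * of_real (q t)))"
      unfolding E_def by (intro norm_triangle_le add_left_mono norm_sum)
    finally have h0: "norm (\<Sum>t=1..T. \<gamma> t * of_real (ap_count (M t) (int \<nu> * int (u * t ^ r)) d - 2 * y t / real d)) \<le>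
        E \<gamma> M d \<nu> + (\<Sum>t=1..T. norm (\<gamma> t * of_real (q t)))" .
    have "(\<Sum>t=1..T. norm (\<gamma> t * of_real (q t))) \<le> (\<Sum>t=1..T. 1 * \<bar>q t\<bar>)"
      unfolding norm_mult norm_of_real by (intro sum_mono mult_right_mono \<gamma>) auto
    also have "\<dots> \<le> (\<Sum>t=1..T. \<epsilon> (M t + w) d \<nu> t - I t * \<epsilon> (M t - w) d \<nu> t + 8 * real w * (1 / real d))"
      using q by (intro sum_mono) simp
    also have "\<dots> = (\<Sum>t=1..T. \<epsilon> (M t + w) d \<nu> t) - (\<Sum>t=1..T. I t * \<epsilon> (M t - w) d \<nu> t) + 8 * real T * real w * (1 / real d)"
      by (simp add: sum.distrib sum_subtractf)
    finally have h1: "(\<Sum>t=1..T. norm (\<gamma> t * of_real (q t))) \<le> (\<Sum>t=1..T. \<epsilon> (M t + w) d \<nu> t) - (\<Sum>t=1..T. I t * \<epsilon> (M t - w) d \<nu> t) + 8 * real T * real w * (1 / real d)" .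
    have h2: "(\<Sum>t=1..T. \<epsilon> (M t + w) d \<nu> t) \<le> E (\<lambda>_. 1) (\<lambda>t. M t + w) d \<nu>"
    proof -
      have "E (\<lambda>_. 1) (\<lambda>t. M t + w) d \<nu> = norm (complex_of_real (\<Sum>t=1..T. \<epsilon> (M t + w) d \<nu> t))"
        by (simp add: E_def)
      thus ?thesis by (simp only: norm_of_real abs_ge_self)
    qed
    have h3: "- (\<Sum>t=1..T. I t * \<epsilon> (M t - w) d \<nu> t) \<le> E (\<lambda>t. of_real (I t)) (\<lambda>t. M t - w) d \<nu>"
    proof -
      have "E (\<lambda>t. of_real (I t)) (\<lambda>t. M t - w) d \<nu> = norm (complex_of_real (\<Sum>t=1..T. I t * \<epsilon> (M t - w) d \<nu> t))"
        by (simp add: E_def)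
      thus ?thesis by (simp only: norm_of_real abs_ge_minus_self)
    qed
    show ?thesis using h0 h1 h2 h3 by linarith
  qed
  have "(\<Sum>d\<in>moduli D. \<Sum>\<nu>\<in>sqrt_roots d. norm (\<Sum>t=1..T. \<gamma> t * of_real 
       (ap_count (M t) (int \<nu> * int (u * t ^ r)) d - 2 * y t / real d)))
    \<le> (\<Sum>d\<in>moduli D. \<Sum>\<nu>\<in>sqrt_roots d. E \<gamma> M d \<nu> + E (\<lambda>_. 1) (\<lambda>t. M t + w) d \<nu> + 
        E (\<lambda>t. of_real (I t)) (\<lambda>t. M t - w) d \<nu> + 8 * real T * real w * (1 / real d))"
    by (intro sum_mono pw) auto
  also have "\<dots> = (\<Sum>d\<in>moduli D. \<Sum>\<nu>\<in>sqrt_roots d. E \<gamma> M d \<nu>) + 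
      (\<Sum>d\<in>moduli D. \<Sum>\<nu>\<in>sqrt_roots d. E (\<lambda>_. 1) (\<lambda>t. M t + w) d \<nu>) + 
      (\<Sum>d\<in>moduli D. \<Sum>\<nu>\<in>sqrt_roots d. E (\<lambda>t. of_real (I t)) (\<lambda>t. M t - w) d \<nu>) +
      8 * real T * real w * (\<Sum>d\<in>moduli D. \<Sum>\<nu>\<in>sqrt_roots d. 1 / real d)"
    by (simp only: sum.distrib sum_distrib_left)
  also have "\<dots> \<le> B + B + B + 8 * real T * real w * (13 * (real K + 2)^2)"
  proof (intro add_mono EB mult_left_mono sum_sqrt_roots_inverse assms)
    fix t assume t: "t \<in> {1..T}"
    show "M t + w \<le> 5 * P" "M t + w + w \<le> 5 * P" "M t - w + w \<le> 5 * P" using Mle[OF t] w by auto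
  qed (auto simp: \<gamma> I_def)
  finally show ?thesis by (simp add: B_def M_def mult_ac)
qed

section \<open>Removing the coprimality conditions\<close>

lemma squarefree_dvdI:
  fixes g n :: nat
  assumes "squarefree g" "\<And>p. prime p \<Longrightarrow> p dvd g \<Longrightarrow> p dvd n"
  shows "g dvd n"
proof -
  define h where "h = gcd g n"
  obtain q where q: "g = h * q" unfolding h_def by (metis dvd_def gcd_dvd1)
  have "q = 1"
  proof (rule ccontr)
    assume "q \<noteq> 1"
    then obtain p where p: "prime p" "p dvd q" by (metis prime_factor_nat)
    have "p dvd h" unfolding h_def using p q assms(2)[of p] by (simp add: dvd_mult)
    hence "p ^ 2 dvd g" using p q by (simp add: power2_eq_square mult_dvd_mono)
    hence "p dvd 1" using assms(1) squarefreeD by blast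
    thus False using p by simp
  qed
  thus ?thesis using q by (metis gcd_dvd2 h_def mult.right_neutral)
qed

lemma not_4_dvd_square_plus_1: "\<not> 4 dvd (a :: int)^2 + 1"
proof (cases "even a")
  case True
  then obtain c where "a = 2 * c" by blast
  hence "a^2 + 1 = 4 * c^2 + 1" by (simp add: power2_eq_square)
  moreover have "\<not> 4 dvd 4 * y + (1::int)" for y by presburger
  ultimately show ?thesis by simp
next
  case False
  then obtain c where "a = 2 * c + 1" by (elim oddE)
  hence eq: "a^2 + 1 = 4 * (c^2 + c) + 2" by (simp add: power2_eq_square algebra_simps)
  have "\<not> 4 dvd 4 * y + (2::int)" for y by presburger
  thus ?thesis unfolding eq .
qed

text \<open>Given one lift \<open>x0\<close>, a lift \<open>x\<close> is determined by the set of primes dividing \<open>g\<close> at which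
  \<open>(x - x0) / e\<close> vanishes: at each other prime \<open>x\<close> is congruent to \<open>- x0\<close>.\<close>
lemma card_root_lifts:
  assumes "squarefree g" "e > 0"
  shows "card {\<nu> \<in> sqrt_roots (g * e). \<nu> mod e = \<nu>'} \<le> card {k. k dvd g}"
proof (cases "{\<nu> \<in> sqrt_roots (g * e). \<nu> mod e = \<nu>'} = {}")
  case False
  define S where "S = {\<nu> \<in> sqrt_roots (g * e). \<nu> mod e = \<nu>'}"
  obtain x0 where x0: "x0 \<in> S" using False by (auto simp: S_def)
  have g0: "g > 0" using assms(1) by (cases "g = 0") auto
  define t where "t x = (int x - int x0) div int e" for x
  have t: "int x - int x0 = int e * t x" if "x \<in> S" for x
  proof -
    have "x mod e = x0 mod e" using that x0 by (simp add: S_def)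
    hence "int x mod int e = int x0 mod int e" by (simp only: flip: zmod_int)
    hence "int e dvd int x - int x0" by (simp add: mod_eq_dvd_iff)
    thus ?thesis by (simp add: t_def)
  qed
  have sq: "int g * int e dvd (int x)^2 + 1" if "x \<in> S" for x
  proof -
    have "int (g * e) dvd int (x^2 + 1)" using that by (simp only: of_nat_dvd_iff) (auto simp: S_def sqrt_roots_def)
    thus ?thesis by (simp add: add.commute)
  qed
  have neg: "int p dvd int x + int x0" if "x \<in> S" "prime p" "p dvd g" "\<not> int p dvd t x" for x p
  proof -
    have "int g * int e dvd ((int x)^2 + 1) - ((int x0)^2 + 1)" by (intro dvd_diff sq that x0)
    also have "((int x)^2 + 1) - ((int x0)^2 + 1) = (int x - int x0) * (int x + int x0)"
      by (simp add: power2_eq_square algebra_simps)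
    also have "\<dots> = (t x * (int x + int x0)) * int e" by (simp add: t[OF that(1)])
    finally have "int g dvd t x * (int x + int x0)" using assms(2) by simp
    hence "int p dvd t x * (int x + int x0)" using that(3) by (meson dvd_trans of_nat_dvd_iff)
    thus ?thesis using that by (simp add: prime_dvd_mult_iff)
  qed
  have "inj_on (\<lambda>x. nat (gcd (t x) (int g))) S"
  proof (rule inj_onI)
    fix x y assume xy: "x \<in> S" "y \<in> S" "nat (gcd (t x) (int g)) = nat (gcd (t y) (int g))"
    have geq: "gcd (t x) (int g) = gcd (t y) (int g)" using xy(3) by (simp add: nat_eq_iff)
    have "g dvd nat \<bar>t x - t y\<bar>"
    proof (rule squarefree_dvdI[OF assms(1)])
      fix p assume p: "prime p" "p dvd g"
      have eqv: "int p dvd t x \<longleftrightarrow> int p dvd t y"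
        using geq p(2) by (metis gcd_greatest_iff of_nat_dvd_iff)
      have "int p dvd t x - t y"
      proof (cases "int p dvd t x")
        case True
        thus ?thesis using eqv by (simp add: dvd_diff)
      next
        case False
        have "int p dvd (int x + int x0) - (int y + int x0)"
        using False eqv xy p by (intro dvd_diff neg) auto
        also have "(int x + int x0) - (int y + int x0) = (int x - int x0) - (int y - int x0)" by simp
        also have "\<dots> = int e * (t x - t y)" by (simp only: t[OF xy(1)] t[OF xy(2)] right_diff_distrib)
        finally have "int p dvd int e \<or> int p dvd t x - t y" using p by (simp add: prime_dvd_mult_iff)
        \<comment> \<open>If p divided e, then x would be congruent to both x0 and - x0, so p would
          divide 2 x0. It cannot divide x0, because p divides x0^2 + 1; and p = 2 would make 4
          divide x0^2 + 1.\<close>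
        moreover have "\<not> int p dvd int e"
        proof
        assume pe: "int p dvd int e"
        have "int p dvd int x - int x0" using pe by (simp add: t[OF xy(1)])
        from dvd_diff[OF neg[OF xy(1) p False] this] have "int p dvd 2 * int x0" by simp
        moreover have px0: "int p dvd (int x0)^2 + 1"
        using sq[OF x0] pe by (meson dvd_mult_right dvd_trans)
        have "\<not> int p dvd int x0"
        proof
        assume "int p dvd int x0"
        hence "int p dvd ((int x0)^2 + 1) - (int x0)^2" by (intro dvd_diff px0) (simp add: power2_eq_square)
        thus False using p by simp
        qed
        ultimately have "int p dvd 2" using p by (simp add: prime_dvd_mult_iff)
        hence "p = 2" using p by (metis of_nat_dvd_iff of_nat_numeral primes_dvd_imp_eq two_is_prime_nat)
        hence "2 * 2 dvd (int x0)^2 + 1"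
        using p(2) pe sq[OF x0] mult_dvd_mono[of 2 "int g" 2 "int e"] by (simp add: dvd_trans)
        thus False using not_4_dvd_square_plus_1 by simp
        qed
        ultimately show ?thesis by blast
      qed
      thus "p dvd nat \<bar>t x - t y\<bar>" by (simp add: dvd_nat_abs_iff)
    qed
    hence "int g dvd t x - t y" by (simp add: dvd_nat_abs_iff)
    hence "int g * int e dvd (t x - t y) * int e" by (intro mult_dvd_mono) auto
    also have "(t x - t y) * int e = (int x - int x0) - (int y - int x0)"
      by (simp add: t[OF xy(1)] t[OF xy(2)] algebra_simps)
    finally have "int (g * e) dvd int x - int y" by simp
    hence "int x mod int (g * e) = int y mod int (g * e)" by (simp add: mod_eq_dvd_iff)
    hence "x mod (g * e) = y mod (g * e)" by (metis of_nat_eq_iff zmod_int)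
    thus "x = y" using xy by (simp add: S_def sqrt_roots_def)
  qed
  moreover have "(\<lambda>x. nat (gcd (t x) (int g))) ` S \<subseteq> {k. k dvd g}"
  proof safe
    fix x
    have "int (nat (gcd (t x) (int g))) dvd int g" by simp
    thus "nat (gcd (t x) (int g)) dvd g" by (simp only: of_nat_dvd_iff)
  qed
  moreover have "finite {k. k dvd g}" using g0 by simp
  ultimately show ?thesis unfolding S_def[symmetric] by (meson card_inj_on_le)
qed (simp only: card.empty le0)

section \<open>Divisor sums and the passage to reduced moduli\<close>

definition num_divs :: "nat \<Rightarrow> nat" where
  "num_divs n = card {k. k dvd n}"

lemma num_divs_mult_le: "a > 0 \<Longrightarrow> b > 0 \<Longrightarrow> num_divs (a * b) \<le> num_divs a * num_divs b"
proof -
  assume "a > 0" "b > 0"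
  have "{k. k dvd a * b} \<subseteq> (\<lambda>(i, j). i * j) ` ({k. k dvd a} \<times> {k. k dvd b})"
    by (auto dest!: division_decomp)
  hence "card {k. k dvd a * b} \<le> card ((\<lambda>(i, j). i * j) ` ({k. k dvd a} \<times> {k. k dvd b}))"
    using \<open>a > 0\<close> \<open>b > 0\<close> by (intro card_mono) auto
  also have "\<dots> \<le> card ({k. k dvd a} \<times> {k. k dvd b})" using \<open>a > 0\<close> \<open>b > 0\<close> by (intro card_image_le) auto
  finally show ?thesis by (simp add: num_divs_def card_cartesian_product)
qed

lemma sum_divisors_le:
  fixes F :: "nat \<Rightarrow> nat \<Rightarrow> real"
  assumes "\<And>a c. F a c \<ge> 0"
  shows "(\<Sum>b=1..T. \<Sum>a\<in>{a. a dvd b}. F a (b div a)) \<le> (\<Sum>a=1..T. \<Sum>c=1..T. F a c)"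
proof -
  have "(\<Sum>b=1..T. \<Sum>a\<in>{a. a dvd b}. F a (b div a)) = (\<Sum>(b, a)\<in>(SIGMA b:{1..T}. {a. a dvd b}). F a (b div a))"
    by (subst sum.Sigma) auto
  also have "\<dots> \<le> (\<Sum>(a, c)\<in>{1..T} \<times> {1..T}. F a c)"
  proof (rule sum_le_included[where i = "\<lambda>(a, c). (a * c, a)"])
    show "\<forall>p\<in>(SIGMA b:{1..T}. {a. a dvd b}). \<exists>q\<in>{1..T} \<times> {1..T}. (case q of (a, c) \<Rightarrow> (a * c, a)) = p \<and>
        (case p of (b, a) \<Rightarrow> F a (b div a)) \<le> (case q of (a, c) \<Rightarrow> F a c)"
    proof safe
      fix b a assume b: "b \<in> {1..T}" "a dvd b"
      then obtain c where c: "b = a * c" by blast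
      have "a \<ge> 1" "c \<ge> 1" using b c by (auto intro: Suc_leI Nat.gr0I)
      have "a \<le> a * c" "c \<le> a * c" using \<open>a \<ge> 1\<close> \<open>c \<ge> 1\<close> by auto
      moreover have "a * c \<le> T" using b c by simp
      ultimately have "a \<le> T" "c \<le> T" by linarith+
      thus "\<exists>q\<in>{1..T} \<times> {1..T}. (case q of (a, c) \<Rightarrow> (a * c, a)) = (b, a) \<and> F a (b div a) \<le> (case q of (a, c) \<Rightarrow> F a c)"
        using \<open>a \<ge> 1\<close> \<open>c \<ge> 1\<close> by (intro bexI[of _ "(a, c)"]) (auto simp: c)
    qed
  qed (use assms in \<open>auto intro!: finite_SigmaI\<close>)
  also have "\<dots> = (\<Sum>a=1..T. \<Sum>c=1..T. F a c)" by (simp add: sum.cartesian_product)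
  finally show ?thesis .
qed

text \<open>The first bound opens the divisor function as a double harmonic sum. The second opens
  one of the two factors in the same way and uses submultiplicativity on the other, which reduces it
  to the square of the first.\<close>

lemma sum_num_divs_le:
  assumes "T < 2 ^ K"
  shows "(\<Sum>b=1..T. real (num_divs b) / real b) \<le> (real K)^2"
    and "(\<Sum>b=1..T. (real (num_divs b))^2 / real b) \<le> (real K) ^ 4"
proof -
  have h: "(\<Sum>a=1..T. 1 / real a) \<le> real K"
  proof -
    have "(\<Sum>a=1..T. 1 / real a) \<le> (\<Sum>a=1..<2^K. 1 / real a)"
      using assms by (intro sum_mono2) auto
    thus ?thesis using harmonic_dyadic[of K] by linarith
  qed
  have div: "real b = real a * real (b div a)" if "a dvd b" for a b :: nat
    using that by (metis dvd_mult_div_cancel of_nat_mult)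
  have "(\<Sum>b=1..T. real (num_divs b) / real b) = (\<Sum>b=1..T. \<Sum>a\<in>{a. a dvd b}. 1 / real a * (1 / real (b div a)))"
  proof (intro sum.cong refl)
    fix b assume "b \<in> {1..T}"
    have "(\<Sum>a\<in>{a. a dvd b}. 1 / real a * (1 / real (b div a))) = (\<Sum>a\<in>{a. a dvd b}. 1 / real b)"
      by (intro sum.cong refl) (simp add: div)
    thus "real (num_divs b) / real b = (\<Sum>a\<in>{a. a dvd b}. 1 / real a * (1 / real (b div a)))"
      by (simp add: num_divs_def)
  qed
  also have "\<dots> \<le> (\<Sum>a=1..T. \<Sum>c=1..T. 1 / real a * (1 / real c))"
    by (rule sum_divisors_le) auto
  also have "\<dots> = (\<Sum>a=1..T. 1 / real a) * (\<Sum>c=1..T. 1 / real c)" by (simp only: sum_product)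
  also have "\<dots> \<le> real K * real K" by (intro mult_mono h sum_nonneg) auto
  finally show A: "(\<Sum>b=1..T. real (num_divs b) / real b) \<le> (real K)^2" by (simp add: power2_eq_square)
  let ?F = "\<lambda>a. real (num_divs a) / real a"
  have "(\<Sum>b=1..T. (real (num_divs b))^2 / real b) \<le> (\<Sum>b=1..T. \<Sum>a\<in>{a. a dvd b}. ?F a * ?F (b div a))"
  proof (intro sum_mono)
    fix b assume b: "b \<in> {1..T}"
    have "(real (num_divs b))^2 / real b = (\<Sum>a\<in>{a. a dvd b}. real (num_divs b) / real b)"
      by (simp add: num_divs_def power2_eq_square)
    also have "\<dots> \<le> (\<Sum>a\<in>{a. a dvd b}. ?F a * ?F (b div a))"
    proof (intro sum_mono)
      fix a assume a: "a \<in> {a. a dvd b}"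
      then obtain c where c: "b = a * c" by blast
      hence "a > 0" "c > 0" using b by (auto intro: Nat.gr0I)
      hence "real (num_divs (a * c)) \<le> real (num_divs a) * real (num_divs c)"
        using num_divs_mult_le[of a c] by (metis of_nat_le_iff of_nat_mult)
      thus "real (num_divs b) / real b \<le> ?F a * ?F (b div a)"
        using \<open>a > 0\<close> \<open>c > 0\<close> by (simp add: c divide_right_mono)
    qed
    finally show "(real (num_divs b))^2 / real b \<le> (\<Sum>a\<in>{a. a dvd b}. ?F a * ?F (b div a))" .
  qed
  also have "\<dots> \<le> (\<Sum>a=1..T. \<Sum>c=1..T. ?F a * ?F c)"
    by (rule sum_divisors_le) auto
  also have "\<dots> = (\<Sum>a=1..T. ?F a) * (\<Sum>c=1..T. ?F c)" by (simp only: sum_product)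
  also have "\<dots> \<le> (real K)^2 * (real K)^2" by (intro mult_mono A sum_nonneg) auto
  finally show "(\<Sum>b=1..T. (real (num_divs b))^2 / real b) \<le> (real K) ^ 4" by (simp flip: power_add)
qed

text \<open>The map from (d, \<nu>) to the reduced modulus e and the root modulo e has fibres of at
  most \<open>(num_divs b)^2\<close> elements: one factor for the choice of g = gcd b d, the other
  for the lifts of a root from e to g e.\<close>

lemma sum_reduced_roots_le:
  fixes f :: "nat \<Rightarrow> nat \<Rightarrow> real"
  assumes "squarefree b" "\<And>d \<nu>. f d \<nu> \<ge> 0"
  shows "(\<Sum>d\<in>moduli D. \<Sum>\<nu>\<in>sqrt_roots d. f (d div gcd b d) (\<nu> mod (d div gcd b d)))
     \<le> (real (num_divs b))^2 * (\<Sum>d\<in>moduli D. \<Sum>\<nu>\<in>sqrt_roots d. f d \<nu>)"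
proof -
  have b0: "b > 0" using assms(1) by (cases "b = 0") auto
  define S where "S = (SIGMA d:moduli D. sqrt_roots d)"
  define \<phi> where "\<phi> = (\<lambda>(d, \<nu>). (d div gcd b d, \<nu> mod (d div gcd b d)))"
  have finS: "finite S" by (auto simp: S_def finite_modulus_index)
  have \<phi>: "\<phi> p \<in> S" if p: "p \<in> S" for p
  proof -
    obtain d \<nu> where p_eq: "p = (d, \<nu>)" by (cases p)
    have d: "d > 0" "real d \<le> D" "\<nu> \<in> sqrt_roots d" using p by (auto simp: S_def p_eq)
    define e where "e = d div gcd b d"
    have de: "d = gcd b d * e" by (simp add: e_def)
    have "e > 0" using d(1) de by (metis mult_0_right neq0_conv)
    have "real e \<le> real d" by (simp add: e_def)
    have "e dvd \<nu>\<^sup>2 + 1" using d(3) de unfolding sqrt_roots_def by (metis (mono_tags, lifting) dvd_mult_right mem_Collect_eq)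
    moreover have "(\<nu> mod e)^2 + 1 \<equiv> (\<nu> mod e)^2 + 1" by simp
    moreover have "((\<nu> mod e)^2 + 1) mod e = (\<nu>\<^sup>2 + 1) mod e" by (metis mod_add_left_eq power_mod)
    ultimately have "\<nu> mod e \<in> sqrt_roots e" using \<open>e > 0\<close> by (simp add: sqrt_roots_def dvd_eq_mod_eq_0)
    thus ?thesis using \<open>e > 0\<close> \<open>real e \<le> real d\<close> d(2) by (simp add: S_def \<phi>_def p_eq flip: e_def)
  qed
  have fiber: "card {p \<in> S. \<phi> p = q} \<le> (num_divs b)^2" if q: "q \<in> S" for q
  proof -
    obtain e \<nu>' where q_eq: "q = (e, \<nu>')" by (cases q)
    have e0: "e > 0" using q by (simp add: S_def q_eq)
    have "{p \<in> S. \<phi> p = q} \<subseteq> (\<Union>g\<in>{g. g dvd b}. Pair (g * e) ` {\<nu> \<in> sqrt_roots (g * e). \<nu> mod e = \<nu>'})"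
    proof
      fix p assume p: "p \<in> {p \<in> S. \<phi> p = q}"
      obtain d \<nu> where p_eq: "p = (d, \<nu>)" by (cases p)
      have e: "e = d div gcd b d" "\<nu>' = \<nu> mod e" using p by (auto simp: \<phi>_def p_eq q_eq)
      have "d = gcd b d * e" by (simp add: e)
      moreover have "\<nu> \<in> sqrt_roots d" using p by (simp add: S_def p_eq)
      ultimately show "p \<in> (\<Union>g\<in>{g. g dvd b}. Pair (g * e) ` {\<nu> \<in> sqrt_roots (g * e). \<nu> mod e = \<nu>'})"
        using e by (intro UN_I[of "gcd b d"]) (auto simp: p_eq)
    qed
    hence "card {p \<in> S. \<phi> p = q} \<le> card (\<Union>g\<in>{g. g dvd b}. Pair (g * e) ` {\<nu> \<in> sqrt_roots (g * e). \<nu> mod e = \<nu>'})"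
      using b0 by (intro card_mono) auto
    also have "\<dots> \<le> (\<Sum>g\<in>{g. g dvd b}. card (Pair (g * e) ` {\<nu> \<in> sqrt_roots (g * e). \<nu> mod e = \<nu>'}))"
      using b0 by (intro card_UN_le) auto
    also have "\<dots> \<le> (\<Sum>g\<in>{g. g dvd b}. num_divs b)"
    proof (intro sum_mono)
      fix g assume g: "g \<in> {g. g dvd b}"
      have "card (Pair (g * e) ` {\<nu> \<in> sqrt_roots (g * e). \<nu> mod e = \<nu>'}) \<le> card {\<nu> \<in> sqrt_roots (g * e). \<nu> mod e = \<nu>'}"
        by (intro card_image_le) auto
      also have "\<dots> \<le> card {k. k dvd g}"
        using g assms(1) e0 by (intro card_root_lifts) (auto intro: squarefree_mono)
      also have "\<dots> \<le> card {k. k dvd b}" using g b0 by (intro card_mono) auto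
      finally show "card (Pair (g * e) ` {\<nu> \<in> sqrt_roots (g * e). \<nu> mod e = \<nu>'}) \<le> num_divs b"
        by (simp add: num_divs_def)
    qed
    also have "\<dots> = (num_divs b)^2" by (simp add: num_divs_def power2_eq_square)
    finally show ?thesis .
  qed
  let ?f = "\<lambda>p. f (fst p) (snd p)"
  have "(\<Sum>d\<in>moduli D. \<Sum>\<nu>\<in>sqrt_roots d. f (d div gcd b d) (\<nu> mod (d div gcd b d)))
      = (\<Sum>p\<in>S. ?f (\<phi> p))"
    unfolding S_def by (subst sum.Sigma) (auto simp: finite_modulus_index \<phi>_def case_prod_unfold)
  also have "\<dots> = (\<Sum>q\<in>S. \<Sum>p\<in>{p \<in> S. \<phi> p = q}. ?f (\<phi> p))"
    by (rule sum.group[symmetric]) (use finS \<phi> in auto)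
  also have "\<dots> = (\<Sum>q\<in>S. real (card {p \<in> S. \<phi> p = q}) * ?f q)" by simp
  also have "\<dots> \<le> (\<Sum>q\<in>S. (real (num_divs b))^2 * ?f q)"
  proof (intro sum_mono mult_right_mono)
    fix q assume "q \<in> S"
    from fiber[OF this] show "real (card {p \<in> S. \<phi> p = q}) \<le> (real (num_divs b))^2"
      by (metis of_nat_le_iff of_nat_power)
  qed (use assms in auto)
  also have "\<dots> = (real (num_divs b))^2 * (\<Sum>d\<in>moduli D. \<Sum>\<nu>\<in>sqrt_roots d. f d \<nu>)"
    unfolding S_def by (subst sum.Sigma) (auto simp: finite_modulus_index sum_distrib_left case_prod_unfold)
  finally show ?thesis .
qed

section \<open>Moebius inversion over the base t\<close>

lemma prime_factors_prod_primes:
  fixes X :: "nat set"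
  assumes "finite X" "\<And>p. p \<in> X \<Longrightarrow> prime p"
  shows "prime_factors (\<Prod>X) = X" "squarefree (\<Prod>X)"
proof -
  have "\<Prod>X \<noteq> 0" using assms(1) not_prime_0 assms(2) by (metis prod_zero_iff)
  moreover have "prime p \<and> p dvd \<Prod>X \<longleftrightarrow> p \<in> X" for p
    using assms by (auto simp: prime_dvd_prod_iff) (metis primes_dvd_imp_eq)
  ultimately show "prime_factors (\<Prod>X) = X" by (auto simp: prime_factors_dvd)
  show "squarefree (\<Prod>X)"
    using assms by (intro squarefree_prod_coprime) (auto simp: primes_coprime squarefree_prime)
qed

lemma prod_prime_factors_squarefree:
  assumes "squarefree (n :: nat)"
  shows "\<Prod>(prime_factors n) = n"
proof -
  have n0: "n \<noteq> 0" using assms by (intro notI) simp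
  have "multiplicity p n = 1" if "p \<in> prime_factors n" for p
    using assms n0 that by (simp add: squarefree_factorial_semiring')
  hence "(\<Prod>p\<in>prime_factors n. p ^ multiplicity p n) = \<Prod>(prime_factors n)" by (intro prod.cong) auto
  thus ?thesis using prime_factorization_nat[of n] n0 by simp
qed

definition moebius :: "nat \<Rightarrow> real" where
  "moebius n = (if squarefree n then (-1) ^ card (prime_factors n) else 0)"

text \<open>Expanding the product over subsets of the prime factors gives the squarefree divisors.
  The indicator of p | m for \<open>f\<close> yields the coprimality condition, and gcd(p, d) / p
  yields the density in the main term.\<close>

lemma sum_moebius_prod:
  fixes f :: "nat \<Rightarrow> real"
  assumes "t > 0"
  shows "(\<Sum>b\<in>{b. b dvd t}. moebius b * (\<Prod>p\<in>prime_factors b. f p)) = (\<Prod>p\<in>prime_factors t. 1 - f p)"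
proof -
  have "(\<Prod>p\<in>prime_factors t. 1 - f p) = (\<Prod>p\<in>prime_factors t. - f p + 1)" by simp
  also have "\<dots> = (\<Sum>X\<in>Pow (prime_factors t). (\<Prod>p\<in>X. - f p) * (\<Prod>p\<in>prime_factors t - X. 1))"
    by (rule prod_add) auto
  also have "\<dots> = (\<Sum>X\<in>Pow (prime_factors t). (-1) ^ card X * (\<Prod>p\<in>X. f p))"
    by (simp add: prod_uminus)
  also have "\<dots> = (\<Sum>b\<in>{b. b dvd t \<and> squarefree b}. (-1) ^ card (prime_factors b) * (\<Prod>p\<in>prime_factors b. f p))"
  proof (rule sum.reindex_bij_witness[of _ prime_factors "\<lambda>X. \<Prod>X"])
    fix X assume "X \<in> Pow (prime_factors t)"
    hence X: "X \<subseteq> prime_factors t" "finite X" "\<And>p. p \<in> X \<Longrightarrow> prime p"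
      by (auto intro: finite_subset)
    show "prime_factors (\<Prod>X) = X" using X by (intro prime_factors_prod_primes)
    have "\<Prod>X dvd t"
    proof (rule squarefree_dvdI)
      fix p assume "prime p" "p dvd \<Prod>X"
      hence "p \<in> prime_factors (\<Prod>X)"
        using prime_factors_prod_primes(2)[OF X(2,3)] by (cases "\<Prod>X = 0") (simp_all add: prime_factors_dvd)
      thus "p dvd t" using prime_factors_prod_primes(1)[OF X(2,3)] X(1) by auto
    qed (use X in \<open>intro prime_factors_prod_primes\<close>)
    thus "\<Prod>X \<in> {b. b dvd t \<and> squarefree b}"
      using prime_factors_prod_primes(2)[OF X(2,3)] by simp
    show "(-1) ^ card (prime_factors (\<Prod>X)) * (\<Prod>p\<in>prime_factors (\<Prod>X). f p) = (-1) ^ card X * (\<Prod>p\<in>X. f p)"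
      using prime_factors_prod_primes(1)[OF X(2,3)] by simp
  next
    fix b assume "b \<in> {b. b dvd t \<and> squarefree b}"
    thus "\<Prod>(prime_factors b) = b" "prime_factors b \<in> Pow (prime_factors t)"
      using assms dvd_prime_factors[of t b] by (auto simp: prod_prime_factors_squarefree)
  qed
  also have "\<dots> = (\<Sum>b\<in>{b. b dvd t}. moebius b * (\<Prod>p\<in>prime_factors b. f p))"
    using assms by (intro sum.mono_neutral_cong_left) (auto simp: moebius_def)
  finally show ?thesis ..
qed

lemma sum_moebius_coprime:
  fixes m :: int
  assumes "t > 0"
  shows "(\<Sum>b\<in>{b. b dvd t}. moebius b * (if int b dvd m then 1 else 0)) = (if coprime m (int t) then 1 else 0)"
proof -
  define f where "f p = (if int p dvd m then 1 else 0 :: real)" for p :: nat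
  have prod_f: "(\<Prod>p\<in>prime_factors b. f p) = (if int b dvd m then 1 else 0)" if sqf: "squarefree b" for b
  proof (cases "int b dvd m")
    case True
    have "f p = 1" if "p \<in> prime_factors b" for p
      unfolding f_def
      using dvd_trans[of "int p" "int b" m] in_prime_factors_imp_dvd[OF that] True by simp
    thus ?thesis using True by simp
  next
    case False
    have "\<not> b dvd nat \<bar>m\<bar>" using False by (simp add: dvd_nat_abs_iff)
    then obtain p where p: "prime p" "p dvd b" "\<not> p dvd nat \<bar>m\<bar>"
      using squarefree_dvdI[OF sqf, of "nat \<bar>m\<bar>"] by blast
    have "\<not> int p dvd m" using p(3) by (simp add: dvd_nat_abs_iff)
    moreover have "p \<in> prime_factors b" using p sqf by (cases "b = 0") (simp_all add: prime_factors_dvd)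
    ultimately have "(\<Prod>p\<in>prime_factors b. f p) = 0" by (intro prod_zero) (auto simp: f_def)
    thus ?thesis using False by simp
  qed
  have "(\<Sum>b\<in>{b. b dvd t}. moebius b * (if int b dvd m then 1 else 0)) = (\<Sum>b\<in>{b. b dvd t}. moebius b * (\<Prod>p\<in>prime_factors b. f p))"
  proof (intro sum.cong refl)
    fix b
    show "moebius b * (if int b dvd m then 1 else 0) = moebius b * (\<Prod>p\<in>prime_factors b. f p)"
      by (cases "squarefree b") (simp_all only: prod_f moebius_def if_False mult_zero_left)
  qed
  also have "\<dots> = (\<Prod>p\<in>prime_factors t. 1 - f p)" by (rule sum_moebius_prod[OF assms])
  also have "\<dots> = (if coprime m (int t) then 1 else 0)"
  proof (cases "coprime m (int t)")
    case True
    have "f p = 0" if "p \<in> prime_factors t" for p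
    proof -
      have "int p dvd int t" "prime (int p)" using that by auto
      hence "\<not> int p dvd m" using True by (metis coprime_common_divisor not_prime_unit)
      thus ?thesis by (simp add: f_def)
    qed
    thus ?thesis using True by simp
  next
    case False
    hence "\<bar>gcd m (int t)\<bar> \<noteq> 1" by (simp add: coprime_iff_gcd_eq_1)
    then obtain q where "prime q" "q dvd gcd m (int t)" using prime_factor_int by blast
    hence q: "prime q" "q dvd m" "q dvd int t" by simp_all
    define p where "p = nat q"
    have qp: "q = int p" using q(1) by (simp add: p_def prime_ge_0_int)
    have "p \<in> prime_factors t" using q assms unfolding qp by (auto simp: prime_factors_dvd)
    moreover have "f p = 1" using q(2) by (simp add: f_def qp)
    ultimately have "(\<Prod>p\<in>prime_factors t. 1 - f p) = 0" by (intro prod_zero) auto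
    thus ?thesis using False by simp
  qed
  finally show ?thesis .
qed

lemma gcd_mult_coprime:
  fixes a b d :: nat
  assumes "coprime a b"
  shows "gcd (a * b) d = gcd a d * gcd b d"
proof (rule dvd_antisym)
  obtain u v where uv: "gcd (a * b) d = u * v" "u dvd a" "v dvd b"
    using division_decomp[of "gcd (a * b) d" a b] by auto
  hence "u dvd gcd a d" "v dvd gcd b d"
    by (metis dvd_mult_left dvd_mult_right gcd_dvd2 gcd_greatest)+
  thus "gcd (a * b) d dvd gcd a d * gcd b d" unfolding uv by (rule mult_dvd_mono)
  have "coprime (gcd a d) (gcd b d)" using assms by (meson coprime_divisors gcd_dvd1)
  thus "gcd a d * gcd b d dvd gcd (a * b) d"
    by (intro gcd_greatest mult_dvd_mono divides_mult) auto
qed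

lemma gcd_prod_primes:
  fixes X :: "nat set"
  assumes "finite X" "\<And>p. p \<in> X \<Longrightarrow> prime p"
  shows "gcd (\<Prod>X) d = (\<Prod>p\<in>X. gcd p d)"
  using assms
proof (induction X)
  case (insert p X)
  have "coprime p (\<Prod>X)"
    using insert by (intro prod_coprime_right primes_coprime) auto
  hence "gcd (p * \<Prod>X) d = gcd p d * gcd (\<Prod>X) d"
    by (rule gcd_mult_coprime)
  thus ?case using insert by simp
qed auto

text \<open>The main term for the multiples of b has density proportional to gcd(b, d) / b. The
  local factor 1 - gcd(p, d) / p is 0 for p | d and 1 - 1 / p otherwise, which is how the condition
  (l, d) = 1 and the ratio of the totient arise in \<open>M_main\<close>.\<close>

lemma sum_moebius_gcd:
  assumes "t > 0" "d > 0"
  shows "(\<Sum>b\<in>{b. b dvd t}. moebius b * (real (gcd b d) / real b)) = (if coprime t d then real (totient t) / real t else 0)"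
proof -
  define f where "f p = real (gcd p d) / real p" for p :: nat
  have prod_f: "(\<Prod>p\<in>prime_factors b. f p) = real (gcd b d) / real b" if "squarefree b" for b
  proof -
    have "(\<Prod>p\<in>prime_factors b. f p) = real (\<Prod>p\<in>prime_factors b. gcd p d) / real (\<Prod>(prime_factors b))"
      by (simp add: f_def prod_dividef)
    also have "(\<Prod>p\<in>prime_factors b. gcd p d) = gcd (\<Prod>(prime_factors b)) d"
      by (rule gcd_prod_primes[symmetric]) auto
    finally show ?thesis using that by (simp add: prod_prime_factors_squarefree)
  qed
  have "(\<Sum>b\<in>{b. b dvd t}. moebius b * (real (gcd b d) / real b)) = (\<Sum>b\<in>{b. b dvd t}. moebius b * (\<Prod>p\<in>prime_factors b. f p))"
  proof (intro sum.cong refl)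
    fix b
    show "moebius b * (real (gcd b d) / real b) = moebius b * (\<Prod>p\<in>prime_factors b. f p)"
      by (cases "squarefree b") (simp_all only: prod_f moebius_def if_False mult_zero_left)
  qed
  also have "\<dots> = (\<Prod>p\<in>prime_factors t. 1 - f p)" by (rule sum_moebius_prod[OF assms(1)])
  also have "\<dots> = (if coprime t d then real (totient t) / real t else 0)"
  proof (cases "coprime t d")
    case True
    have "f p = 1 / real p" if "p \<in> prime_factors t" for p
    proof -
      have "coprime p d" using that True by (meson coprime_divisors dvd_refl in_prime_factors_iff)
      thus ?thesis by (simp add: f_def)
    qed
    hence "(\<Prod>p\<in>prime_factors t. 1 - f p) = (\<Prod>p\<in>prime_factors t. 1 - 1 / real p)" by (intro prod.cong) auto
    thus ?thesis using True totient_formula2[of t] assms by simp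
  next
    case False
    then obtain p where p: "prime p" "p dvd t" "p dvd d"
      by (metis coprime_iff_gcd_eq_1 gcd_dvd1 gcd_dvd2 dvd_trans prime_factor_nat)
    have "f p = 1" using p by (simp add: f_def gcd_proj1_if_dvd_nat prime_gt_0_nat)
    moreover have "p \<in> prime_factors t" using p assms by (auto simp: prime_factors_dvd)
    ultimately have "(\<Prod>p\<in>prime_factors t. 1 - f p) = 0" by (intro prod_zero) auto
    thus ?thesis using False by simp
  qed
  finally show ?thesis .
qed

text \<open>With m = b n and l = (b s)^r both sides of the congruence contain b, since r >= 1.
  Dividing it out lowers the modulus to e, because b / gcd(b, d) is a unit modulo e, and leaves the
  multiplier b^(r-1) s^r.\<close>

lemma card_multiples_in_progression:
  assumes "b > 0" "d > 0" "r \<ge> 1"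
  defines "e \<equiv> d div gcd b d"
  shows "real (card {m::int. \<bar>m\<bar> \<le> int M \<and> int b dvd m \<and> int d dvd m - int \<nu> * int ((b * s) ^ r)})
     = ap_count (M div b) (int (\<nu> mod e) * int (b ^ (r - 1) * s ^ r)) e"
proof -
  define g where "g = gcd b d"
  define b' where "b' = b div g"
  have g0: "g > 0" using assms by (simp add: g_def)
  have b: "b = g * b'" and d: "d = g * e" by (simp_all add: b'_def g_def e_def)
  have cop: "coprime (int b') (int e)"
    unfolding b'_def e_def g_def using assms by (simp add: div_gcd_coprime)
  have brs: "int ((b * s) ^ r) = int b * int (b ^ (r - 1) * s ^ r)"
    using assms(3) by (cases r) (simp_all add: power_mult_distrib)
  have iff: "int d dvd int b * n - int \<nu> * int ((b * s) ^ r) \<longleftrightarrow> int e dvd n - int (\<nu> mod e) * int (b ^ (r - 1) * s ^ r)" for n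
  proof -
    let ?c = "int (b ^ (r - 1) * s ^ r)"
    have "int b * n - int \<nu> * int ((b * s) ^ r) = int b * (n - int \<nu> * ?c)"
      unfolding brs by (simp add: algebra_simps)
    hence "int d dvd int b * n - int \<nu> * int ((b * s) ^ r) \<longleftrightarrow> int g * int e dvd int g * (int b' * (n - int \<nu> * ?c))"
      using b d by (metis mult.assoc of_nat_mult)
    also have "\<dots> \<longleftrightarrow> int e dvd int b' * (n - int \<nu> * ?c)" using g0 by simp
    also have "\<dots> \<longleftrightarrow> int e dvd n - int \<nu> * ?c"
      using cop by (simp add: coprime_dvd_mult_right_iff coprime_commute)
    also have "\<dots> \<longleftrightarrow> (n - int \<nu> * ?c) mod int e = 0" by (simp add: dvd_eq_mod_eq_0)
    also have "(n - int \<nu> * ?c) mod int e = (n - int (\<nu> mod e) * ?c) mod int e"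
      by (metis mod_diff_right_eq mod_mult_left_eq zmod_int)
    also have "\<dots> = 0 \<longleftrightarrow> int e dvd n - int (\<nu> mod e) * ?c" by (simp add: dvd_eq_mod_eq_0)
    finally show ?thesis .
  qed
  have abs_iff: "\<bar>int b * n\<bar> \<le> int M \<longleftrightarrow> \<bar>n\<bar> \<le> int (M div b)" for n
  proof -
    have "\<bar>int b * n\<bar> \<le> int M \<longleftrightarrow> \<bar>n\<bar> * int b \<le> int M" by (simp add: abs_mult mult.commute)
    also have "\<dots> \<longleftrightarrow> nat \<bar>n\<bar> * b \<le> M" by (metis abs_ge_zero int_nat_eq of_nat_le_iff of_nat_mult)
    also have "\<dots> \<longleftrightarrow> nat \<bar>n\<bar> \<le> M div b" using assms(1) by (simp add: less_eq_div_iff_mult_less_eq)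
    also have "\<dots> \<longleftrightarrow> \<bar>n\<bar> \<le> int (M div b)" by linarith
    finally show ?thesis .
  qed
  have "{m::int. \<bar>m\<bar> \<le> int M \<and> int b dvd m \<and> int d dvd m - int \<nu> * int ((b * s) ^ r)}
     = (\<lambda>n. int b * n) ` {n. \<bar>n\<bar> \<le> int (M div b) \<and> int e dvd n - int (\<nu> mod e) * int (b ^ (r - 1) * s ^ r)}"
    (is "?A = ?B")
  proof (intro equalityI subsetI)
    fix m assume m: "m \<in> ?A"
    then obtain n where "m = int b * n" by blast
    thus "m \<in> ?B" using m iff abs_iff by (intro image_eqI[of _ _ n]) simp_all
  next
    fix m assume "m \<in> ?B"
    thus "m \<in> ?A" using iff abs_iff by auto
  qed
  moreover have "inj_on (\<lambda>n. int b * n) A" for A using assms(1) by (auto intro: inj_onI)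
  ultimately show ?thesis unfolding ap_count_def by (simp only: card_image)
qed

text \<open>If d divides l^2 + m^2 with l and m coprime, then l is invertible modulo d and m / l is
  a root, so each m belongs to exactly one \<nu>. The factor 2 accounts for the sign of m. The value
  m = 0 is coprime to l only for l = 1, and then d divides 1.\<close>

lemma sum_card_roots_progression:
  assumes "d > 0" "l > 0"
  shows "(\<Sum>\<nu>\<in>sqrt_roots d. card {m::int. \<bar>m\<bar> \<le> int M \<and> coprime m (int l) \<and> int d dvd m - int \<nu> * int l})
     = 2 * card {m. 0 < m \<and> m \<le> M \<and> d dvd l^2 + m^2 \<and> coprime l m} + (if d = 1 \<and> l = 1 then 1 else 0)"
proof -
  define Z where "Z = {m::int. \<bar>m\<bar> \<le> int M \<and> coprime m (int l) \<and> int d dvd (int l)^2 + m^2}"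
  define S where "S \<nu> = {m::int. \<bar>m\<bar> \<le> int M \<and> coprime m (int l) \<and> int d dvd m - int \<nu> * int l}" for \<nu>
  define P where "P = {m. 0 < m \<and> m \<le> M \<and> d dvd l^2 + m^2 \<and> coprime l m}"
  have finS: "finite (S \<nu>)" for \<nu> by (rule finite_subset[of _ "{-int M..int M}"]) (auto simp: S_def)
  have coprime_ld: "coprime (int l) (int d)" if "coprime m (int l)" "int d dvd (int l)^2 + m^2" for m
  proof (rule coprimeI)
    fix c assume c: "c dvd int l" "c dvd int d"
    hence "c dvd ((int l)^2 + m^2) - (int l)^2" using that(2) by (intro dvd_diff) (auto intro: dvd_trans simp: power2_eq_square)
    hence "c dvd m * m" by (simp add: power2_eq_square)
    moreover have "coprime c m" using that(1) c(1) by (meson coprime_commute coprime_divisors dvd_refl)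
    ultimately have "c dvd m" by (simp add: coprime_dvd_mult_left_iff)
    thus "is_unit c" using \<open>coprime c m\<close> by (metis coprime_absorb_left)
  qed
  have S_sub: "(int l)^2 + m^2 = (int l)^2 * ((int \<nu>)^2 + 1) + (m - int \<nu> * int l) * (m + int \<nu> * int l)" for m \<nu>
    by (simp add: power2_eq_square algebra_simps)
  have root: "int d dvd (int \<nu>)^2 + 1" if "\<nu> \<in> sqrt_roots d" for \<nu>
  proof -
    have "int d dvd int (\<nu>\<^sup>2 + 1)" using that by (simp only: of_nat_dvd_iff) (simp add: sqrt_roots_def)
    thus ?thesis by (simp add: add.commute)
  qed
  have "Z = (\<Union>\<nu>\<in>sqrt_roots d. S \<nu>)"
  proof (intro equalityI subsetI)
    fix m assume m: "m \<in> Z"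
    hence cop: "coprime (int l) (int d)" by (intro coprime_ld[of m]) (auto simp: Z_def)
    then obtain k where k: "[int l * k = 1] (mod int d)" using cong_solve_coprime_int by blast
    define \<nu> where "\<nu> = nat ((m * k) mod int d)"
    have \<nu>: "int \<nu> = (m * k) mod int d" using assms by (simp add: \<nu>_def)
    have "[int \<nu> * int l = m * k * int l] (mod int d)"
      unfolding \<nu> by (intro cong_mult) (auto simp: cong_def)
    also have "m * k * int l = m * (int l * k)" by simp
    also have "[m * (int l * k) = m * 1] (mod int d)" by (intro cong_mult k) auto
    finally have "[m = int \<nu> * int l] (mod int d)" by (simp add: cong_sym)
    hence dv: "int d dvd m - int \<nu> * int l" by (simp add: cong_iff_dvd_diff)
    have "int d dvd (int l)^2 * ((int \<nu>)^2 + 1)"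
    proof -
      have "int d dvd ((int l)^2 + m^2) - (m - int \<nu> * int l) * (m + int \<nu> * int l)"
        using m dv by (intro dvd_diff) (auto simp: Z_def)
      thus ?thesis unfolding S_sub[of m \<nu>] by simp
    qed
    hence "int d dvd (int \<nu>)^2 + 1" using cop by (simp add: coprime_dvd_mult_right_iff coprime_commute)
    hence "int d dvd int (\<nu>\<^sup>2 + 1)" by (simp add: add.commute)
    hence "d dvd \<nu>\<^sup>2 + 1" by (simp only: of_nat_dvd_iff)
    moreover have "\<nu> < d" using assms(1) \<nu> by (metis of_nat_0_less_iff of_nat_less_iff pos_mod_bound)
    ultimately have "\<nu> \<in> sqrt_roots d" by (simp add: sqrt_roots_def)
    thus "m \<in> (\<Union>\<nu>\<in>sqrt_roots d. S \<nu>)" using dv m by (auto simp: S_def Z_def)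
  next
    fix m assume "m \<in> (\<Union>\<nu>\<in>sqrt_roots d. S \<nu>)"
    then obtain \<nu> where \<nu>: "\<nu> \<in> sqrt_roots d" "m \<in> S \<nu>" by blast
    have "int d dvd (int l)^2 + m^2"
      unfolding S_sub[of m \<nu>] using root[OF \<nu>(1)] \<nu>(2) by (intro dvd_add) (auto simp: S_def)
    thus "m \<in> Z" using \<nu>(2) by (simp add: Z_def S_def)
  qed
  moreover have "card (\<Union>\<nu>\<in>sqrt_roots d. S \<nu>) = (\<Sum>\<nu>\<in>sqrt_roots d. card (S \<nu>))"
  proof (rule card_UN_disjoint)
    show "\<forall>i\<in>sqrt_roots d. \<forall>j\<in>sqrt_roots d. i \<noteq> j \<longrightarrow> S i \<inter> S j = {}"
    proof (intro ballI impI equals0I)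
      fix i j m assume ij: "i \<in> sqrt_roots d" "j \<in> sqrt_roots d" "i \<noteq> j" "m \<in> S i \<inter> S j"
      have "int d dvd (int l)^2 + m^2"
        unfolding S_sub[of m i] using root[OF ij(1)] ij(4) by (intro dvd_add) (auto simp: S_def)
      hence cop: "coprime (int l) (int d)" using ij(4) by (intro coprime_ld[of m]) (auto simp: S_def)
      have "int d dvd m - int j * int l" "int d dvd m - int i * int l" using ij(4) by (auto simp: S_def)
      hence "int d dvd (m - int j * int l) - (m - int i * int l)" by (rule dvd_diff)
      hence "int d dvd (int i - int j) * int l" by (simp add: algebra_simps)
      hence "int d dvd int i - int j" using cop by (simp add: coprime_dvd_mult_left_iff coprime_commute)
      hence "int i mod int d = int j mod int d" by (simp add: mod_eq_dvd_iff)
      hence "i mod d = j mod d" by (metis of_nat_eq_iff zmod_int)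
      thus False using ij by (simp add: sqrt_roots_def)
    qed
  qed (use finS in auto)
  ultimately have "(\<Sum>\<nu>\<in>sqrt_roots d. card (S \<nu>)) = card Z" by simp
  also have "Z = (int ` P \<union> (\<lambda>m. - int m) ` P) \<union> (if d = 1 \<and> l = 1 then {0} else {})"
  proof (intro equalityI subsetI)
    fix m assume m: "m \<in> Z"
    show "m \<in> (int ` P \<union> (\<lambda>m. - int m) ` P) \<union> (if d = 1 \<and> l = 1 then {0} else {})"
    proof (cases "m = 0")
      case True
      hence "l = 1" using m assms by (simp add: Z_def)
      moreover have "d = 1" using m True \<open>l = 1\<close> by (simp add: Z_def)
      ultimately show ?thesis using True by simp
    next
      case False
      define n where "n = nat \<bar>m\<bar>"
      have n: "int n = \<bar>m\<bar>" by (simp add: n_def)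
      have "int d dvd int (l^2 + n^2)" using m by (simp add: Z_def n)
      hence "d dvd l^2 + n^2" by (simp only: of_nat_dvd_iff)
      moreover have "coprime (int l) (int n)" using m by (simp add: Z_def n coprime_commute)
      hence "coprime l n" by simp
      moreover have "n \<le> M" using m n by (simp add: Z_def)
      ultimately have "n \<in> P" using False n by (simp add: P_def)
      moreover have "m = int n \<or> m = - int n" using n by linarith
      ultimately show ?thesis by blast
    qed
  next
    fix m assume "m \<in> (int ` P \<union> (\<lambda>m. - int m) ` P) \<union> (if d = 1 \<and> l = 1 then {0} else {})"
    moreover have "int n \<in> Z \<and> - int n \<in> Z" if "n \<in> P" for n
    proof -
      have "int d dvd int (l^2 + n^2)" using that by (simp only: of_nat_dvd_iff) (simp add: P_def)
      thus ?thesis using that by (simp add: P_def Z_def coprime_commute)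
    qed
    ultimately show "m \<in> Z" by (auto simp: Z_def split: if_splits)
  qed
  also have "card \<dots> = 2 * card P + (if d = 1 \<and> l = 1 then 1 else 0)"
  proof -
    have finP: "finite P" by (rule finite_subset[of _ "{..M}"]) (auto simp: P_def)
    have "card (int ` P \<union> (\<lambda>m. - int m) ` P) = card (int ` P) + card ((\<lambda>m. - int m) ` P)"
      using finP by (intro card_Un_disjoint) (auto simp: P_def)
    also have "\<dots> = 2 * card P" by (simp add: card_image inj_on_def)
    finally have 1: "card (int ` P \<union> (\<lambda>m. - int m) ` P) = 2 * card P" .
    have "card ((int ` P \<union> (\<lambda>m. - int m) ` P) \<union> (if d = 1 \<and> l = 1 then {0} else {}))
      = card (int ` P \<union> (\<lambda>m. - int m) ` P) + card (if d = 1 \<and> l = 1 then {0::int} else {})"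
      using finP by (intro card_Un_disjoint) (auto simp: P_def)
    thus ?thesis using 1 by simp
  qed
  finally show ?thesis by (simp only: S_def P_def)
qed

lemma sum_atLeastAtMost_divisors:
  fixes F :: "nat \<Rightarrow> nat \<Rightarrow> 'a :: comm_monoid_add"
  shows "(\<Sum>t=1..T. \<Sum>b\<in>{b. b dvd t}. F b t) = (\<Sum>b=1..T. \<Sum>s=1..T div b. F b (b * s))"
proof -
  have "(\<Sum>t=1..T. \<Sum>b\<in>{b. b dvd t}. F b t) = (\<Sum>(t, b)\<in>(SIGMA t:{1..T}. {b. b dvd t}). F b t)"
    by (subst sum.Sigma) auto
  also have "\<dots> = (\<Sum>(b, s)\<in>(SIGMA b:{1..T}. {1..T div b}). F b (b * s))"
  proof (rule sum.reindex_bij_witness[of _ "\<lambda>(b, s). (b * s, b)" "\<lambda>(t, b). (b, t div b)"])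
    fix p assume "p \<in> (SIGMA t:{1..T}. {b. b dvd t})"
    then obtain t b where p: "p = (t, b)" "1 \<le> t" "t \<le> T" "b dvd t" by auto
    then obtain s where s: "t = b * s" by blast
    have "b > 0" "s > 0" using p s by (auto intro: Nat.gr0I)
    moreover have "b \<le> T" using p \<open>s > 0\<close> by (meson dvd_imp_le le_trans less_le_trans zero_less_one)
    moreover have "s \<le> T div b" using \<open>b > 0\<close> p s by (simp add: less_eq_div_iff_mult_less_eq mult.commute)
    ultimately show "(case case p of (t, b) \<Rightarrow> (b, t div b) of (b, s) \<Rightarrow> (b * s, b)) = p"
      "(case p of (t, b) \<Rightarrow> (b, t div b)) \<in> (SIGMA b:{1..T}. {1..T div b})"
      "(case case p of (t, b) \<Rightarrow> (b, t div b) of (b, s) \<Rightarrow> F b (b * s)) = (case p of (t, b) \<Rightarrow> F b t)"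
      by (auto simp: p(1) s)
  next
    fix p assume "p \<in> (SIGMA b:{1..T}. {1..T div b})"
    then obtain b s where p: "p = (b, s)" "1 \<le> b" "b \<le> T" "1 \<le> s" "s \<le> T div b" by auto
    have "b * s \<le> T" using p by (simp add: less_eq_div_iff_mult_less_eq mult.commute)
    thus "(case case p of (b, s) \<Rightarrow> (b * s, b) of (t, b) \<Rightarrow> (b, t div b)) = p"
      "(case p of (b, s) \<Rightarrow> (b * s, b)) \<in> (SIGMA t:{1..T}. {b. b dvd t})"
      using p by auto
  qed
  also have "\<dots> = (\<Sum>b=1..T. \<Sum>s=1..T div b. F b (b * s))"
    by (subst sum.Sigma) auto
  finally show ?thesis .
qed

section \<open>Sequences supported on powers\<close>

locale power_supported =
  fixes r :: nat and \<gamma> :: "nat \<Rightarrow> complex" and x :: real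
  assumes r: "r \<ge> 1" and x: "x \<ge> 2"
    and \<gamma>_le: "\<And>l. l \<ge> 1 \<Longrightarrow> norm (\<gamma> l) \<le> 1"
    and \<gamma>_supp: "\<And>l. l \<ge> 1 \<Longrightarrow> (\<nexists>k. k > 0 \<and> l = k ^ r) \<Longrightarrow> \<gamma> l = 0"
begin

definition base_bound :: real where
  "base_bound = x powr (1 / (2 * real r))"

definition max_base :: nat where
  "max_base = nat \<lfloor>base_bound\<rfloor>"

definition height :: "nat \<Rightarrow> real" where
  "height t = sqrt (x - (real (t ^ r))^2)"

definition base_coeff :: "nat \<Rightarrow> complex" where
  "base_coeff t = (if real (t ^ r) < sqrt x then \<gamma> (t ^ r) else 0)"

lemma base_bound_power: "base_bound ^ r = sqrt x"
  using r x by (simp add: base_bound_def powr_half_sqrt flip: powr_realpow powr_powr) (simp add: powr_powr powr_half_sqrt)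

lemma power_less_sqrt_iff: "real (t ^ r) < sqrt x \<longleftrightarrow> real t < base_bound"
proof -
  have "base_bound \<ge> 0" by (simp add: base_bound_def)
  have "real t ^ r < base_bound ^ r \<longleftrightarrow> real t < base_bound"
    using r \<open>base_bound \<ge> 0\<close> by (metis linorder_not_less of_nat_0_le_iff power_mono power_strict_mono zero_less_one_class.zero_le_one less_le_trans zero_less_one)
  thus ?thesis by (simp add: base_bound_power)
qed

lemma power_le_sqrt: "real t \<le> base_bound \<Longrightarrow> real (t ^ r) \<le> sqrt x"
  using power_mono[of "real t" base_bound r] by (simp add: base_bound_power)

lemma le_max_base_iff: "t \<le> max_base \<longleftrightarrow> real t \<le> base_bound"
  unfolding max_base_def using le_nat_floor[of t base_bound] 
  by (metis base_bound_def le_nat_iff le_floor_iff of_int_of_nat_eq powr_ge_zero zero_le_floor)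

lemma height_nonneg:
  assumes "t \<le> max_base"
  shows "height t \<ge> 0"
proof -
  have "(real (t ^ r))^2 \<le> (sqrt x)^2"
    using assms by (intro power_mono power_le_sqrt) (auto simp: le_max_base_iff)
  thus ?thesis using x by (simp add: height_def)
qed

lemma \<gamma>_nonzero_imp_power: "l > 0 \<Longrightarrow> \<gamma> l \<noteq> 0 \<Longrightarrow> \<exists>t>0. l = t ^ r"
  using \<gamma>_supp[of l] by fastforce

section \<open>\<open>A_sum\<close> and \<open>M_main\<close> as sums over the base t\<close>

lemma A_sum_eq:
  assumes "d > 0"
  shows "A_sum \<gamma> d x = (\<Sum>t=1..max_base. base_coeff t * of_nat (card {m. 0 < m \<and> m \<le> nat \<lfloor>height t\<rfloor> \<and> d dvd (t ^ r)^2 + m^2 \<and> coprime (t ^ r) m}))"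
proof -
  define G where "G = {(l, m). l > 0 \<and> m > 0 \<and> real (l^2 + m^2) \<le> x \<and> d dvd l^2 + m^2 \<and> coprime l (m::nat)}"
  define N where "N = {n. n > 0 \<and> real n \<le> x \<and> d dvd n}"
  have finN: "finite N" unfolding N_def by (rule finite_A_sum_index)
  have G_eq: "G = (\<Union>n\<in>N. {(l, m). l > 0 \<and> m > 0 \<and> l^2 + m^2 = n \<and> coprime l m})"
    by (auto simp: G_def N_def)
  have finG: "finite G" unfolding G_eq using finN by (intro finite_UN_I finite_a_coeff_index)
  have "A_sum \<gamma> d x = (\<Sum>n\<in>N. \<Sum>p\<in>{p \<in> G. (fst p)^2 + (snd p)^2 = n}. \<gamma> (fst p))"
    unfolding A_sum_def N_def[symmetric] a_coeff_def
    by (intro sum.cong refl) (auto simp: G_def N_def case_prod_unfold)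
  also have "\<dots> = (\<Sum>p\<in>G. \<gamma> (fst p))"
    by (rule sum.group) (use finN finG in \<open>auto simp: G_def N_def\<close>)
  also have "\<dots> = (\<Sum>p\<in>{p \<in> G. \<exists>t>0. fst p = t ^ r}. \<gamma> (fst p))"
    using finG \<gamma>_nonzero_imp_power by (intro sum.mono_neutral_right) (auto simp: G_def)
  also have "\<dots> = (\<Sum>(t, m)\<in>(SIGMA t:{1..max_base}. {m. 0 < m \<and> real (t ^ r) < sqrt x \<and> m \<le> nat \<lfloor>height t\<rfloor> \<and> d dvd (t ^ r)^2 + m^2 \<and> coprime (t ^ r) m}). \<gamma> (t ^ r))"
  proof -
    define S where "S = (SIGMA t:{1..max_base}. {m. 0 < m \<and> real (t ^ r) < sqrt x \<and> m \<le> nat \<lfloor>height t\<rfloor> \<and> d dvd (t ^ r)^2 + m^2 \<and> coprime (t ^ r) m})"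
    define h where "h = (\<lambda>(t::nat, m::nat). (t ^ r, m))"
    \<comment> \<open>Positivity of m makes the bound for l strict, in agreement with the range in
      \<open>M_main\<close>. Conversely, strictness keeps the radicand positive.\<close>
    have key: "real (l^2 + m^2) \<le> x \<longleftrightarrow> real l < sqrt x \<and> m \<le> nat \<lfloor>sqrt (x - (real l)^2)\<rfloor>" if "m > 0" for l m
    proof
      assume *: "real (l^2 + m^2) \<le> x"
      have "0 < (real m)^2" using that by simp
      moreover have "(real l)^2 + (real m)^2 \<le> x" using * by simp
      ultimately have "(real l)^2 < x" by linarith
      hence 1: "real l < sqrt x" by (rule real_less_rsqrt)
      have "(real m)^2 \<le> x - (real l)^2" using * by simp
      hence "real m \<le> sqrt (x - (real l)^2)" by (rule real_le_rsqrt)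
      thus "real l < sqrt x \<and> m \<le> nat \<lfloor>sqrt (x - (real l)^2)\<rfloor>" using 1 by (simp add: le_nat_floor)
    next
      assume *: "real l < sqrt x \<and> m \<le> nat \<lfloor>sqrt (x - (real l)^2)\<rfloor>"
      hence "(real l)^2 < (sqrt x)^2" by (intro power_strict_mono) auto
      hence "(real l)^2 < x" using x by simp
      hence "real (nat \<lfloor>sqrt (x - (real l)^2)\<rfloor>) \<le> sqrt (x - (real l)^2)" by (intro of_nat_floor) simp
      hence "real m \<le> sqrt (x - (real l)^2)" using * by linarith
      hence "(real m)^2 \<le> (sqrt (x - (real l)^2))^2" by (intro power_mono) auto
      thus "real (l^2 + m^2) \<le> x" using \<open>(real l)^2 < x\<close> by simp
    qed
    have "{p \<in> G. \<exists>t>0. fst p = t ^ r} = h ` S"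
    proof (intro equalityI subsetI)
      fix p assume "p \<in> {p \<in> G. \<exists>t>0. fst p = t ^ r}"
      then obtain t m where p: "p = (t ^ r, m)" "t > 0" "(t ^ r, m) \<in> G" by (cases p) auto
      hence m: "m > 0" "real ((t ^ r)^2 + m^2) \<le> x" "d dvd (t ^ r)^2 + m^2" "coprime (t ^ r) m"
        by (auto simp: G_def)
      have m2: "real (t ^ r) < sqrt x" "m \<le> nat \<lfloor>height t\<rfloor>" using iffD1[OF key[OF m(1)] m(2)] unfolding height_def by blast+
      hence "t \<le> max_base" using power_less_sqrt_iff le_max_base_iff by simp
      hence "(t, m) \<in> S" using m m2 p by (simp add: S_def)
      thus "p \<in> h ` S" by (intro image_eqI[of _ _ "(t, m)"]) (auto simp: h_def p)
    next
      fix p assume "p \<in> h ` S"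
      then obtain t m where p: "p = (t ^ r, m)" "(t, m) \<in> S" by (auto simp: h_def)
      hence m: "t > 0" "m > 0" "real (t ^ r) < sqrt x" "m \<le> nat \<lfloor>height t\<rfloor>" "d dvd (t ^ r)^2 + m^2" "coprime (t ^ r) m"
        by (auto simp: S_def)
      have "real ((t ^ r)^2 + m^2) \<le> x" using key[OF m(2), of "t ^ r"] m(3,4) by (simp only: height_def)
      thus "p \<in> {p \<in> G. \<exists>t>0. fst p = t ^ r}" using m p by (auto simp: G_def)
    qed
    moreover have "inj_on h S"
      using r by (auto simp: inj_on_def h_def intro: power_eq_imp_eq_base)
    ultimately show ?thesis unfolding S_def[symmetric]
      by (simp add: sum.reindex case_prod_unfold h_def)
  qed
  also have "\<dots> = (\<Sum>t=1..max_base. \<Sum>m\<in>{m. 0 < m \<and> real (t ^ r) < sqrt x \<and> m \<le> nat \<lfloor>height t\<rfloor> \<and> d dvd (t ^ r)^2 + m^2 \<and> coprime (t ^ r) m}. \<gamma> (t ^ r))"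
    by (rule sum.Sigma[symmetric]) auto
  also have "\<dots> = (\<Sum>t=1..max_base. base_coeff t * of_nat (card {m. 0 < m \<and> m \<le> nat \<lfloor>height t\<rfloor> \<and> d dvd (t ^ r)^2 + m^2 \<and> coprime (t ^ r) m}))"
    by (intro sum.cong refl) (auto simp: base_coeff_def)
  finally show ?thesis .
qed

text \<open>Both the ratio of the totient and coprimality to d depend only on the primes dividing l,
  so they are the same for l = t^r and for t.\<close>

lemma M_main_eq:
  assumes "d > 0"
  shows "M_main \<gamma> d x = of_real (real (rho d) / real d) * (\<Sum>t=1..max_base. base_coeff t * of_real ((if coprime t d then real (totient t) / real t else 0) * height t))"
proof -
  define S where "S = {l. l > 0 \<and> real l < sqrt x \<and> coprime l d}"
  define F where "F l = \<gamma> l * of_real (real (totient l) / real l * sqrt (x - (real l)^2))" for l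
  define R where "R = {t\<in>{1..max_base}. real (t ^ r) < sqrt x \<and> coprime t d}"
  have finS: "finite S" unfolding S_def by (rule finite_M_main_index)
  have "(\<Sum>l\<in>S. F l) = (\<Sum>l\<in>{l \<in> S. \<exists>t>0. l = t ^ r}. F l)"
    using finS \<gamma>_nonzero_imp_power by (intro sum.mono_neutral_right) (auto simp: S_def F_def)
  also have "{l \<in> S. \<exists>t>0. l = t ^ r} = (\<lambda>t. t ^ r) ` R"
  proof (intro equalityI subsetI)
    fix l assume "l \<in> {l \<in> S. \<exists>t>0. l = t ^ r}"
    then obtain t where t: "l = t ^ r" "t > 0" "t ^ r \<in> S" by auto
    hence "t \<in> R" using r power_less_sqrt_iff[of t] le_max_base_iff[of t] by (auto simp: S_def R_def)
    thus "l \<in> (\<lambda>t. t ^ r) ` R" using t by blast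
  next
    fix l assume "l \<in> (\<lambda>t. t ^ r) ` R"
    then obtain t where t: "l = t ^ r" "t \<in> R" by blast
    hence "t > 0" "t ^ r \<in> S" by (auto simp: R_def S_def)
    thus "l \<in> {l \<in> S. \<exists>t>0. l = t ^ r}" using t by blast
  qed
  also have "(\<Sum>l\<in>(\<lambda>t. t ^ r) ` R. F l) = (\<Sum>t\<in>R. F (t ^ r))"
    using r by (subst sum.reindex) (auto simp: inj_on_def intro: power_eq_imp_eq_base)
  also have "\<dots> = (\<Sum>t=1..max_base. base_coeff t * of_real ((if coprime t d then real (totient t) / real t else 0) * height t))"
  proof -
    have "F (t ^ r) = base_coeff t * of_real ((if coprime t d then real (totient t) / real t else 0) * height t)" if "t \<in> R" for t
    proof -
      have "t > 0" using that by (auto simp: R_def)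
      have "real (totient (t ^ r)) / real (t ^ r) = real (totient t) / real t"
      proof -
        have "real (totient (t ^ r)) / real (t ^ r) = real (t ^ (r - 1) * totient t) / real (t ^ (r - 1) * t)"
        using r totient_power[of r t] by (cases r) (simp_all add: mult.commute)
        thus ?thesis using \<open>t > 0\<close> by simp
      qed
      thus ?thesis using that by (simp only: F_def base_coeff_def height_def R_def) simp
    qed
    hence "(\<Sum>t\<in>R. F (t ^ r)) = (\<Sum>t\<in>R. base_coeff t * of_real ((if coprime t d then real (totient t) / real t else 0) * height t))"
      by (intro sum.cong) auto
    also have "\<dots> = (\<Sum>t=1..max_base. base_coeff t * of_real ((if coprime t d then real (totient t) / real t else 0) * height t))"
      by (intro sum.mono_neutral_left) (auto simp: R_def base_coeff_def)
    finally show ?thesis .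
  qed
  finally show ?thesis by (simp add: M_main_def S_def F_def)
qed

text \<open>The bases are t = b s. In this definition \<open>d\<close> and \<open>\<nu>\<close>
  stand for a modulus and a root that are already reduced; \<open>error_sum\<close> inserts the
  reduction of the original pairs.\<close>

definition reduced_error :: "nat \<Rightarrow> nat \<Rightarrow> nat \<Rightarrow> real" where
  "reduced_error b d \<nu> = norm (\<Sum>s=1..max_base div b. base_coeff (b * s) * of_real
     (ap_count (nat \<lfloor>height (b * s) / real b\<rfloor>) (int \<nu> * int (b ^ (r - 1) * s ^ r)) d - 2 * (height (b * s) / real b) / real d))"

abbreviation error_sum :: "nat \<Rightarrow> nat \<Rightarrow> real" where
  "error_sum b d \<equiv> \<Sum>\<nu>\<in>sqrt_roots d. reduced_error b (d div gcd b d) (\<nu> mod (d div gcd b d))"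

text \<open>Count and main term are expanded over the same divisors b, so that their difference is,
  term by term, the error of a single progression modulo the reduced modulus.\<close>

lemma moebius_error:
  assumes "d > 0" "t \<in> {1..max_base}"
  shows "real (card {m::int. \<bar>m\<bar> \<le> int (nat \<lfloor>height t\<rfloor>) \<and> coprime m (int (t ^ r)) \<and> int d dvd m - int \<nu> * int (t ^ r)})
       - 2 * ((if coprime t d then real (totient t) / real t else 0) * height t) / real d
     = (\<Sum>b\<in>{b. b dvd t}. moebius b * (ap_count (nat \<lfloor>height t / real b\<rfloor>) (int (\<nu> mod (d div gcd b d)) * int (b ^ (r - 1) * (t div b) ^ r)) (d div gcd b d)
        - 2 * (height t / real b) / real (d div gcd b d)))"
proof -
  define M where "M = nat \<lfloor>height t\<rfloor>"
  define Z where "Z = {m::int. \<bar>m\<bar> \<le> int M \<and> int d dvd m - int \<nu> * int (t ^ r)}"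
  have finZ: "finite Z" by (rule finite_subset[of _ "{-int M..int M}"]) (auto simp: Z_def)
  have t0: "t > 0" "t \<le> max_base" using assms(2) by auto
  have cop: "coprime m (int (t ^ r)) \<longleftrightarrow> coprime m (int t)" for m using r by simp
  have "real (card {m::int. \<bar>m\<bar> \<le> int M \<and> coprime m (int (t ^ r)) \<and> int d dvd m - int \<nu> * int (t ^ r)})
      = real (card {m \<in> Z. coprime m (int t)})"
    unfolding cop Z_def by (intro arg_cong[of _ _ real] arg_cong[of _ _ card]) auto
  also have "\<dots> = (\<Sum>m\<in>Z. if coprime m (int t) then 1 else 0)"
    using finZ by (simp add: sum.If_cases Int_def)
  also have "\<dots> = (\<Sum>m\<in>Z. \<Sum>b\<in>{b. b dvd t}. moebius b * (if int b dvd m then 1 else 0))"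
    by (simp only: sum_moebius_coprime[OF t0(1)])
  also have "\<dots> = (\<Sum>b\<in>{b. b dvd t}. \<Sum>m\<in>Z. moebius b * (if int b dvd m then 1 else 0))"
    by (rule sum.swap)
  also have "\<dots> = (\<Sum>b\<in>{b. b dvd t}. moebius b * real (card {m::int. \<bar>m\<bar> \<le> int M \<and> int b dvd m \<and> int d dvd m - int \<nu> * int (t ^ r)}))"
  proof (intro sum.cong refl)
    fix b
    have "{m \<in> Z. int b dvd m} = {m::int. \<bar>m\<bar> \<le> int M \<and> int b dvd m \<and> int d dvd m - int \<nu> * int (t ^ r)}"
      by (auto simp: Z_def)
    thus "(\<Sum>m\<in>Z. moebius b * (if int b dvd m then 1 else 0)) = moebius b * real (card {m::int. \<bar>m\<bar> \<le> int M \<and> int b dvd m \<and> int d dvd m - int \<nu> * int (t ^ r)})"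
      using finZ by (simp add: sum.If_cases Int_def flip: sum_distrib_left)
  qed
  also have "\<dots> = (\<Sum>b\<in>{b. b dvd t}. moebius b * ap_count (nat \<lfloor>height t / real b\<rfloor>) (int (\<nu> mod (d div gcd b d)) * int (b ^ (r - 1) * (t div b) ^ r)) (d div gcd b d))"
  proof (intro sum.cong refl)
    fix b assume "b \<in> {b. b dvd t}"
    hence b: "b * (t div b) = t" "b > 0" using t0 by (auto intro: Nat.gr0I)
    have "M div b = nat \<lfloor>height t / real b\<rfloor>"
      unfolding M_def using height_nonneg[OF t0(2)] floor_divide_real_eq_div[of "int b" "height t"]
      by (simp add: nat_div_distrib)
    thus "moebius b * real (card {m::int. \<bar>m\<bar> \<le> int M \<and> int b dvd m \<and> int d dvd m - int \<nu> * int (t ^ r)}) = 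
        moebius b * ap_count (nat \<lfloor>height t / real b\<rfloor>) (int (\<nu> mod (d div gcd b d)) * int (b ^ (r - 1) * (t div b) ^ r)) (d div gcd b d)"
      using card_multiples_in_progression[OF b(2) assms(1) r, of M \<nu> "t div b"] by (simp only: b(1))
  qed
  finally have 1: "real (card {m::int. \<bar>m\<bar> \<le> int M \<and> coprime m (int (t ^ r)) \<and> int d dvd m - int \<nu> * int (t ^ r)}) = \<dots>" .
  have "2 * ((if coprime t d then real (totient t) / real t else 0) * height t) / real d
     = (\<Sum>b\<in>{b. b dvd t}. moebius b * (real (gcd b d) / real b)) * (2 * height t / real d)"
    by (subst sum_moebius_gcd[OF t0(1) assms(1)]) simp
  also have "\<dots> = (\<Sum>b\<in>{b. b dvd t}. moebius b * (2 * (height t / real b) / real (d div gcd b d)))"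
    unfolding sum_distrib_right
  proof (intro sum.cong refl)
    fix b
    have "gcd b d > 0" using assms(1) by simp
    have "real (d div gcd b d) = real d / real (gcd b d)" by (simp add: real_of_nat_div)
    thus "moebius b * (real (gcd b d) / real b) * (2 * height t / real d) = moebius b * (2 * (height t / real b) / real (d div gcd b d))"
      by simp
  qed
  finally show ?thesis using 1 by (simp add: M_def right_diff_distrib sum_subtractf)
qed

text \<open>The factor 2 comes from counting m of both signs, and the extra 1 for d = 1 from m = 0.
  Only squarefree b survive, with weight of modulus 1.\<close>

lemma norm_A_minus_M_le:
  assumes "d > 0"
  shows "2 * norm (A_sum \<gamma> d x - M_main \<gamma> d x) \<le>
     (if d = 1 then 1 else 0) + (\<Sum>b\<in>{b \<in> {1..max_base}. squarefree b}. error_sum b d)"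
proof -
  define C where "C t \<nu> = card {m::int. \<bar>m\<bar> \<le> int (nat \<lfloor>height t\<rfloor>) \<and> coprime m (int (t ^ r)) \<and> int d dvd m - int \<nu> * int (t ^ r)}" for t \<nu>
  define P where "P t = card {m. 0 < m \<and> m \<le> nat \<lfloor>height t\<rfloor> \<and> d dvd (t ^ r)^2 + m^2 \<and> coprime (t ^ r) m}" for t
  define \<phi> where "\<phi> t = (if coprime t d then real (totient t) / real t else 0) * height t" for t
  define \<delta> where "\<delta> t = (if d = 1 \<and> t ^ r = 1 then 1 else 0 :: complex)" for t :: nat
  define Q where "Q b t \<nu> = moebius b * (ap_count (nat \<lfloor>height t / real b\<rfloor>) (int (\<nu> mod (d div gcd b d)) * int (b ^ (r - 1) * (t div b) ^ r)) (d div gcd b d)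
        - 2 * (height t / real b) / real (d div gcd b d))" for b t \<nu>
  have C: "(\<Sum>\<nu>\<in>sqrt_roots d. of_nat (C t \<nu>)) = 2 * of_nat (P t) + \<delta> t" if "t \<in> {1..max_base}" for t
  proof -
    have "t ^ r > 0" using that by simp
    from sum_card_roots_progression[OF assms this, of "nat \<lfloor>height t\<rfloor>"]
    have *: "(\<Sum>\<nu>\<in>sqrt_roots d. C t \<nu>) = 2 * P t + (if d = 1 \<and> t ^ r = 1 then 1 else 0)"
      by (simp only: C_def P_def)
    have "(\<Sum>\<nu>\<in>sqrt_roots d. of_nat (C t \<nu>)) = complex_of_nat (\<Sum>\<nu>\<in>sqrt_roots d. C t \<nu>)" by simp
    also have "\<dots> = 2 * of_nat (P t) + \<delta> t" unfolding * by (simp add: \<delta>_def)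
    finally show ?thesis .
  qed
  have "2 * (A_sum \<gamma> d x - M_main \<gamma> d x) + (\<Sum>t=1..max_base. base_coeff t * \<delta> t)
      = (\<Sum>t=1..max_base. base_coeff t * (2 * of_nat (P t) + \<delta> t)) - (\<Sum>t=1..max_base. base_coeff t * of_real (real (rho d) * (2 * \<phi> t / real d)))"
    unfolding A_sum_eq[OF assms] M_main_eq[OF assms] P_def[symmetric] \<phi>_def[symmetric]
    by (simp add: algebra_simps sum.distrib sum_distrib_left)
  also have "\<dots> = (\<Sum>t=1..max_base. base_coeff t * (2 * of_nat (P t) + \<delta> t) - base_coeff t * of_real (real (rho d) * (2 * \<phi> t / real d)))"
    by (simp add: sum_subtractf)
  also have "\<dots> = (\<Sum>t=1..max_base. \<Sum>\<nu>\<in>sqrt_roots d. base_coeff t * of_real (real (C t \<nu>) - 2 * \<phi> t / real d))"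
  proof (intro sum.cong refl)
    fix t assume t: "t \<in> {1..max_base}"
    have "(\<Sum>\<nu>\<in>sqrt_roots d. base_coeff t * of_real (real (C t \<nu>) - 2 * \<phi> t / real d))
      = base_coeff t * ((\<Sum>\<nu>\<in>sqrt_roots d. of_nat (C t \<nu>)) - (\<Sum>\<nu>\<in>sqrt_roots d. of_real (2 * \<phi> t / real d)))"
      by (simp add: sum_distrib_left right_diff_distrib sum_subtractf)
    thus "base_coeff t * (2 * of_nat (P t) + \<delta> t) - base_coeff t * of_real (real (rho d) * (2 * \<phi> t / real d)) = 
        (\<Sum>\<nu>\<in>sqrt_roots d. base_coeff t * of_real (real (C t \<nu>) - 2 * \<phi> t / real d))"
      unfolding C[OF t] by (simp add: rho_eq_card right_diff_distrib)
  qed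
  also have "\<dots> = (\<Sum>\<nu>\<in>sqrt_roots d. \<Sum>t=1..max_base. base_coeff t * of_real (real (C t \<nu>) - 2 * \<phi> t / real d))"
    by (rule sum.swap)
  also have "\<dots> = (\<Sum>\<nu>\<in>sqrt_roots d. \<Sum>t=1..max_base. \<Sum>b\<in>{b. b dvd t}. base_coeff t * of_real (Q b t \<nu>))"
  proof (intro sum.cong refl)
    fix \<nu> t assume "t \<in> {1..max_base}"
    from moebius_error[OF assms this, of \<nu>]
    have "real (C t \<nu>) - 2 * \<phi> t / real d = (\<Sum>b\<in>{b. b dvd t}. Q b t \<nu>)"
      by (simp only: C_def \<phi>_def Q_def)
    thus "base_coeff t * of_real (real (C t \<nu>) - 2 * \<phi> t / real d) = (\<Sum>b\<in>{b. b dvd t}. base_coeff t * of_real (Q b t \<nu>))"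
      by (simp only: of_real_sum sum_distrib_left)
  qed
  also have "\<dots> = (\<Sum>\<nu>\<in>sqrt_roots d. \<Sum>b=1..max_base. \<Sum>s=1..max_base div b. base_coeff (b * s) * of_real (Q b (b * s) \<nu>))"
    by (simp only: sum_atLeastAtMost_divisors)
  finally have eq: "2 * (A_sum \<gamma> d x - M_main \<gamma> d x) + (\<Sum>t=1..max_base. base_coeff t * \<delta> t) = \<dots>" .
  have E: "norm (\<Sum>s=1..max_base div b. base_coeff (b * s) * of_real (Q b (b * s) \<nu>)) \<le> 
      (if squarefree b then reduced_error b (d div gcd b d) (\<nu> mod (d div gcd b d)) else 0)" if b: "b \<in> {1..max_base}" for b \<nu>
  proof -
    have "(\<Sum>s=1..max_base div b. base_coeff (b * s) * of_real (Q b (b * s) \<nu>)) = of_real (moebius b) * (\<Sum>s=1..max_base div b. base_coeff (b * s) * of_real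
     (ap_count (nat \<lfloor>height (b * s) / real b\<rfloor>) (int (\<nu> mod (d div gcd b d)) * int (b ^ (r - 1) * s ^ r)) (d div gcd b d) - 2 * (height (b * s) / real b) / real (d div gcd b d)))"
      unfolding sum_distrib_left using b by (intro sum.cong refl) (simp add: Q_def)
    hence "norm (\<Sum>s=1..max_base div b. base_coeff (b * s) * of_real (Q b (b * s) \<nu>)) = \<bar>moebius b\<bar> * reduced_error b (d div gcd b d) (\<nu> mod (d div gcd b d))"
      by (simp only: norm_mult norm_of_real reduced_error_def)
    also have "\<bar>moebius b\<bar> = (if squarefree b then 1 else 0)" by (simp add: moebius_def power_abs)
    finally show ?thesis by simp
  qed
  have "norm (\<Sum>t=1..max_base. base_coeff t * \<delta> t) \<le> (if d = 1 then 1 else 0)"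
  proof -
    have "(\<Sum>t=1..max_base. base_coeff t * \<delta> t) = (\<Sum>t\<in>{1..max_base} \<inter> {1}. base_coeff t * \<delta> t)"
      using r by (intro sum.mono_neutral_right) (auto simp: \<delta>_def)
    moreover have "norm (base_coeff 1) \<le> 1" using \<gamma>_le[of 1] by (simp add: base_coeff_def)
    ultimately show ?thesis by (cases "1 \<le> max_base") (auto simp: \<delta>_def)
  qed
  moreover have "2 * norm (A_sum \<gamma> d x - M_main \<gamma> d x) = norm ((2 * (A_sum \<gamma> d x - M_main \<gamma> d x) + (\<Sum>t=1..max_base. base_coeff t * \<delta> t)) - (\<Sum>t=1..max_base. base_coeff t * \<delta> t))"
    by (simp only: add_diff_cancel_right' norm_mult norm_numeral)
  moreover have "\<dots> \<le> norm (2 * (A_sum \<gamma> d x - M_main \<gamma> d x) + (\<Sum>t=1..max_base. base_coeff t * \<delta> t)) + norm (\<Sum>t=1..max_base. base_coeff t * \<delta> t)"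
    by (rule norm_triangle_ineq4)
  moreover have "norm (2 * (A_sum \<gamma> d x - M_main \<gamma> d x) + (\<Sum>t=1..max_base. base_coeff t * \<delta> t)) \<le> 
      (\<Sum>b\<in>{b \<in> {1..max_base}. squarefree b}. error_sum b d)"
  proof -
    have "norm (2 * (A_sum \<gamma> d x - M_main \<gamma> d x) + (\<Sum>t=1..max_base. base_coeff t * \<delta> t)) \<le>
        (\<Sum>\<nu>\<in>sqrt_roots d. \<Sum>b=1..max_base. norm (\<Sum>s=1..max_base div b. base_coeff (b * s) * of_real (Q b (b * s) \<nu>)))"
      unfolding eq by (intro order.trans[OF norm_sum] sum_mono norm_sum)
    also have "\<dots> \<le> (\<Sum>\<nu>\<in>sqrt_roots d. \<Sum>b=1..max_base. if squarefree b then reduced_error b (d div gcd b d) (\<nu> mod (d div gcd b d)) else 0)"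
      by (intro sum_mono E)
    also have "\<dots> = (\<Sum>\<nu>\<in>sqrt_roots d. \<Sum>b\<in>{b \<in> {1..max_base}. squarefree b}. reduced_error b (d div gcd b d) (\<nu> mod (d div gcd b d)))"
      by (intro sum.cong refl sum.inter_filter[symmetric]) auto
    also have "\<dots> = (\<Sum>b\<in>{b \<in> {1..max_base}. squarefree b}. error_sum b d)"
      by (rule sum.swap)
    finally show ?thesis .
  qed
  ultimately show ?thesis by linarith
qed

section \<open>Choice of the smoothing width and final summation\<close>

lemma sqrt_times_base_bound: "sqrt x * base_bound = x powr ((real r + 1) / (2 * real r))"
proof -
  have "sqrt x * base_bound = x powr (1 / 2 + 1 / (2 * real r))"
    using x by (simp add: base_bound_def powr_add powr_half_sqrt)
  also have "1 / 2 + 1 / (2 * real r) = (real r + 1) / (2 * real r)"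
    using r by (simp add: field_simps)
  finally show ?thesis .
qed

lemma base_bound_bounds: "1 \<le> base_bound" "base_bound \<le> sqrt x"
proof -
  show 1: "1 \<le> base_bound" unfolding base_bound_def using x by (intro ge_one_powr_ge_zero) auto
  have "base_bound ^ 1 \<le> base_bound ^ r" using 1 r by (intro power_increasing) auto
  thus "base_bound \<le> sqrt x" by (simp add: base_bound_power)
qed

lemma norm_base_coeff_le: "t \<ge> 1 \<Longrightarrow> norm (base_coeff t) \<le> 1"
  using \<gamma>_le[of "t ^ r"] by (simp add: base_coeff_def)

text \<open>For fixed b both the number T of bases and the length P shrink by the factor b, so D T P
  is at most D X / b^2 and its square root gains 1 / b. In the smoothing error T w the gain comes
  from T alone. The constant is 600000 + 2 * 104.\<close>

lemma sum_reduced_error_le: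
  assumes K: "x < 2 ^ K" and D: "sqrt x \<le> D" "D \<le> sqrt x * base_bound" and b: "b \<in> {1..max_base}"
  defines "Y \<equiv> D powr (1/4) * (sqrt x * base_bound) powr (3/4)"
  shows "(\<Sum>d\<in>moduli D. \<Sum>\<nu>\<in>sqrt_roots d. reduced_error b d \<nu>) \<le> 600208 * (real K + 2) ^ 4 * Y / real b"
    and "1 \<le> Y"
proof -
  define X where "X = sqrt x * base_bound"
  define \<eta> where "\<eta> = (D / X) powr (1/4)"
  define L where "L = real K + 2"
  have sx: "sqrt x \<ge> 1" using x by simp
  have D1: "D \<ge> 1" using D sx by linarith
  have X: "X \<ge> D" "X > 0" using D D1 by (auto simp: X_def)
  have X_le: "X \<le> sqrt x * sqrt x" unfolding X_def using base_bound_bounds sx by (intro mult_left_mono) auto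
  have "sqrt x * sqrt x = x" using x by simp
  have \<eta>: "0 < \<eta>" "\<eta> \<le> 1" using X D1 by (auto simp: \<eta>_def intro!: powr_le1)
  have \<eta>4: "\<eta> ^ 4 = D / X" using X D1 by (simp add: \<eta>_def powr_powr flip: powr_realpow)
  have \<eta>X: "\<eta> * X = Y"
  proof -
    have "\<eta> * X = D powr (1/4) / X powr (1/4) * X powr 1" using X D1 by (simp add: \<eta>_def powr_divide)
    also have "\<dots> = D powr (1/4) * (X powr 1 / X powr (1/4))" by simp
    also have "X powr 1 / X powr (1/4) = X powr (1 - 1/4)" by (rule powr_diff[symmetric])
    finally show ?thesis by (simp add: Y_def X_def)
  qed
  have DX: "sqrt (D * X) / \<eta> = Y"
  proof -
    have "(\<eta> * Y)^2 = \<eta> ^ 4 * X^2" unfolding \<eta>X[symmetric] by (simp add: power2_eq_square eval_nat_numeral)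
    also have "\<dots> = D * X" unfolding \<eta>4 using X by (simp add: power2_eq_square)
    finally have "sqrt (D * X) = \<eta> * Y" using \<eta> X by (intro real_sqrt_unique) (auto simp flip: \<eta>X)
    thus ?thesis using \<eta> by simp
  qed
  \<comment> \<open>This uses the lower bound on D: since X <= x, D / X is at least 1 / sqrt x, and
    \<eta> >= \<eta>^4 = D / X. Hence \<eta> sqrt x >= 1 and \<open>base_bound\<close> is at most Y,
    which later absorbs the rounding of \<open>w\<close>.\<close>
  have "1 / sqrt x = sqrt x / (sqrt x * sqrt x)"
    using sx by (metis divide_divide_eq_left divide_self_if not_one_le_zero)
  also have "\<dots> \<le> D / X" using X X_le D D1 by (intro frac_le) linarith+
  also have "\<dots> \<le> \<eta>" unfolding \<eta>4[symmetric] using power_decreasing[of 1 4 \<eta>] \<eta> by simp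
  finally have "1 \<le> \<eta> * sqrt x" using sx by (simp add: field_simps)
  hence "1 * base_bound \<le> \<eta> * sqrt x * base_bound" using base_bound_bounds by (intro mult_right_mono) auto
  hence L0Y: "base_bound \<le> Y" unfolding \<eta>X[symmetric] X_def by simp
  thus Y1: "1 \<le> Y" using base_bound_bounds by linarith
  have b0: "b \<ge> 1" "real b \<le> base_bound" using b by (auto simp: le_max_base_iff)
  define P where "P = nat \<lfloor>sqrt x / real b\<rfloor>"
  define T where "T = max_base div b"
  \<comment> \<open>Rounding up gives P / w <= 1 / \<eta> and w >= 1 even when \<eta> P is below
    1.\<close>
  define w where "w = nat \<lceil>\<eta> * real P\<rceil>"
  have "sqrt x / real b \<ge> 1" using b0 base_bound_bounds by simp
  hence P1: "P \<ge> 1" by (simp add: P_def le_nat_iff le_floor_iff)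
  have P_le: "real P \<le> sqrt x / real b" using x unfolding P_def by (intro of_nat_floor) auto
  have "real T \<le> real max_base / real b" unfolding T_def by (rule of_nat_div_le_of_nat)
  also have "\<dots> \<le> base_bound / real b" using le_max_base_iff[of max_base] by (intro divide_right_mono) auto
  finally have T_le: "real T \<le> base_bound / real b" .
  have w_ge: "\<eta> * real P \<le> real w" unfolding w_def by (rule real_nat_ceiling_ge)
  have "\<eta> * real P > 0" using \<eta> P1 by simp
  hence w_le: "real w \<le> \<eta> * real P + 1" unfolding w_def by linarith
  have w1: "w \<ge> 1" using w_ge \<open>\<eta> * real P > 0\<close> by (cases w) auto
  have "\<eta> * real P \<le> real P" using \<eta> by (simp add: mult_left_le_one_le)
  hence wP: "w \<le> 2 * P" unfolding w_def by (simp add: nat_le_iff ceiling_le_iff)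
  have L0K: "base_bound < 2 ^ K" "D < 2 ^ K"
  proof -
    have "sqrt x \<le> x" using sx mult_right_mono[of 1 "sqrt x" "sqrt x"] \<open>sqrt x * sqrt x = x\<close> by simp
    thus "base_bound < 2 ^ K" using base_bound_bounds K by linarith
    show "D < 2 ^ K" using X X_le \<open>sqrt x * sqrt x = x\<close> K by linarith
  qed
  have TK: "T < 2 ^ K"
  proof -
    have "T \<le> max_base" by (simp add: T_def)
    hence "real T < 2 ^ K" using L0K le_max_base_iff[of T] by linarith
    hence "real T < real (2 ^ K)" by (simp only: of_nat_power of_nat_numeral)
    thus ?thesis by (simp only: of_nat_less_iff)
  qed
  have bt: "b * t \<le> max_base" if "t \<in> {1..T}" for t
    using that b0 by (simp add: T_def less_eq_div_iff_mult_less_eq mult.commute)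
  have "(\<Sum>d\<in>moduli D. \<Sum>\<nu>\<in>sqrt_roots d. reduced_error b d \<nu>)
     \<le> 600000 * (real K + 2) ^ 4 * (sqrt (D * real T * real P) * (real P / real w)) + 104 * (real K + 2)^2 * real T * real w"
    unfolding reduced_error_def T_def[symmetric]
  proof (rule ap_count_sum_bound)
    show "b ^ (r - 1) * t ^ r \<le> P" if t: "t \<in> {1..T}" for t
    proof -
      have "real b * real (b ^ (r - 1) * t ^ r) = real ((b * t) ^ r)"
        using r by (cases r) (simp_all add: power_mult_distrib)
      also have "\<dots> \<le> sqrt x" using bt[OF t] by (intro power_le_sqrt) (simp only: le_max_base_iff)
      finally have "real (b ^ (r - 1) * t ^ r) \<le> sqrt x / real b" using b0 by (simp only: field_simps)
      thus ?thesis unfolding P_def by (rule le_nat_floor)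
    qed
    show "0 \<le> height (b * t) / real b" if "t \<in> {1..T}" for t using height_nonneg[OF bt[OF that]] by simp
    show "nat \<lfloor>height (b * t) / real b\<rfloor> \<le> P" if "t \<in> {1..T}" for t
      unfolding P_def height_def by (intro nat_mono floor_mono divide_right_mono real_sqrt_le_mono) auto
    show "norm (base_coeff (b * t)) \<le> 1" if "t \<in> {1..T}" for t using that b0 by (intro norm_base_coeff_le) simp
  qed (use TK L0K D1 b0 r P1 w1 wP in auto)
  also have "\<dots> \<le> 600000 * L ^ 4 * (Y / real b) + 104 * L ^ 4 * (2 * (Y / real b))"
  proof (intro add_mono)
    have "D * real T * real P \<le> D * (base_bound / real b) * (sqrt x / real b)"
      using T_le P_le D1 base_bound_bounds by (intro mult_mono mult_nonneg_nonneg) auto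
    also have "\<dots> = D * X / (real b)^2" by (simp add: X_def power2_eq_square)
    finally have "sqrt (D * real T * real P) \<le> sqrt (D * X / (real b)^2)" by (rule real_sqrt_le_mono)
    also have "\<dots> = sqrt (D * X) / real b" by (simp add: real_sqrt_divide)
    finally have s: "sqrt (D * real T * real P) \<le> sqrt (D * X) / real b" .
    have "real P / real w \<le> 1 / \<eta>" using w_ge w1 \<eta> by (simp add: field_simps)
    hence "sqrt (D * real T * real P) * (real P / real w) \<le> sqrt (D * X) / real b * (1 / \<eta>)"
      using s X D1 by (intro mult_mono) auto
    also have "\<dots> = Y / real b" unfolding DX[symmetric] by simp
    finally show "600000 * (real K + 2) ^ 4 * (sqrt (D * real T * real P) * (real P / real w)) \<le> 600000 * L ^ 4 * (Y / real b)"
      unfolding L_def by (intro mult_left_mono) auto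
    have "real T * real w \<le> base_bound / real b * (\<eta> * sqrt x + 1)"
    proof (intro mult_mono T_le)
      have "real P \<le> sqrt x / real b" by (rule P_le)
      also have "\<dots> \<le> sqrt x / 1" using b0 x by (intro divide_left_mono) auto
      finally have "\<eta> * real P \<le> \<eta> * sqrt x" using \<eta> by simp
      thus "real w \<le> \<eta> * sqrt x + 1" using w_le by linarith
    qed (use base_bound_bounds in auto)
    also have "\<dots> = (\<eta> * X + base_bound) / real b" by (simp add: X_def field_simps)
    also have "\<dots> \<le> (Y + Y) / real b" using L0Y \<eta>X by (intro divide_right_mono add_mono) auto
    finally have TD: "real T * real w \<le> 2 * (Y / real b)" by simp
    have "104 * (real K + 2)^2 * real T * real w = 104 * L\<^sup>2 * (real T * real w)" by (simp add: L_def)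
    also have "\<dots> \<le> 104 * L ^ 4 * (2 * (Y / real b))"
      by (intro mult_mono TD power_increasing) (auto simp: L_def)
    finally show "104 * (real K + 2)^2 * real T * real w \<le> 104 * L ^ 4 * (2 * (Y / real b))" .
  qed
  also have "\<dots> = 600208 * L ^ 4 * Y / real b" by simp
  finally show "(\<Sum>d\<in>moduli D. \<Sum>\<nu>\<in>sqrt_roots d. reduced_error b d \<nu>) \<le> 600208 * (real K + 2) ^ 4 * Y / real b"
    by (simp add: L_def)
qed

text \<open>Of the eight factors \<open>real K + 2\<close>, four come from the bound for a fixed b
  and four from summing the squared divisor function over b, which counts the fibres of the
  reduction. The contribution of m = 0 is absorbed because Y >= 1.\<close>

lemma sum_norm_A_minus_M_le:
  assumes K: "x < 2 ^ K" and D: "sqrt x \<le> D" "D \<le> sqrt x * base_bound"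
  shows "(\<Sum>d\<in>moduli D. norm (A_sum \<gamma> d x - M_main \<gamma> d x))
    \<le> 10 ^ 6 * (real K + 2) ^ 8 * (D powr (1/4) * (sqrt x * base_bound) powr (3/4))"
proof -
  define Y where "Y = D powr (1/4) * (sqrt x * base_bound) powr (3/4)"
  define L where "L = real K + 2"
  define Ds where "Ds = moduli D"
  have finD: "finite Ds" unfolding Ds_def by (rule finite_modulus_index)
  have T01: "max_base \<ge> 1" using base_bound_bounds le_max_base_iff[of 1] by simp
  have T0K: "max_base < 2 ^ K"
  proof -
    have "real max_base \<le> base_bound" using le_max_base_iff[of max_base] by simp
    also have "base_bound \<le> sqrt x" by (rule base_bound_bounds)
    also have "\<dots> \<le> x" using x by (intro real_le_lsqrt) (auto simp: power2_eq_square)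
    finally have "real max_base < 2 ^ K" using K by linarith
    hence "real max_base < real (2 ^ K)" by (simp only: of_nat_power of_nat_numeral)
    thus ?thesis by (simp only: of_nat_less_iff)
  qed
  have Y1: "Y \<ge> 1" using sum_reduced_error_le(2)[OF K D, of 1] T01 by (simp add: Y_def)
  have "2 * (\<Sum>d\<in>Ds. norm (A_sum \<gamma> d x - M_main \<gamma> d x)) = (\<Sum>d\<in>Ds. 2 * norm (A_sum \<gamma> d x - M_main \<gamma> d x))"
    by (simp add: sum_distrib_left)
  also have "\<dots> \<le> (\<Sum>d\<in>Ds. (if d = 1 then 1 else 0) + (\<Sum>b\<in>{b \<in> {1..max_base}. squarefree b}. error_sum b d))"
    by (intro sum_mono norm_A_minus_M_le) (auto simp: Ds_def)
  also have "\<dots> = (\<Sum>d\<in>Ds. if d = 1 then 1 else 0) + (\<Sum>b\<in>{b \<in> {1..max_base}. squarefree b}. \<Sum>d\<in>Ds. error_sum b d)"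
    unfolding sum.distrib by (intro arg_cong2[of _ _ _ _ "(+)"] refl sum.swap)
  also have "\<dots> \<le> 1 + (\<Sum>b\<in>{b \<in> {1..max_base}. squarefree b}. (real (num_divs b))^2 * (600208 * L ^ 4 * Y / real b))"
  proof (intro add_mono sum_mono)
    show "(\<Sum>d\<in>Ds. if d = 1 then 1 else 0) \<le> (1::real)" using finD by (simp add: sum.delta)
    fix b assume b: "b \<in> {b \<in> {1..max_base}. squarefree b}"
    have "(\<Sum>d\<in>Ds. error_sum b d)
      \<le> (real (num_divs b))^2 * (\<Sum>d\<in>Ds. \<Sum>\<nu>\<in>sqrt_roots d. reduced_error b d \<nu>)"
      unfolding Ds_def using b by (intro sum_reduced_roots_le) (auto simp: reduced_error_def)
    also have "\<dots> \<le> (real (num_divs b))^2 * (600208 * L ^ 4 * Y / real b)"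
      unfolding Ds_def L_def Y_def using b by (intro mult_left_mono sum_reduced_error_le(1) K D) auto
    finally show "(\<Sum>d\<in>Ds. error_sum b d) \<le> (real (num_divs b))^2 * (600208 * L ^ 4 * Y / real b)" .
  qed
  also have "(\<Sum>b\<in>{b \<in> {1..max_base}. squarefree b}. (real (num_divs b))^2 * (600208 * L ^ 4 * Y / real b)) \<le> 
      (\<Sum>b=1..max_base. (real (num_divs b))^2 * (600208 * L ^ 4 * Y / real b))"
    using Y1 by (intro sum_mono2) auto
  also have "\<dots> = 600208 * L ^ 4 * Y * (\<Sum>b=1..max_base. (real (num_divs b))^2 / real b)"
    unfolding sum_distrib_left by (intro sum.cong refl) simp
  also have "\<dots> \<le> 600208 * L ^ 4 * Y * L ^ 4"
  proof (intro mult_left_mono)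
    have "(\<Sum>b=1..max_base. (real (num_divs b))^2 / real b) \<le> real K ^ 4" by (rule sum_num_divs_le(2)[OF T0K])
    also have "\<dots> \<le> L ^ 4" by (intro power_mono) (auto simp: L_def)
    finally show "(\<Sum>b=1..max_base. (real (num_divs b))^2 / real b) \<le> L ^ 4" .
  qed (use Y1 in auto)
  also have "1 + 600208 * L ^ 4 * Y * L ^ 4 = 1 + 600208 * (L ^ 8 * Y)" by (simp flip: power_add)
  also have "\<dots> \<le> L ^ 8 * Y + 600208 * (L ^ 8 * Y)"
  proof (intro add_right_mono)
    have "1 * 1 \<le> L ^ 8 * Y" using Y1 by (intro mult_mono one_le_power) (auto simp: L_def)
    thus "1 \<le> L ^ 8 * Y" by simp
  qed
  also have "\<dots> \<le> 2 * (10 ^ 6 * (L ^ 8 * Y))" using Y1 by (simp add: L_def)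
  finally show ?thesis by (simp add: Ds_def Y_def L_def mult_ac)
qed

end

theorem theorem6p1:
  fixes r :: nat
  assumes "r \<ge> 1"
  shows "\<exists>C > (0::real). \<forall>(\<gamma> :: nat \<Rightarrow> complex) (x::real) (D::real).
     (\<forall>l\<ge>1. norm (\<gamma> l) \<le> 1) \<longrightarrow>
     (\<forall>l\<ge>1. (\<nexists>k. k > 0 \<and> l = k ^ r) \<longrightarrow> \<gamma> l = 0) \<longrightarrow>
     x \<ge> 2 \<longrightarrow> sqrt x \<le> D \<longrightarrow> D \<le> x powr ((real r + 1) / (2 * real r)) \<longrightarrow>
     (\<Sum>d \<in> {d. d > 0 \<and> real d \<le> D}. norm (A_sum \<gamma> d x - M_main \<gamma> d x))
       \<le> C * (D powr (1/4) * x powr (3 * (real r + 1) / (8 * real r)) * (ln x) powr 65.25)"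
proof (intro exI conjI allI impI)
  show "(10 ^ 6 * (5 ^ 8 * 2 powr 65.25) :: real) > 0" by simp
  fix \<gamma> :: "nat \<Rightarrow> complex" and x D :: real
  assume \<gamma>: "\<forall>l\<ge>1. norm (\<gamma> l) \<le> 1" "\<forall>l\<ge>1. (\<nexists>k. k > 0 \<and> l = k ^ r) \<longrightarrow> \<gamma> l = 0"
    and x: "x \<ge> 2" and D: "sqrt x \<le> D" "D \<le> x powr ((real r + 1) / (2 * real r))"
  interpret power_supported r \<gamma> x
    using assms \<gamma> x by unfold_locales auto
  define K where "K = nat \<lceil>log 2 x\<rceil> + 1"
  have lx: "ln x \<ge> 1 / 2"
  proof -
    have "ln x \<ge> ln 2" using x by simp
    thus ?thesis using ln2_ge_two_thirds by linarith
  qed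
  have log0: "log 2 x \<ge> 0" using x by simp
  have "x = 2 powr (log 2 x)" using x by simp
  also have "\<dots> < 2 powr real K"
    unfolding K_def by (intro powr_less_mono) linarith+
  also have "\<dots> = 2 ^ K" by (simp add: powr_realpow)
  finally have xK: "x < 2 ^ K" .
  have "real K + 2 \<le> log 2 x + 4" unfolding K_def using log0 by linarith
  also have "log 2 x \<le> 2 * ln x"
  proof -
    have "log 2 x = ln x / ln 2" by (simp add: log_def)
    also have "\<dots> \<le> ln x / (1 / 2)" using lx ln2_ge_two_thirds by (intro divide_left_mono) auto
    finally show ?thesis by simp
  qed
  \<comment> \<open>Here 4 <= 8 ln x because ln x >= 1 / 2.\<close>
  finally have "real K + 2 \<le> 5 * (2 * ln x)" using lx by linarith
  hence "(real K + 2) ^ 8 \<le> (5 * (2 * ln x)) ^ 8" by (intro power_mono) auto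
  also have "\<dots> = 5 ^ 8 * (2 * ln x) powr (real 8)" using lx by (subst powr_realpow) (auto simp: power_mult_distrib)
  \<comment> \<open>The exponent is raised on the base 2 ln x, which is at least 1, whereas ln x
    itself is below 1 for x near 2.\<close>
  also have "\<dots> \<le> 5 ^ 8 * (2 * ln x) powr 65.25" using lx by (intro mult_left_mono powr_mono) auto
  also have "(2 * ln x) powr 65.25 = 2 powr 65.25 * ln x powr 65.25" using lx by (subst powr_mult) auto
  finally have K8: "(real K + 2) ^ 8 \<le> 5 ^ 8 * 2 powr 65.25 * ln x powr 65.25" by (simp only: mult.assoc)
  have "(\<Sum>d\<in>moduli D. norm (A_sum \<gamma> d x - M_main \<gamma> d x))
    \<le> 10 ^ 6 * (real K + 2) ^ 8 * (D powr (1/4) * (sqrt x * base_bound) powr (3/4))"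
    using D by (intro sum_norm_A_minus_M_le xK) (auto simp: sqrt_times_base_bound)
  also have "(sqrt x * base_bound) powr (3/4) = x powr (3 * (real r + 1) / (8 * real r))"
    unfolding sqrt_times_base_bound using assms by (simp add: powr_powr mult.commute)
  also have "10 ^ 6 * (real K + 2) ^ 8 * (D powr (1/4) * x powr (3 * (real r + 1) / (8 * real r)))
    \<le> 10 ^ 6 * (5 ^ 8 * 2 powr 65.25 * ln x powr 65.25) * (D powr (1/4) * x powr (3 * (real r + 1) / (8 * real r)))"
    by (intro mult_right_mono mult_left_mono K8) auto
  also have "\<dots> = 10 ^ 6 * (5 ^ 8 * 2 powr 65.25) * (D powr (1/4) * x powr (3 * (real r + 1) / (8 * real r)) * ln x powr 65.25)"
    by (simp only: mult_ac)
  finally show "(\<Sum>d\<in>moduli D. norm (A_sum \<gamma> d x - M_main \<gamma> d x))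
    \<le> 10 ^ 6 * (5 ^ 8 * 2 powr 65.25) * (D powr (1/4) * x powr (3 * (real r + 1) / (8 * real r)) * ln x powr 65.25)" .
qed

end
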